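(* Let $A:D(A)\subset H\to H$ be the generator of a strongly continuous semigroup $(T(t))_{t\ge 0}$ on $H$; let $\mathscr{C}:\mathscr{Z}\subset H\to H$ be a linear operator with $D(A)\subset\mathscr{Z}\subset H$ such that $C:=\mathscr{C}|_{D(A)}\in\mathcal{L}(D(A),H)$ is an admissible operator for $A$; and let $F:H\to H$ and $\mathscr{M}:H\to L_2^0(V,H)$ be (nonlinear) maps for which there is $k>0$ with $\|F(x)-F(y)\|+\|\mathscr{M}(x)-\mathscr{M}(y)\|_2\le k\|x-y\|$ for all $x,y\in H$. Let $T>0$, and for $x\in H$ let $X(\cdot,x)\in\mathcal{C}_{\mathcal{F}}([0,T];H)$ denote the unique mild solution of $$dX(t)=[AX(t)+F(\mathscr{C}X(t))]\,dt+\mathscr{M}(X(t))\,dW(t),\quad t\in[0,T],\qquad X(0)=x.$$ For bounded Borel measurable $\phi:H\to\mathbb{R}$ put $P_t\phi(x):=\mathbb{E}(\phi(X(t,x)))$, $t\in[0,T]$, $x\in H$, and let $\mathcal{C}_b(H)$ be the set of bounded continuous functions $\phi:H\to\mathbb{R}$. Then $$P_t\,\mathcal{C}_b(H)\subset\mathcal{C}_b(H)\qquad\text{for all }t\in[0,T].$$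
   Context: $H$ and $V$ are real separable Hilbert spaces. $D(A)$ carries the graph norm. $(\Omega,\mathcal{F},\mathbb{P})$ is a complete probability space with a normal filtration $(\mathcal{F}_t)_{t\ge 0}$. $W(t)=\sum_k\sqrt{\lambda_k}\,\beta_k(t)e_k$ is a $V$-valued $Q$-Wiener process, where $(\beta_k)$ are mutually independent real standard Brownian motions (with respect to the filtration), $(e_k)$ is a complete orthonormal basis of $V$, $\lambda_k\ge 0$, $Qe_k=\lambda_ke_k$ and $\operatorname{tr}Q=\sum_k\lambda_k<\infty$. $L_2^0(V,H)$ is the space of Hilbert-Schmidt operators from $Q^{1/2}(V)$ to $H$, with norm $\|D\|_2=\big(\sum_k\|\sqrt{\lambda_k}De_k\|^2\big)^{1/2}$. $\mathcal{C}_{\mathcal{F}}([0,T];H)$ is the space of $\mathcal{F}_t$-adapted, $H$-valued measurable processes $u(t,\omega)$ on $[0,T]$ such that $t\mapsto(\mathbb{E}\|u(t)\|^2)^{1/2}$ is continuous. Admissibility: $C\in\mathcal{L}(D(A),H)$ is admissible for $A$ if for some (hence all) $\alpha>0$ there is $\gamma(\alpha)>0$ with $\int_0^\alpha\|CT(t)x\|^2dt\le\gamma(\alpha)^2\|x\|^2$ for all $x\in D(A)$. Yosida extension of $C$ for $A$: $D(C_\Lambda)=\{x\in H:\lim_{\lambda\in\mathbb{R},\,\lambda\to+\infty}C\lambda(\lambda-A)^{-1}x\text{ exists in }H\}$ and $C_\Lambda x$ is this limit. The unique mild solution is the unique $X\in\mathcal{C}_{\mathcal{F}}([0,T];H)$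 such that $X(t)\in D(C_\Lambda)$ for a.e. $t\in[0,T]$, $\mathbb{P}$-a.s., $X$ and $C_\Lambda X$ are measurable with $\int_0^T\|X(t)\|^2dt<\infty$ and $\int_0^T\|C_\Lambda X(t)\|^2dt<\infty$ $\mathbb{P}$-a.s., and $X(t)=T(t)x+\int_0^tT(t-s)F(C_\Lambda X(s))\,ds+\int_0^tT(t-s)\mathscr{M}(X(s))\,dW(s)$ for all $t\in[0,T]$, $\mathbb{P}$-a.s. (its existence and uniqueness under the stated hypotheses is an earlier theorem of the paper). *)

theory Defs
  imports "HOL-Probability.Probability"
begin

section \<open>Semigroups, admissibility and the Yosida extension\<close>

definition C0_semigroup :: "(real \<Rightarrow> 'h \<Rightarrow>\<^sub>L 'h::banach) \<Rightarrow> bool" where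
  "C0_semigroup S \<longleftrightarrow>
     S 0 = id_blinfun \<and>
     (\<forall>s\<ge>0. \<forall>t\<ge>0. S (s + t) = S s o\<^sub>L S t) \<and>
     (\<forall>x. ((\<lambda>t. S t x) \<longlongrightarrow> x) (at_right 0))"

text \<open>Unbounded operators are pairs of a total function and a domain; values off the domain
  are irrelevant.\<close>

definition generator :: "(real \<Rightarrow> 'h \<Rightarrow>\<^sub>L 'h::banach) \<Rightarrow> 'h set \<Rightarrow> ('h \<Rightarrow> 'h) \<Rightarrow> bool" where
  "generator S DA A \<longleftrightarrow>
     DA = {x. \<exists>y. ((\<lambda>t. (S t x - x) /\<^sub>R t) \<longlongrightarrow> y) (at_right 0)} \<and>
     (\<forall>x\<in>DA. ((\<lambda>t. (S t x - x) /\<^sub>R t) \<longlongrightarrow> A x) (at_right 0))"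

definition linear_on_subspace :: "'a::real_vector set \<Rightarrow> ('a \<Rightarrow> 'b::real_vector) \<Rightarrow> bool" where
  "linear_on_subspace Z L \<longleftrightarrow>
     subspace Z \<and>
     (\<forall>x\<in>Z. \<forall>y\<in>Z. L (x + y) = L x + L y) \<and>
     (\<forall>c. \<forall>x\<in>Z. L (c *\<^sub>R x) = c *\<^sub>R L x)"

definition graph_norm :: "('h \<Rightarrow> 'h) \<Rightarrow> 'h::real_normed_vector \<Rightarrow> real" where
  "graph_norm A x = norm x + norm (A x)"

definition graph_bounded_linear ::
  "'h set \<Rightarrow> ('h \<Rightarrow> 'h) \<Rightarrow> ('h::real_normed_vector \<Rightarrow> 'h) \<Rightarrow> bool" where
  "graph_bounded_linear DA A C \<longleftrightarrow>
     linear_on_subspace DA C \<and> (\<exists>K. \<forall>x\<in>DA. norm (C x) \<le> K * graph_norm A x)"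

definition admissible ::
  "(real \<Rightarrow> 'h \<Rightarrow>\<^sub>L 'h::banach) \<Rightarrow> 'h set \<Rightarrow> ('h \<Rightarrow> 'h) \<Rightarrow> ('h \<Rightarrow> 'h) \<Rightarrow> bool" where
  "admissible S DA A C \<longleftrightarrow>
     graph_bounded_linear DA A C \<and>
     (\<exists>\<alpha>>0. \<exists>\<gamma>>0. \<forall>x\<in>DA.
        (\<integral>\<^sup>+t\<in>{0..\<alpha>}. ennreal ((norm (C (S t x)))\<^sup>2) \<partial>lborel) \<le> ennreal (\<gamma>\<^sup>2 * (norm x)\<^sup>2))"

text \<open>The inverse below is only meaningful for \<open>l\<close> in the resolvent set, which contains all
  sufficiently large reals when \<open>A\<close> generates a strongly continuous semigroup.\<close>

definition resolvent :: "'h set \<Rightarrow> ('h \<Rightarrow> 'h) \<Rightarrow> real \<Rightarrow> 'h::real_vector \<Rightarrow> 'h" where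
  "resolvent DA A l x = (THE y. y \<in> DA \<and> l *\<^sub>R y - A y = x)"

definition yosida_dom ::
  "'h set \<Rightarrow> ('h \<Rightarrow> 'h) \<Rightarrow> ('h \<Rightarrow> 'h) \<Rightarrow> 'h::real_normed_vector set" where
  "yosida_dom DA A C = {x. \<exists>y. ((\<lambda>l. C (l *\<^sub>R resolvent DA A l x)) \<longlongrightarrow> y) at_top}"

definition yosida_ext ::
  "'h set \<Rightarrow> ('h \<Rightarrow> 'h) \<Rightarrow> ('h \<Rightarrow> 'h) \<Rightarrow> 'h::real_normed_vector \<Rightarrow> 'h" where
  "yosida_ext DA A C x =
     (if x \<in> yosida_dom DA A C then Lim at_top (\<lambda>l. C (l *\<^sub>R resolvent DA A l x)) else 0)"


section \<open>Filtrations and Q-Wiener processes\<close>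

text \<open>Time is \<open>real\<close>, but only the \<open>\<F> t\<close> with \<open>t \<ge> 0\<close> matter.\<close>

definition normal_filtration :: "'w measure \<Rightarrow> (real \<Rightarrow> 'w measure) \<Rightarrow> bool" where
  "normal_filtration M \<F> \<longleftrightarrow>
     (\<forall>t\<ge>0. subalgebra M (\<F> t)) \<and>
     (\<forall>s\<ge>0. \<forall>t\<ge>s. sets (\<F> s) \<subseteq> sets (\<F> t)) \<and>
     null_sets M \<subseteq> sets (\<F> 0) \<and>
     (\<forall>t\<ge>0. sets (\<F> t) = (\<Inter>s\<in>{t<..}. sets (\<F> s)))"

definition indep_of_past ::
  "'w measure \<Rightarrow> (real \<Rightarrow> 'w measure) \<Rightarrow> real \<Rightarrow> ('w \<Rightarrow> 'b::topological_space) \<Rightarrow> bool" where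
  "indep_of_past M \<F> s Y \<longleftrightarrow>
     prob_space.indep_set M (sets (\<F> s)) (sets (vimage_algebra (space M) Y borel))"

definition brownian_motion ::
  "'w measure \<Rightarrow> (real \<Rightarrow> 'w measure) \<Rightarrow> (real \<Rightarrow> 'w \<Rightarrow> real) \<Rightarrow> bool" where
  "brownian_motion M \<F> B \<longleftrightarrow>
     (AE \<omega> in M. B 0 \<omega> = 0) \<and>
     (AE \<omega> in M. continuous_on {0..} (\<lambda>t. B t \<omega>)) \<and>
     (\<forall>t\<ge>0. B t \<in> borel_measurable (\<F> t)) \<and>
     (\<forall>s\<ge>0. \<forall>t>s.
        distributed M lborel (\<lambda>\<omega>. B t \<omega> - B s \<omega>) (normal_density 0 (sqrt (t - s))) \<and>
        indep_of_past M \<F> s (\<lambda>\<omega>. B t \<omega> - B s \<omega>))"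

definition orthonormal_basis :: "nat set \<Rightarrow> (nat \<Rightarrow> 'v::real_inner) \<Rightarrow> bool" where
  "orthonormal_basis I e \<longleftrightarrow>
     (\<forall>j\<in>I. \<forall>k\<in>I. e j \<bullet> e k = (if j = k then 1 else 0)) \<and>
     closure (span (e ` I)) = UNIV"

text \<open>The basis is indexed by a set \<open>I\<close> of naturals, so that finite-dimensional \<open>V\<close> is covered
  too.  Independence of the increments of \<open>W\<close> (not just of each \<open>\<beta> k\<close>) from the past is the usual
  meaning of a Q-Wiener process with respect to a filtration.\<close>

definition Q_wiener ::
  "'w measure \<Rightarrow> (real \<Rightarrow> 'w measure) \<Rightarrow> ('v \<Rightarrow>\<^sub>L 'v) \<Rightarrow> nat set \<Rightarrow> (nat \<Rightarrow> real) \<Rightarrow>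
   (nat \<Rightarrow> 'v) \<Rightarrow> (nat \<Rightarrow> real \<Rightarrow> 'w \<Rightarrow> real) \<Rightarrow>
   (real \<Rightarrow> 'w \<Rightarrow> 'v::{real_inner,banach,second_countable_topology}) \<Rightarrow> bool" where
  "Q_wiener M \<F> Q I lam e \<beta> W \<longleftrightarrow>
     orthonormal_basis I e \<and>
     (\<forall>k\<in>I. lam k \<ge> 0 \<and> Q (e k) = lam k *\<^sub>R e k) \<and>
     lam summable_on I \<and>
     (\<forall>k\<in>I. brownian_motion M \<F> (\<beta> k)) \<and>
     prob_space.indep_vars M (\<lambda>k. PiM {0..} (\<lambda>_. borel)) (\<lambda>k \<omega>. \<lambda>t\<in>{0..}. \<beta> k t \<omega>) I \<and>
     (\<forall>t\<ge>0. AE \<omega> in M. ((\<lambda>k. (sqrt (lam k) * \<beta> k t \<omega>) *\<^sub>R e k) has_sum W t \<omega>) I) \<and>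
     (AE \<omega> in M. continuous_on {0..} (\<lambda>t. W t \<omega>)) \<and>
     (\<forall>t\<ge>0. W t \<in> borel_measurable (\<F> t)) \<and>
     (\<forall>s\<ge>0. \<forall>t>s. indep_of_past M \<F> s (\<lambda>\<omega>. W t \<omega> - W s \<omega>))"


section \<open>Hilbert-Schmidt operators on the range of the square root of Q\<close>

text \<open>\<open>Q\<close> is diagonal in the basis \<open>e\<close>, so its nonnegative square root is given by the series below.\<close>

definition Q_half ::
  "nat set \<Rightarrow> (nat \<Rightarrow> real) \<Rightarrow> (nat \<Rightarrow> 'v) \<Rightarrow> 'v \<Rightarrow> 'v::{real_inner,banach}" where
  "Q_half I lam e u = (\<Sum>\<^sub>\<infinity>k\<in>I. (sqrt (lam k) * (u \<bullet> e k)) *\<^sub>R e k)"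

text \<open>An operator on the range of \<open>Q_half\<close> is a total function whose values off that range are
  irrelevant.  The range carries the norm \<open>inf {norm u |u. Q_half u = v}\<close>, hence \<open>D\<close> is bounded
  linear there iff \<open>D\<close> composed with \<open>Q_half\<close> is bounded linear on \<open>V\<close>.  The \<open>sqrt (lam k) *\<^sub>R e k\<close>
  with \<open>lam k > 0\<close> form an orthonormal basis of the range; if \<open>lam k = 0\<close> then \<open>e k\<close> need not lie in
  the range, but its contribution below vanishes.\<close>

definition L20 ::
  "nat set \<Rightarrow> (nat \<Rightarrow> real) \<Rightarrow> (nat \<Rightarrow> 'v::{real_inner,banach}) \<Rightarrow>
   ('v \<Rightarrow> 'h::real_normed_vector) set" where
  "L20 I lam e = {D. bounded_linear (\<lambda>u. D (Q_half I lam e u)) \<and>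
                     (\<lambda>k. (norm (sqrt (lam k) *\<^sub>R D (e k)))\<^sup>2) summable_on I}"

definition HS_norm ::
  "nat set \<Rightarrow> (nat \<Rightarrow> real) \<Rightarrow> (nat \<Rightarrow> 'v) \<Rightarrow> ('v \<Rightarrow> 'h::real_normed_vector) \<Rightarrow> real" where
  "HS_norm I lam e D = sqrt (\<Sum>\<^sub>\<infinity>k\<in>I. (norm (sqrt (lam k) *\<^sub>R D (e k)))\<^sup>2)"


section \<open>The stochastic integral\<close>

text \<open>A list of tuples \<open>(a, b, E, B)\<close> encodes the elementary process which is the sum of the
  \<open>1\<^bsub>(a,b]\<^esub>(s) 1\<^bsub>E\<^esub>(\<omega>) B\<close>, where \<open>B\<close> is a bounded operator from \<open>V\<close> to \<open>H\<close> and \<open>E\<close> is an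
  event known at time \<open>a\<close>.\<close>

type_synonym ('w, 'v, 'h) elementary = "(real \<times> real \<times> 'w set \<times> ('v \<Rightarrow>\<^sub>L 'h)) list"

definition elementary :: "(real \<Rightarrow> 'w measure) \<Rightarrow>
    ('w, 'v::real_normed_vector, 'h::real_normed_vector) elementary \<Rightarrow> bool" where
  "elementary \<F> p \<longleftrightarrow> (\<forall>(a, b, E, B)\<in>set p. 0 \<le> a \<and> a \<le> b \<and> E \<in> sets (\<F> a))"

definition elem_process :: "('w, 'v::real_normed_vector, 'h::real_normed_vector) elementary \<Rightarrow>
    real \<Rightarrow> 'w \<Rightarrow> 'v \<Rightarrow> 'h" where
  "elem_process p s \<omega> v = (\<Sum>(a, b, E, B)\<leftarrow>p. (indicator {a<..b} s * indicator E \<omega>) *\<^sub>R B v)"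

definition elem_integral :: "(real \<Rightarrow> 'w \<Rightarrow> 'v) \<Rightarrow>
    ('w, 'v::real_normed_vector, 'h::real_normed_vector) elementary \<Rightarrow> real \<Rightarrow> 'w \<Rightarrow> 'h" where
  "elem_integral W p t \<omega> =
     (\<Sum>(a, b, E, B)\<leftarrow>p. indicator E \<omega> *\<^sub>R B (W (min b t) \<omega> - W (min a t) \<omega>))"

text \<open>\<open>has_stoch_integral \<dots> \<Phi> t Y\<close>: the adapted measurable process \<open>\<Phi>\<close> with values in \<open>L20\<close> is a
  limit of elementary processes in mean square on \<open>[0,t]\<close>, and \<open>Y\<close> is the mean square limit of
  their integrals, i.e. \<open>Y\<close> is the Ito integral of \<open>\<Phi>\<close> over \<open>[0,t]\<close> with respect to \<open>W\<close>.
  No localisation is needed, as the integrands of interest are square integrable on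
  \<open>[0,t] \<times> \<Omega>\<close>.\<close>

definition has_stoch_integral ::
  "'w measure \<Rightarrow> (real \<Rightarrow> 'w measure) \<Rightarrow> nat set \<Rightarrow> (nat \<Rightarrow> real) \<Rightarrow> (nat \<Rightarrow> 'v) \<Rightarrow>
   (real \<Rightarrow> 'w \<Rightarrow> 'v::{real_inner,banach,second_countable_topology}) \<Rightarrow>
   (real \<Rightarrow> 'w \<Rightarrow> 'v \<Rightarrow> 'h::{real_inner,banach,second_countable_topology}) \<Rightarrow>
   real \<Rightarrow> ('w \<Rightarrow> 'h) \<Rightarrow> bool" where
  "has_stoch_integral M \<F> I lam e W \<Phi> t Y \<longleftrightarrow>
     (\<forall>s\<in>{0..t}. \<forall>\<omega>\<in>space M. \<Phi> s \<omega> \<in> L20 I lam e) \<and>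
     (\<forall>k\<in>I. (\<lambda>(s, \<omega>). sqrt (lam k) *\<^sub>R \<Phi> s \<omega> (e k))
              \<in> borel_measurable (restrict_space borel {0..t} \<Otimes>\<^sub>M M)) \<and>
     (\<forall>k\<in>I. \<forall>s\<in>{0..t}. (\<lambda>\<omega>. sqrt (lam k) *\<^sub>R \<Phi> s \<omega> (e k)) \<in> borel_measurable (\<F> s)) \<and>
     Y \<in> borel_measurable M \<and>
     (\<exists>p. (\<forall>n. elementary \<F> (p n)) \<and>
          (\<lambda>n. \<integral>\<^sup>+\<omega>. (\<integral>\<^sup>+s\<in>{0..t}.
              ennreal ((HS_norm I lam e (\<lambda>v. elem_process (p n) s \<omega> v - \<Phi> s \<omega> v))\<^sup>2) \<partial>lborel) \<partial>M)
            \<longlonglongrightarrow> 0 \<and>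
          (\<lambda>n. \<integral>\<^sup>+\<omega>. ennreal ((norm (elem_integral W (p n) t \<omega> - Y \<omega>))\<^sup>2) \<partial>M) \<longlonglongrightarrow> 0)"


section \<open>Mild solutions and the transition operators\<close>

definition C_adapted :: "'w measure \<Rightarrow> (real \<Rightarrow> 'w measure) \<Rightarrow> real \<Rightarrow>
    (real \<Rightarrow> 'w \<Rightarrow> 'h::{real_inner,banach,second_countable_topology}) set" where
  "C_adapted M \<F> T = {u.
     (\<lambda>(t, \<omega>). u t \<omega>) \<in> borel_measurable (restrict_space borel {0..T} \<Otimes>\<^sub>M M) \<and>
     (\<forall>t\<in>{0..T}. u t \<in> borel_measurable (\<F> t)) \<and>
     (\<forall>t\<in>{0..T}. integrable M (\<lambda>\<omega>. (norm (u t \<omega>))\<^sup>2)) \<and>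
     continuous_on {0..T} (\<lambda>t. sqrt (\<integral>\<omega>. (norm (u t \<omega>))\<^sup>2 \<partial>M))}"

text \<open>The exceptional null set of the integral equation may depend on \<open>t\<close>, as processes in
  \<open>C_adapted\<close> are only determined up to modification.\<close>

definition mild_solution ::
  "'w measure \<Rightarrow> (real \<Rightarrow> 'w measure) \<Rightarrow>
   nat set \<Rightarrow> (nat \<Rightarrow> real) \<Rightarrow> (nat \<Rightarrow> 'v) \<Rightarrow>
   (real \<Rightarrow> 'w \<Rightarrow> 'v::{real_inner,banach,second_countable_topology}) \<Rightarrow>
   (real \<Rightarrow> 'h \<Rightarrow>\<^sub>L 'h) \<Rightarrow> 'h set \<Rightarrow> ('h \<Rightarrow> 'h) \<Rightarrow> ('h \<Rightarrow> 'h) \<Rightarrow>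
   ('h \<Rightarrow> 'h) \<Rightarrow> ('h \<Rightarrow> 'v \<Rightarrow> 'h) \<Rightarrow> real \<Rightarrow> 'h \<Rightarrow>
   (real \<Rightarrow> 'w \<Rightarrow> 'h::{real_inner,banach,second_countable_topology}) \<Rightarrow> bool" where
  "mild_solution M \<F> I lam e W S DA A C F \<M> T x X \<longleftrightarrow>
     X \<in> C_adapted M \<F> T \<and>
     (AE \<omega> in M. AE t\<in>{0..T} in lborel. X t \<omega> \<in> yosida_dom DA A C) \<and>
     (\<lambda>(t, \<omega>). yosida_ext DA A C (X t \<omega>))
        \<in> borel_measurable (restrict_space borel {0..T} \<Otimes>\<^sub>M M) \<and>
     (AE \<omega> in M. (\<integral>\<^sup>+t\<in>{0..T}. ennreal ((norm (X t \<omega>))\<^sup>2) \<partial>lborel) < \<infinity>) \<and>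
     (AE \<omega> in M. (\<integral>\<^sup>+t\<in>{0..T}. ennreal ((norm (yosida_ext DA A C (X t \<omega>)))\<^sup>2) \<partial>lborel) < \<infinity>) \<and>
     (\<forall>t\<in>{0..T}. \<exists>Y.
        has_stoch_integral M \<F> I lam e W (\<lambda>s \<omega> v. S (t - s) (\<M> (X s \<omega>) v)) t Y \<and>
        (AE \<omega> in M. X t \<omega> =
           S t x + (LINT s:{0..t}|lborel. S (t - s) (F (yosida_ext DA A C (X s \<omega>)))) + Y \<omega>))"

definition transition ::
  "'w measure \<Rightarrow> ('h \<Rightarrow> real \<Rightarrow> 'w \<Rightarrow> 'h) \<Rightarrow> real \<Rightarrow> ('h \<Rightarrow> real) \<Rightarrow> 'h \<Rightarrow> real" where
  "transition M X t \<phi> x = (\<integral>\<omega>. \<phi> (X x t \<omega>) \<partial>M)"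

end

theory Submission
  imports Defs
begin

text \<open>
  Solutions started at \<open>x\<close> and \<open>y\<close> satisfy \<open>E \<parallel>X x t - X y t\<parallel>\<^sup>2 \<le> B * \<parallel>x - y\<parallel>\<^sup>2\<close> for
  \<open>t \<in> {0..T}\<close>, with \<open>B\<close> depending on the data of the equation only (\<open>mean_square_dependence\<close>).
  Hence \<open>X x t\<close> depends continuously on \<open>x\<close> in mean square, and the expectation of a bounded continuous
  function of it depends continuously on \<open>x\<close> (\<open>expectation_continuous_of_mean_square\<close>).

  For the mean square estimate let \<open>D\<close> be the difference of the two solutions and \<open>h\<close> the difference of
  their observations by the Yosida extension of \<open>C\<close>.  The variation of constants formula gives
  \<open>D t = S t (x - y) + cv t + Z t\<close>, where \<open>cv\<close> is the convolution of the semigroup with the difference of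
  the drifts and \<open>Z\<close> that of the stochastic convolutions.  The difference of the drifts is at most
  \<open>k * \<parallel>h\<parallel>\<close> in norm, so \<open>h\<close> has to be estimated, although it is an unbounded function of \<open>D\<close>.  Three
  observations make this possible.

  \<^item> The Yosida extension is the limit of the bounded operators \<open>Y n = C l R(l)\<close> with \<open>l\<close> tending to
    infinity.  As \<open>l R(l)\<close> averages the semigroup over an exponential distribution, the \<open>Y n\<close> are admissible
    with one constant \<open>cT\<close> (\<open>Y_admissible\<close>).  A mild solution lies in the domain of the Yosida extension at
    almost all times, so Fatou's lemma transfers estimates of \<open>Y n (D t)\<close> that are uniform in \<open>n\<close> to \<open>h\<close>.

  \<^item> Convolution with the semigroup followed by \<open>Y n\<close> has squared norm at most \<open>cT / (2 * \<mu>)\<close> in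
    \<open>L\<^sup>2\<close> with weight \<open>exp (- 2 * \<mu> * t)\<close>.  For large \<open>\<mu>\<close> the contribution of \<open>cv\<close> to the weighted norm of
    \<open>h\<close> is at most half of that norm and can be absorbed.  This is done path by path
    (\<open>observation_pathwise\<close>), because the definition of a mild solution makes the norm finite almost surely
    but says nothing about its expectation.

  \<^item> What remains is \<open>Y n (Z t)\<close>.  Its expected energy is bounded by the time integral of
    \<open>E \<parallel>D s\<parallel>\<^sup>2\<close>, by the Ito inequality and admissibility once more (\<open>noise_observation\<close>).

  Inserting these bounds into the formula for \<open>D\<close> bounds \<open>E \<parallel>D t\<parallel>\<^sup>2\<close> by a multiple of
  \<open>\<parallel>x - y\<parallel>\<^sup>2\<close> plus a multiple of its own time integral, and Gronwall's inequality concludes.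
  The Ito inequality itself is derived from the covariances of the increments of the Brownian motions;
  the resolvent is identified with the Laplace transform of the semigroup.
\<close>

abbreviation normsq :: "'a::real_normed_vector \<Rightarrow> ennreal" where
  "normsq x \<equiv> ennreal ((norm x)\<^sup>2)"

section \<open>The uniform boundedness principle\<close>

text \<open>
  A displacement \<open>u\<close> of length \<open>r\<close> nearly attaining the norm of \<open>B\<close> satisfies
  \<open>2 * B u = B (x + u) - B (x - u)\<close>, so one of the two points \<open>x + u\<close>, \<open>x - u\<close> has a large image,
  wherever the centre \<open>x\<close> lies.\<close>

lemma blinfun_half_ball:
  fixes B :: "'a::real_normed_vector \<Rightarrow>\<^sub>L 'b::real_normed_vector"
  assumes r: "r > 0"
  shows "\<exists>y. norm (y - x) \<le> r \<and> norm (B y) \<ge> r * norm B / 2"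
proof (cases "norm B = 0")
  case True
  then show ?thesis using r by (intro exI[of _ x]) auto
next
  case False
  then have pos: "norm B > 0" by simp
  have "\<exists>v. norm (B v) > norm B / 2 * norm v"
  proof (rule ccontr)
    assume "\<nexists>v. norm B / 2 * norm v < norm (B v)"
    then have "norm (B v) \<le> norm B / 2 * norm v" for v by (meson not_less)
    then have "norm B \<le> norm B / 2" using pos by (intro norm_blinfun_bound) auto
    with pos show False by simp
  qed
  then obtain v where v: "norm (B v) > norm B / 2 * norm v" by blast
  have v0: "norm v > 0"
  proof (rule ccontr)
    assume "\<not> norm v > 0"
    then have "v = 0" by simp
    with v show False by (simp add: blinfun.zero_right)
  qed
  define u where "u = (r / norm v) *\<^sub>R v"
  have nu: "norm u = r" using r v0 by (simp add: u_def)
  have "norm (B u) = r / norm v * norm (B v)" using r v0 by (simp add: u_def blinfun.scaleR_right)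
  also have "\<dots> \<ge> r / norm v * (norm B / 2 * norm v)"
    using v r v0 by (intro mult_left_mono) auto
  finally have Bu: "norm (B u) \<ge> r * norm B / 2" using v0 by simp
  have "B u = (1/2) *\<^sub>R (B (x + u) - B (x - u))"
    by (simp add: blinfun.add_right blinfun.diff_right flip: scaleR_2)
  then have "norm (B u) \<le> (norm (B (x + u)) + norm (B (x - u))) / 2"
    using norm_triangle_ineq4[of "B (x + u)" "B (x - u)"] by simp
  then have "norm (B (x + u)) \<ge> r * norm B / 2 \<or> norm (B (x - u)) \<ge> r * norm B / 2"
    using Bu by argo
  then show ?thesis
    by (elim disjE; intro exI[of _ "x + u"] exI[of _ "x - u"] conjI) (auto simp: nu)
qed

text \<open>
  A gliding hump argument: if the norms of \<open>B n\<close> are unbounded, pick operators of norm at least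
  \<open>12 ^ n\<close> and move by at most \<open>(1/4) ^ n\<close> at stage \<open>n\<close> to a point with image of norm at least
  \<open>3 ^ n / 2\<close>.  All later moves together have length at most \<open>(1/3) * (1/4) ^ n\<close>, so the limit of the
  points still has images of norm at least \<open>3 ^ n / 6\<close>.\<close>

lemma uniform_boundedness:
  fixes B :: "nat \<Rightarrow> 'a::banach \<Rightarrow>\<^sub>L 'b::real_normed_vector"
  assumes bdd: "\<And>x. bounded (range (\<lambda>n. B n x))"
  shows "bounded (range B)"
proof (rule ccontr)
  assume unb: "\<not> bounded (range B)"
  have "\<exists>n. norm (B n) \<ge> c" for c
    using unb unfolding bounded_iff by (metis le_cases rangeE)
  then obtain g where g: "\<And>c. norm (B (g c)) \<ge> c" by metis
  define \<nu> where "\<nu> n = g (12 ^ n)" for n :: nat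
  have \<nu>: "norm (B (\<nu> n)) \<ge> 12 ^ n" for n using g by (simp add: \<nu>_def)
  have "\<exists>z. \<forall>n. norm (z (Suc n) - z n) \<le> (1/4)^n \<and> norm (B (\<nu> n) (z (Suc n))) \<ge> (1/4)^n * norm (B (\<nu> n)) / 2"
    using dependent_nat_choice[of "\<lambda>_ _. True" "\<lambda>n x y. norm (y - x) \<le> (1/4)^n \<and> norm (B (\<nu> n) y) \<ge> (1/4)^n * norm (B (\<nu> n)) / 2"]
      blinfun_half_ball[of "(1/4)^n" for n :: nat] by fastforce
  then obtain z where z1: "\<And>n. norm (z (Suc n) - z n) \<le> (1/4)^n"
    and z2: "\<And>n. norm (B (\<nu> n) (z (Suc n))) \<ge> (1/4)^n * norm (B (\<nu> n)) / 2" by blast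
  have tail: "norm (z (m + n) - z n) \<le> (4/3) * (1/4)^n * (1 - (1/4)^m)" for m n
  proof (induction m)
    case (Suc m)
    have "norm (z (Suc m + n) - z n) \<le> norm (z (Suc (m + n)) - z (m + n)) + norm (z (m + n) - z n)"
      using norm_triangle_ineq[of "z (Suc (m + n)) - z (m + n)" "z (m + n) - z n"] by simp
    also have "\<dots> \<le> (1/4)^(m+n) + (4/3) * (1/4)^n * (1 - (1/4)^m)"
      using z1[of "m + n"] Suc by simp
    also have "\<dots> = (4/3) * (1/4)^n * (1 - (1/4)^(Suc m))"
      by (simp add: power_add field_simps)
    finally show ?case .
  qed simp
  have tail': "norm (z (m + n) - z n) \<le> (4/3) * (1/4)^n" for m n
  proof -
    have "(4/3) * (1/4::real)^n * (1 - (1/4)^m) \<le> (4/3) * (1/4)^n * 1"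
      by (rule mult_left_mono) auto
    from order_trans[OF tail this] show ?thesis unfolding mult_1_right .
  qed
  have "Cauchy z"
  proof (rule metric_CauchyI)
    fix e :: real assume e: "e > 0"
    obtain N where N: "(1/4::real)^N < e / 3" using real_arch_pow_inv[of "e/3" "1/4"] e by auto
    show "\<exists>M. \<forall>m\<ge>M. \<forall>n\<ge>M. dist (z m) (z n) < e"
    proof (intro exI[of _ N] allI impI)
      fix m n assume mn: "N \<le> m" "N \<le> n"
      define p where "p = (1/4::real)^N"
      have "norm (z m - z N) \<le> (4/3) * p" "norm (z n - z N) \<le> (4/3) * p"
        unfolding p_def using tail'[of "m - N" N] tail'[of "n - N" N] mn by auto
      moreover have "0 \<le> p" "p < e / 3" using N by (auto simp: p_def)
      ultimately show "dist (z m) (z n) < e"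
        using norm_triangle_ineq4[of "z m - z N" "z n - z N"] by (simp add: dist_norm)
    qed
  qed
  then obtain x where x: "z \<longlonglongrightarrow> x" using Cauchy_convergent convergent_def by blast
  have dx: "norm (x - z n) \<le> (4/3) * (1/4)^n" for n
  proof (rule LIMSEQ_le_const2)
    show "(\<lambda>m. norm (z (m + n) - z n)) \<longlonglongrightarrow> norm (x - z n)"
      by (intro tendsto_intros LIMSEQ_ignore_initial_segment x)
  qed (use tail' in auto)
  obtain c where c: "\<And>n. norm (B n x) \<le> c" using bdd[of x] unfolding bounded_iff by auto
  have lower: "3 ^ n \<le> 6 * c" for n :: nat
  proof -
    let ?B = "B (\<nu> n)"
    have "norm (?B (z (Suc n)) - ?B x) \<le> norm ?B * norm (z (Suc n) - x)"
      by (metis blinfun.diff_right norm_blinfun)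
    also have "\<dots> \<le> norm ?B * ((1/3) * (1/4)^n)"
      using dx[of "Suc n"] by (intro mult_left_mono) (auto simp: norm_minus_commute)
    finally have "norm (?B x) \<ge> (1/4)^n * norm ?B / 2 - norm ?B * ((1/3) * (1/4)^n)"
      using z2[of n] norm_triangle_ineq2[of "?B (z (Suc n))" "?B x"] by linarith
    also have "(1/4)^n * norm ?B / 2 - norm ?B * ((1/3) * (1/4)^n) = (1/6) * ((1/4)^n * norm ?B)"
      by simp
    finally have "(1/4)^n * norm ?B \<le> 6 * c" using c[of "\<nu> n"] by linarith
    moreover have "(1/4)^n * 12 ^ n \<le> (1/4)^n * norm ?B" using \<nu>[of n] by (intro mult_left_mono) auto
    moreover have "(1/4)^n * 12 ^ n = (3::real) ^ n" by (simp flip: power_mult_distrib)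
    ultimately show ?thesis by simp
  qed
  obtain n where "6 * c < 3 ^ n" using real_arch_pow[of 3 "6 * c"] by auto
  with lower[of n] show False by simp
qed



section \<open>Strongly continuous semigroups\<close>

locale C0_semigroup_op =
  fixes S :: "real \<Rightarrow> 'h \<Rightarrow>\<^sub>L 'h::{banach,second_countable_topology}"
  assumes C0: "C0_semigroup S"
begin

lemma S_0 [simp]: "S 0 x = x"
  and S_add: "0 \<le> s \<Longrightarrow> 0 \<le> t \<Longrightarrow> S (s + t) x = S s (S t x)"
  and S_right: "((\<lambda>t. S t x) \<longlongrightarrow> x) (at_right 0)"
  using C0 by (auto simp: C0_semigroup_def)

text \<open>
  Otherwise there are \<open>t n\<close> tending to \<open>0\<close> with norms of \<open>S (t n)\<close> tending to infinity, although
  \<open>S (t n) x\<close> converges for each \<open>x\<close>.\<close>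

lemma bounded_near_0: "\<exists>\<delta>>0. \<exists>K. \<forall>t\<in>{0..\<delta>}. norm (S t) \<le> K"
proof (rule ccontr)
  assume *: "\<not> (\<exists>\<delta>>0. \<exists>K. \<forall>t\<in>{0..\<delta>}. norm (S t) \<le> K)"
  have "\<exists>t. 0 \<le> t \<and> t \<le> 1 / Suc n \<and> norm (S t) > Suc n" for n :: nat
    using * by (metis atLeastAtMost_iff not_le of_nat_0_less_iff zero_less_Suc zero_less_divide_1_iff)
  then obtain t where t: "\<And>n. 0 \<le> t n" "\<And>n::nat. t n \<le> 1 / Suc n" "\<And>n. norm (S (t n)) > Suc n"
    by metis
  have t0: "t n > 0" for n
  proof -
    have "norm (S 0) \<le> 1" by (rule norm_blinfun_bound) auto
    then have "t n \<noteq> 0" using t(3)[of n] by (metis less_le_not_le of_nat_Suc le_add_same_cancel1 of_nat_0_le_iff order_trans add.commute)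
    then show ?thesis using t(1)[of n] by simp
  qed
  have lim: "filterlim t (at_right 0) sequentially"
  proof -
    have "t \<longlonglongrightarrow> 0"
      by (rule tendsto_sandwich[of "\<lambda>_. 0" _ _ "\<lambda>n. 1 / Suc n"])
         (use t(1,2) LIMSEQ_inverse_real_of_nat in \<open>auto simp: inverse_eq_divide\<close>)
    then show ?thesis using t0 by (auto simp: filterlim_at less_imp_neq[OF t0, symmetric])
  qed
  have "bounded (range (\<lambda>n. S (t n) x))" for x
    using filterlim_compose[OF S_right lim, of x] by (rule convergent_imp_bounded)
  then have "bounded (range (\<lambda>n. S (t n)))" by (rule uniform_boundedness)
  then obtain c where "\<And>n. norm (S (t n)) \<le> c" unfolding bounded_iff by auto
  moreover obtain n where "c < real n" using reals_Archimedean2 by blast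
  ultimately show False using t(3)[of n] by (smt (verit) of_nat_Suc)
qed

lemma exponential_bound: "\<exists>K w. K \<ge> 1 \<and> w \<ge> 0 \<and> (\<forall>t\<ge>0. norm (S t) \<le> K * exp (w * t))"
proof -
  obtain \<delta> K0 where d: "\<delta> > 0" and K0: "\<forall>t\<in>{0..\<delta>}. norm (S t) \<le> K0"
    using bounded_near_0 by blast
  define K where "K = max K0 1"
  have K: "K \<ge> 1" and Kb: "\<And>t. 0 \<le> t \<Longrightarrow> t \<le> \<delta> \<Longrightarrow> norm (S t) \<le> K"
    using K0 by (auto simp: K_def le_max_iff_disj)
  have step: "norm (S (real n * \<delta> + t)) \<le> K ^ Suc n" if "0 \<le> t" "t \<le> \<delta>" for n t
  proof (induction n)
    case 0 then show ?case using Kb that by simp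
  next
    case (Suc n)
    have eq: "S (real (Suc n) * \<delta> + t) = S \<delta> o\<^sub>L S (real n * \<delta> + t)"
      using S_add[of \<delta> "real n * \<delta> + t"] d that by (intro blinfun_eqI) (simp add: algebra_simps)
    have "norm (S (real (Suc n) * \<delta> + t)) \<le> norm (S \<delta>) * norm (S (real n * \<delta> + t))"
      unfolding eq by (rule norm_blinfun_compose)
    also have "\<dots> \<le> K * K ^ Suc n" using Suc Kb[of \<delta>] d K by (intro mult_mono) auto
    finally show ?case by simp
  qed
  define w where "w = ln K / \<delta>"
  have "norm (S t) \<le> K * exp (w * t)" if "t \<ge> 0" for t
  proof -
    define n where "n = nat \<lfloor>t / \<delta>\<rfloor>"
    have "real n = of_int \<lfloor>t / \<delta>\<rfloor>" using that d unfolding n_def by simp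
    then have n: "real n \<le> t / \<delta>" "t / \<delta> \<le> real n + 1" by linarith+
    then have "real n * \<delta> \<le> t" "t \<le> real n * \<delta> + \<delta>" using d by (auto simp: field_simps)
    then have "norm (S t) \<le> K ^ Suc n" using step[of "t - real n * \<delta>" n] by simp
    also have "\<dots> = K * exp (real n * ln K)" using K by (simp add: exp_of_nat_mult)
    also have "\<dots> \<le> K * exp (w * t)"
      using n(1) K mult_right_mono[OF n(1), of "ln K"] by (simp add: w_def mult.commute)
    finally show ?thesis .
  qed
  moreover have "w \<ge> 0" using K d by (simp add: w_def)
  ultimately show ?thesis using K by blast
qed

definition K where "K = (SOME K. \<exists>w\<ge>0. K \<ge> 1 \<and> (\<forall>t\<ge>0. norm (S t) \<le> K * exp (w * t)))"
definition w where "w = (SOME w. w \<ge> 0 \<and> (\<forall>t\<ge>0. norm (S t) \<le> K * exp (w * t)))"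

lemma K_ge_1: "K \<ge> 1" and w_nonneg: "w \<ge> 0"
  and norm_S: "t \<ge> 0 \<Longrightarrow> norm (S t) \<le> K * exp (w * t)"
proof -
  have 1: "\<exists>w\<ge>0. K \<ge> 1 \<and> (\<forall>t\<ge>0. norm (S t) \<le> K * exp (w * t))"
    unfolding K_def by (rule someI_ex) (use exponential_bound in blast)
  then show "K \<ge> 1" by blast
  have 2: "w \<ge> 0 \<and> (\<forall>t\<ge>0. norm (S t) \<le> K * exp (w * t))"
    unfolding w_def by (rule someI_ex) (use 1 in blast)
  then show "w \<ge> 0" "t \<ge> 0 \<Longrightarrow> norm (S t) \<le> K * exp (w * t)" by auto
qed

lemma norm_S_apply: "t \<ge> 0 \<Longrightarrow> norm (S t x) \<le> K * exp (w * t) * norm x"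
  using norm_blinfun[of "S t" x] mult_right_mono[OF norm_S, of t "norm x"] by simp

text \<open>
  Only nonnegative times matter; freezing the semigroup at negative times makes
  \<open>(t, x) \<mapsto> S' t x\<close> continuous, hence Borel measurable, on the whole of \<open>real \<times> 'h\<close>.\<close>

definition S' where "S' t = S (max 0 t)"

lemma S'_eq: "t \<ge> 0 \<Longrightarrow> S' t = S t" by (simp add: S'_def)

text \<open>
  Both one-sided increments have the form \<open>S p (S q x - x)\<close> with \<open>p\<close> the smaller of the two times,
  which reduces continuity everywhere to right continuity at \<open>0\<close> and local boundedness.\<close>

lemma continuous_orbit: "continuous_on UNIV (\<lambda>t. S' t x)"
proof -
  have "isCont (\<lambda>t. S' t x) a" for a
  proof -
    define B where "B = K * exp (w * (\<bar>a\<bar> + 1))"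
    have B: "B > 0" using K_ge_1 by (simp add: B_def)
    have bd: "norm (S' t x - S' a x) \<le> B * norm (S \<bar>max 0 t - max 0 a\<bar> x - x)" if "dist t a < 1" for t
    proof -
      define p q where "p = min (max 0 t) (max 0 a)" and "q = \<bar>max 0 t - max 0 a\<bar>"
      have pq: "p \<ge> 0" "q \<ge> 0" "p \<le> \<bar>a\<bar> + 1" by (auto simp: p_def q_def)
      have "norm (S' t x - S' a x) = norm (S (p + q) x - S p x)"
      proof (cases "max 0 t \<le> max 0 a")
        case True
        then have "p = max 0 t" "p + q = max 0 a" by (auto simp: p_def q_def)
        then show ?thesis by (simp add: S'_def norm_minus_commute)
      next
        case False
        then have "p = max 0 a" "p + q = max 0 t" by (auto simp: p_def q_def)
        then show ?thesis by (simp add: S'_def)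
      qed
      also have "\<dots> = norm (S p (S q x - x))" using pq by (simp add: S_add blinfun.diff_right)
      also have "\<dots> \<le> K * exp (w * p) * norm (S q x - x)" using pq by (intro norm_S_apply)
      also have "\<dots> \<le> B * norm (S q x - x)"
        unfolding B_def using pq K_ge_1 w_nonneg by (intro mult_right_mono mult_left_mono) (auto intro: mult_left_mono)
      finally show ?thesis by (simp add: q_def)
    qed
    show ?thesis unfolding continuous_at_eps_delta
    proof (intro allI impI)
      fix e :: real assume e: "e > 0"
      have "\<forall>\<^sub>F q in at_right 0. dist (S q x) x < e / B"
        using tendstoD[OF S_right, of "e / B" x] e B by simp
      then obtain b where b: "b > 0" "\<And>q. q > 0 \<Longrightarrow> q < b \<Longrightarrow> dist (S q x) x < e / B"
        by (auto simp: eventually_at_right_field)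
      have b': "norm (S q x - x) < e / B" if "q \<ge> 0" "q < b" for q
        using that b(2)[of q] e B by (cases "q = 0") (auto simp: dist_norm)
      show "\<exists>d>0. \<forall>t. dist t a < d \<longrightarrow> dist (S' t x) (S' a x) < e"
      proof (intro exI[of _ "min 1 b"] conjI allI impI)
        fix t assume t: "dist t a < min 1 b"
        have "\<bar>max 0 t - max 0 a\<bar> < b" using t by (auto simp: dist_real_def)
        then have "B * norm (S \<bar>max 0 t - max 0 a\<bar> x - x) < B * (e / B)"
          using b' B by (intro mult_strict_left_mono) auto
        then show "dist (S' t x) (S' a x) < e" using bd[of t] t B by (simp add: dist_norm)
      qed (use b in auto)
    qed
  qed
  then show ?thesis by (simp add: continuous_on_eq_continuous_at)
qed


lemma norm_S'_apply: "norm (S' t x) \<le> K * exp (w * max 0 t) * norm x"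
  unfolding S'_def by (rule norm_S_apply) simp

lemma isCont_S': "isCont (\<lambda>(t, x). S' t x) p"
proof -
  obtain a v where p: "p = (a, v)" by force
  define B where "B = K * exp (w * (\<bar>a\<bar> + 1))"
  have B: "B > 0" using K_ge_1 by (simp add: B_def)
  have l1: "((\<lambda>q. S' (fst q) v) \<longlongrightarrow> S' a v) (at p)"
    using continuous_orbit[of v] tendsto_fst[OF tendsto_ident_at, of p]
    by (intro isCont_tendsto_compose[of a "\<lambda>t. S' t v"]) (auto simp: continuous_on_eq_continuous_at p)
  have l2: "(snd \<longlongrightarrow> v) (at p)" using tendsto_snd[OF tendsto_ident_at, of p] by (simp add: p)
  have "((\<lambda>q. B * norm (snd q - v) + norm (S' (fst q) v - S' a v)) \<longlongrightarrow> B * norm (v - v) + norm (S' a v - S' a v)) (at p)"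
    by (intro tendsto_add tendsto_mult tendsto_const tendsto_norm tendsto_diff l1 l2)
  then have lim: "((\<lambda>q. B * norm (snd q - v) + norm (S' (fst q) v - S' a v)) \<longlongrightarrow> 0) (at p)" by simp
  have ev: "\<forall>\<^sub>F q in at p. dist (fst q) a < 1"
    using tendstoD[OF tendsto_fst[OF tendsto_ident_at, of p], of 1] by (simp add: p)
  have "((\<lambda>q. S' (fst q) (snd q) - S' a v) \<longlongrightarrow> 0) (at p)"
  proof (rule Lim_null_comparison[OF _ lim], rule eventually_mono[OF ev])
    fix q :: "real \<times> 'h" assume q: "dist (fst q) a < 1"
    have "S' (fst q) (snd q) - S' a v = S' (fst q) (snd q - v) + (S' (fst q) v - S' a v)"
      by (simp add: blinfun.diff_right)
    then have "norm (S' (fst q) (snd q) - S' a v) \<le> norm (S' (fst q) (snd q - v)) + norm (S' (fst q) v - S' a v)"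
      using norm_triangle_ineq by metis
    also have "norm (S' (fst q) (snd q - v)) \<le> K * exp (w * max 0 (fst q)) * norm (snd q - v)"
      by (rule norm_S'_apply)
    also have "\<dots> \<le> B * norm (snd q - v)"
      unfolding B_def using q K_ge_1 w_nonneg
      by (intro mult_right_mono mult_left_mono) (auto simp: dist_real_def intro!: mult_left_mono)
    finally show "norm (S' (fst q) (snd q) - S' a v) \<le> B * norm (snd q - v) + norm (S' (fst q) v - S' a v)"
      by simp
  qed
  then show ?thesis by (simp add: isCont_def p case_prod_unfold LIM_zero_iff)
qed

lemma borel_measurable_S' [measurable (raw)]:
  assumes [measurable]: "f \<in> borel_measurable M" "g \<in> borel_measurable M"
  shows "(\<lambda>x. S' (f x) (g x)) \<in> borel_measurable M"
proof -
  have "(\<lambda>p. S' (fst p) (snd p)) \<in> borel_measurable (borel \<Otimes>\<^sub>M borel)"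
    using isCont_S' unfolding borel_prod
    by (intro borel_measurable_continuous_onI) (simp add: continuous_on_eq_continuous_at case_prod_unfold)
  from measurable_compose[OF _ this, of "\<lambda>x. (f x, g x)" M] show ?thesis by simp
qed

end

section \<open>The resolvent as a Laplace transform\<close>

text \<open>
  The kernel of the Laplace transform on the half line, extended by zero to a function on all reals;
  \<open>l * \<kappa> l r\<close> is the density of the exponential distribution.\<close>

definition \<kappa> :: "real \<Rightarrow> real \<Rightarrow> real" where "\<kappa> l r = indicator {0..} r * exp (- l * r)"

lemma \<kappa>_nonneg [simp]: "\<kappa> l r \<ge> 0" by (simp add: \<kappa>_def)

lemma borel_measurable_\<kappa> [measurable]: "\<kappa> l \<in> borel_measurable borel"
  unfolding \<kappa>_def[abs_def] by measurable

lemma nn_integral_\<kappa>: "l > 0 \<Longrightarrow> (\<integral>\<^sup>+r. ennreal (\<kappa> l r) \<partial>lborel) = ennreal (1 / l)"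
proof -
  assume l: "l > 0"
  interpret prob_space "density lborel (exponential_density l)" by (rule prob_space_exponential_density[OF l])
  have "1 = (\<integral>\<^sup>+r. ennreal (exponential_density l r) \<partial>lborel)"
    using emeasure_space_1 by (simp add: emeasure_density)
  also have "\<dots> = (\<integral>\<^sup>+r. ennreal l * ennreal (\<kappa> l r) \<partial>lborel)"
    using l by (intro nn_integral_cong) (auto simp: \<kappa>_def exponential_density_def indicator_def ennreal_mult[symmetric] mult.commute)
  also have "\<dots> = ennreal l * (\<integral>\<^sup>+r. ennreal (\<kappa> l r) \<partial>lborel)" by (rule nn_integral_cmult) simp
  finally have "ennreal (1 / l) * 1 = ennreal (1 / l) * (ennreal l * (\<integral>\<^sup>+r. ennreal (\<kappa> l r) \<partial>lborel))" by simp
  also have "\<dots> = (\<integral>\<^sup>+r. ennreal (\<kappa> l r) \<partial>lborel)"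
    using l by (simp add: mult.assoc[symmetric] ennreal_mult[symmetric])
  finally show ?thesis by simp
qed

lemma integrable_\<kappa>: "l > 0 \<Longrightarrow> integrable lborel (\<kappa> l)"
  by (rule integrableI_nonneg) (auto simp: nn_integral_\<kappa>)

lemma integral_\<kappa>: "l > 0 \<Longrightarrow> (LINT r|lborel. \<kappa> l r) = 1 / l"
  by (subst integral_eq_nn_integral) (auto simp: nn_integral_\<kappa>)

lemma tendsto_average_right:
  fixes f :: "real \<Rightarrow> 'a::{banach,second_countable_topology}"
  assumes f: "continuous_on UNIV f"
  shows "((\<lambda>h. (LINT u|lborel. indicator {0..<h} u *\<^sub>R f u) /\<^sub>R h) \<longlongrightarrow> f 0) (at_right 0)"
proof (rule tendstoI)
  fix e :: real assume e: "e > 0"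
  obtain d where d: "d > 0" "\<And>u. norm u < d \<Longrightarrow> norm (f u - f 0) < e / 2"
    using f e unfolding continuous_on_iff by (metis UNIV_I dist_norm diff_zero half_gt_zero)
  have "dist ((LINT u|lborel. indicator {0..<h} u *\<^sub>R f u) /\<^sub>R h) (f 0) < e" if h: "0 < h" "h < d" for h
  proof -
    have "integrable lborel (\<lambda>u. indicator {0..h} u *\<^sub>R f u)"
      by (rule borel_integrable_compact) (auto intro: continuous_on_subset[OF f])
    then have i: "integrable lborel (\<lambda>u. indicator {0..<h} u *\<^sub>R f u)"
      using set_integrable_subset[of lborel "{0..h}" f "{0..<h}"] by (auto simp: set_integrable_def subset_eq)
    have i0: "integrable lborel (\<lambda>u. indicator {0..<h} u *\<^sub>R f 0)" 
      by (rule integrable_scaleR_left) (use h in \<open>auto intro!: integrable_real_indicator\<close>)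
    have "(LINT u|lborel. indicator {0..<h} u *\<^sub>R f 0) = h *\<^sub>R f 0"
      using h by simp
    then have "(LINT u|lborel. indicator {0..<h} u *\<^sub>R f u) - h *\<^sub>R f 0 = (LINT u|lborel. indicator {0..<h} u *\<^sub>R (f u - f 0))"
      using Bochner_Integration.integral_diff[OF i i0] by (simp add: scaleR_diff_right)
    also have "norm \<dots> \<le> (LINT u|lborel. indicator {0..<h} u *\<^sub>R (e / 2))"
    proof (rule Bochner_Integration.integral_norm_bound_integral)
      show "integrable lborel (\<lambda>u. indicator {0..<h} u *\<^sub>R (f u - f 0))"
        using Bochner_Integration.integrable_diff[OF i i0] by (simp add: scaleR_diff_right)
      show "integrable lborel (\<lambda>u. indicator {0..<h} u *\<^sub>R (e / 2))"
        by (rule integrable_scaleR_left) (use h in \<open>auto intro!: integrable_real_indicator\<close>)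
    next
      fix u :: real
      show "norm (indicator {0..<h} u *\<^sub>R (f u - f 0)) \<le> indicator {0..<h} u *\<^sub>R (e / 2)"
        using d(2)[of u] h by (auto simp: indicator_def less_imp_le)
    qed
    also have "\<dots> = h * (e / 2)" using h by simp
    finally have *: "norm ((LINT u|lborel. indicator {0..<h} u *\<^sub>R f u) - h *\<^sub>R f 0) \<le> h * (e / 2)" .
    have "(LINT u|lborel. indicator {0..<h} u *\<^sub>R f u) /\<^sub>R h - f 0
        = ((LINT u|lborel. indicator {0..<h} u *\<^sub>R f u) - h *\<^sub>R f 0) /\<^sub>R h"
      using h by (simp add: scaleR_diff_right)
    then have "dist ((LINT u|lborel. indicator {0..<h} u *\<^sub>R f u) /\<^sub>R h) (f 0)
        = norm ((LINT u|lborel. indicator {0..<h} u *\<^sub>R f u) - h *\<^sub>R f 0) / h"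
      using h by (simp add: dist_norm divide_inverse mult.commute)
    also have "\<dots> \<le> e / 2" using * h by (simp add: field_simps)
    finally show ?thesis using e by simp
  qed
  then show "\<forall>\<^sub>F h in at_right 0. dist ((LINT u|lborel. indicator {0..<h} u *\<^sub>R f u) /\<^sub>R h) (f 0) < e"
    using d(1) unfolding eventually_at_right_field by blast
qed

context C0_semigroup_op begin

text \<open>
  The Laplace transform of the semigroup, shown below to be the resolvent of its generator.\<close>

definition R :: "real \<Rightarrow> 'h \<Rightarrow> 'h" where "R l x = (LINT r|lborel. \<kappa> l r *\<^sub>R S' r x)"

lemma norm_kernel: "norm (\<kappa> l r *\<^sub>R S' r x) \<le> K * norm x * \<kappa> (l - w) r"
proof (cases "r \<ge> 0")
  case True
  have "norm (\<kappa> l r *\<^sub>R S' r x) \<le> \<kappa> l r * (K * exp (w * r) * norm x)"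
    using norm_S'_apply[of r x] True by (auto intro!: mult_left_mono)
  also have "\<dots> = K * norm x * \<kappa> (l - w) r"
    using True by (simp add: \<kappa>_def algebra_simps exp_add[symmetric] exp_diff divide_simps exp_minus)
  finally show ?thesis .
qed (simp add: \<kappa>_def)

lemma integrable_R: "l > w \<Longrightarrow> integrable lborel (\<lambda>r. \<kappa> l r *\<^sub>R S' r x)"
  by (rule Bochner_Integration.integrable_bound[of _ "\<lambda>r. K * norm x * \<kappa> (l - w) r"])
     (use norm_kernel K_ge_1 in \<open>auto simp: integrable_\<kappa> intro: order_trans[OF norm_kernel]\<close>)

lemma norm_R:
  assumes l: "l > w" shows "norm (R l x) \<le> norm x * (K / (l - w))"
proof -
  have "norm (R l x) \<le> (LINT r|lborel. K * norm x * \<kappa> (l - w) r)"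
    unfolding R_def
    by (rule Bochner_Integration.integral_norm_bound_integral) (use l norm_kernel in \<open>auto simp: integrable_R integrable_\<kappa>\<close>)
  then show ?thesis using l by (simp add: integral_\<kappa> mult.commute)
qed

lemma bounded_linear_R: "l > w \<Longrightarrow> bounded_linear (R l)"
proof (rule bounded_linear_intro)
  assume l: "l > w"
  show "R l (x + y) = R l x + R l y" for x y
    unfolding R_def by (simp add: blinfun.add_right scaleR_add_right integrable_R[OF l])
  show "R l (c *\<^sub>R x) = c *\<^sub>R R l x" for c x
    unfolding R_def by (simp add: blinfun.scaleR_right scaleR_left_commute[of _ c] del: scaleR_scaleR)
qed (rule norm_R)

lemma R_commute:
  assumes "l > w" "bounded_linear G" "\<And>t. t \<ge> 0 \<Longrightarrow> G (S t x) = S t (G x)"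
  shows "G (R l x) = R l (G x)"
proof -
  have "G (S' t x) = S' t (G x)" for t using assms(3) by (simp add: S'_def)
  then show ?thesis
    unfolding R_def integral_bounded_linear[OF assms(2) integrable_R[OF assms(1)], symmetric]
    by (simp add: linear_cmul[OF bounded_linear.linear[OF assms(2)]])
qed

lemma S_R: "l > w \<Longrightarrow> t \<ge> 0 \<Longrightarrow> S t (R l x) = R l (S t x)"
  by (rule R_commute) (auto simp: S_add[symmetric] add.commute blinfun.bounded_linear_right)

lemma R_R: "l > w \<Longrightarrow> m > w \<Longrightarrow> R m (R l x) = R l (R m x)"
  by (rule R_commute) (auto simp: bounded_linear_R S_R)

text \<open>
  Semigroup law and translation of the integration variable: \<open>S h\<close> shifts the Laplace integral to
  the times beyond \<open>h\<close>, up to the factor \<open>exp (l * h)\<close>.  Differentiating at \<open>h = 0\<close> shows that \<open>R l\<close> maps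
  into the domain of the generator.\<close>

lemma S_R_shift:
  assumes l: "l > w" and h: "h \<ge> 0"
  shows "S h (R l x) = exp (l * h) *\<^sub>R (R l x - (LINT u|lborel. indicator {0..<h} u *\<^sub>R exp (- l * u) *\<^sub>R S' u x))"
proof -
  have i: "integrable lborel (\<lambda>u. indicator {0..<h} u *\<^sub>R exp (- l * u) *\<^sub>R S' u x)"
  proof (rule Bochner_Integration.integrable_bound[OF integrable_R[OF l, of x]])
    show "AE u in lborel. norm (indicator {0..<h} u *\<^sub>R exp (- l * u) *\<^sub>R S' u x) \<le> norm (\<kappa> l u *\<^sub>R S' u x)"
      by (auto simp: \<kappa>_def indicator_def)
  qed measurable
  have "S h (R l x) = (LINT r|lborel. \<kappa> l r *\<^sub>R S h (S' r x))"
    unfolding R_def by (subst integral_bounded_linear[OF blinfun.bounded_linear_right integrable_R[OF l], symmetric])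
      (simp add: blinfun.scaleR_right)
  also have "\<dots> = (LINT r|lborel. \<kappa> l ((h + 1 * r) - h) *\<^sub>R S' (h + 1 * r) x)"
    by (rule Bochner_Integration.integral_cong) (auto simp: \<kappa>_def indicator_def S'_def S_add h)
  also have "\<dots> = (LINT u|lborel. \<kappa> l (u - h) *\<^sub>R S' u x)"
    by (subst lborel_integral_real_affine[of 1 _ h]) auto
  also have "\<dots> = (LINT u|lborel. exp (l * h) *\<^sub>R (\<kappa> l u *\<^sub>R S' u x - indicator {0..<h} u *\<^sub>R exp (- l * u) *\<^sub>R S' u x))"
    by (rule Bochner_Integration.integral_cong) (use h in \<open>auto simp: \<kappa>_def indicator_def exp_add[symmetric] algebra_simps\<close>)
  also have "\<dots> = exp (l * h) *\<^sub>R (R l x - (LINT u|lborel. indicator {0..<h} u *\<^sub>R exp (- l * u) *\<^sub>R S' u x))"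
    unfolding R_def using Bochner_Integration.integral_diff[OF integrable_R[OF l, of x] i] by (simp del: scaleR_scaleR)
  finally show ?thesis .
qed

lemma R_derivative:
  assumes l: "l > w"
  shows "((\<lambda>h. (S h (R l x) - R l x) /\<^sub>R h) \<longlongrightarrow> l *\<^sub>R R l x - x) (at_right 0)"
proof -
  have exp': "((\<lambda>h. (exp (l * h) - 1) / h) \<longlongrightarrow> l) (at_right 0)"
  proof -
    have "((\<lambda>h. exp (l * h)) has_field_derivative l) (at 0)" by (auto intro!: derivative_eq_intros)
    then show ?thesis by (auto simp: has_field_derivative_iff intro: filterlim_mono[OF _ order_refl at_le])
  qed
  have cont: "continuous_on UNIV (\<lambda>u. exp (- l * u) *\<^sub>R S' u x)"
    by (intro continuous_intros continuous_orbit)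
  have "((\<lambda>h. ((exp (l * h) - 1) / h) *\<^sub>R R l x - exp (l * h) *\<^sub>R ((LINT u|lborel. indicator {0..<h} u *\<^sub>R exp (- l * u) *\<^sub>R S' u x) /\<^sub>R h))
      \<longlongrightarrow> l *\<^sub>R R l x - exp (l * 0) *\<^sub>R exp (- l * 0) *\<^sub>R S' 0 x) (at_right 0)"
    by (intro tendsto_intros exp' tendsto_average_right[OF cont])
  then have *: "((\<lambda>h. ((exp (l * h) - 1) / h) *\<^sub>R R l x - exp (l * h) *\<^sub>R ((LINT u|lborel. indicator {0..<h} u *\<^sub>R exp (- l * u) *\<^sub>R S' u x) /\<^sub>R h))
      \<longlongrightarrow> l *\<^sub>R R l x - x) (at_right 0)" by (simp add: S'_def)
  show ?thesis
  proof (rule Lim_transform_eventually[OF *])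
    show "\<forall>\<^sub>F h in at_right 0. ((exp (l * h) - 1) / h) *\<^sub>R R l x - exp (l * h) *\<^sub>R ((LINT u|lborel. indicator {0..<h} u *\<^sub>R exp (- l * u) *\<^sub>R S' u x) /\<^sub>R h)
       = (S h (R l x) - R l x) /\<^sub>R h"
      unfolding eventually_at_right_field
      by (intro exI[of _ 1]) (auto simp: S_R_shift[OF l] algebra_simps divide_inverse)
  qed
qed

text \<open>
  After rescaling the integration variable, \<open>l * R l x\<close> is the mean of \<open>S (u / l) x\<close> for an
  exponentially distributed \<open>u\<close>, which tends to \<open>x\<close> by strong continuity and dominated convergence.
  As \<open>R l x\<close> lies in the domain of the generator, this domain is dense.\<close>

lemma R_approx_identity: "\<exists>l. (\<forall>n. l n > w) \<and> (\<lambda>n. l n *\<^sub>R R (l n) x) \<longlonglongrightarrow> x"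
proof -
  define l where "l n = 2 * w + 1 + real n" for n
  have l: "l n > w" "l n > 0" "l n \<ge> 2 * w" for n using w_nonneg by (auto simp: l_def)
  have eq: "l n *\<^sub>R R (l n) x = (LINT u|lborel. \<kappa> 1 u *\<^sub>R S' (u / l n) x)" for n
    unfolding R_def
    by (subst lborel_integral_real_affine[of "1 / l n" _ 0])
      (use l[of n] in \<open>auto simp: \<kappa>_def indicator_def zero_le_divide_iff intro!: Bochner_Integration.integral_cong\<close>)
  have "(\<lambda>n. LINT u|lborel. \<kappa> 1 u *\<^sub>R S' (u / l n) x) \<longlonglongrightarrow> (LINT u|lborel. \<kappa> 1 u *\<^sub>R x)"
  proof (rule integral_dominated_convergence[where w = "\<lambda>u. K * norm x * \<kappa> (1/2) u"])
    have lim: "(\<lambda>n. u / l n) \<longlonglongrightarrow> 0" for u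
    proof -
      have "filterlim l at_top sequentially"
        unfolding l_def by (rule filterlim_tendsto_add_at_top[OF tendsto_const filterlim_real_sequentially])
      then show ?thesis by (intro tendsto_divide_0[OF tendsto_const] filterlim_at_top_imp_at_infinity)
    qed
    have "(\<lambda>n. S' (u / l n) x) \<longlonglongrightarrow> x" for u
      using isCont_tendsto_compose[OF _ lim, of "\<lambda>t. S' t x" u] continuous_orbit[of x]
      by (simp add: continuous_on_eq_continuous_at S'_def)
    then show "AE u in lborel. (\<lambda>n. \<kappa> 1 u *\<^sub>R S' (u / l n) x) \<longlonglongrightarrow> \<kappa> 1 u *\<^sub>R x"
      by (intro AE_I2 tendsto_intros)
    show "AE u in lborel. norm (\<kappa> 1 u *\<^sub>R S' (u / l n) x) \<le> K * norm x * \<kappa> (1/2) u" for n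
    proof (rule AE_I2)
      fix u :: real
      show "norm (\<kappa> 1 u *\<^sub>R S' (u / l n) x) \<le> K * norm x * \<kappa> (1/2) u"
      proof (cases "u \<ge> 0")
        case True
        have "w * (u / l n) \<le> u / 2" using l[of n] True mult_right_mono[OF l(3)[of n] True] by (simp add: field_simps)
        then have "norm (S' (u / l n) x) \<le> K * exp (u / 2) * norm x"
          using norm_S'_apply[of "u / l n" x] True l(2)[of n] K_ge_1
          by (elim order_trans[rotated] order_trans) (auto intro!: mult_right_mono mult_left_mono)
        then have "norm (\<kappa> 1 u *\<^sub>R S' (u / l n) x) \<le> \<kappa> 1 u * (K * exp (u / 2) * norm x)"
          by (auto intro: mult_left_mono)
        also have "\<dots> = K * norm x * (exp (-u) * exp (u / 2))" using True by (simp add: \<kappa>_def)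
        also have "\<dots> = K * norm x * \<kappa> (1/2) u" using True by (simp add: \<kappa>_def exp_add[symmetric])
        finally show ?thesis .
      qed (simp add: \<kappa>_def)
    qed
  qed (auto simp: integrable_\<kappa>)
  then have "(\<lambda>n. l n *\<^sub>R R (l n) x) \<longlonglongrightarrow> x" by (simp add: eq integrable_\<kappa> integral_\<kappa>)
  then show ?thesis using l(1) by blast
qed

end

locale C0_generator = C0_semigroup_op S
  for S :: "real \<Rightarrow> 'h \<Rightarrow>\<^sub>L 'h::{banach,second_countable_topology}" +
  fixes DA :: "'h set" and A :: "'h \<Rightarrow> 'h"
  assumes gen: "generator S DA A"
begin

lemma DA_I: "((\<lambda>t. (S t x - x) /\<^sub>R t) \<longlongrightarrow> y) (at_right 0) \<Longrightarrow> x \<in> DA"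
  and A_lim: "x \<in> DA \<Longrightarrow> ((\<lambda>t. (S t x - x) /\<^sub>R t) \<longlongrightarrow> A x) (at_right 0)"
  using gen by (auto simp: generator_def)

lemma A_eqI: "((\<lambda>t. (S t x - x) /\<^sub>R t) \<longlongrightarrow> y) (at_right 0) \<Longrightarrow> A x = y"
  using A_lim[OF DA_I] by (rule tendsto_unique[OF trivial_limit_at_right_real])

lemma R_in_DA: "l > w \<Longrightarrow> R l x \<in> DA"
  and A_R: "l > w \<Longrightarrow> A (R l x) = l *\<^sub>R R l x - x"
  using DA_I[OF R_derivative] A_eqI[OF R_derivative] by auto

text \<open>
  Since \<open>R l\<close> commutes with the semigroup, it commutes with the generator on its domain.\<close>

lemma R_left_inverse:
  assumes l: "l > w" and y: "y \<in> DA" shows "R l (l *\<^sub>R y - A y) = y"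
proof -
  interpret R: bounded_linear "R l" by (rule bounded_linear_R[OF l])
  have "((\<lambda>t. R l ((S t y - y) /\<^sub>R t)) \<longlongrightarrow> R l (A y)) (at_right 0)"
    by (rule R.tendsto[OF A_lim[OF y]])
  then have "((\<lambda>t. (S t (R l y) - R l y) /\<^sub>R t) \<longlongrightarrow> R l (A y)) (at_right 0)"
  proof (rule Lim_transform_eventually)
    show "\<forall>\<^sub>F t in at_right 0. R l ((S t y - y) /\<^sub>R t) = (S t (R l y) - R l y) /\<^sub>R t"
      unfolding eventually_at_right_field
      by (intro exI[of _ 1]) (auto simp: R.scaleR R.diff S_R[OF l])
  qed
  then have "R l (A y) = l *\<^sub>R R l y - y" using A_eqI A_R[OF l] by metis
  then show ?thesis by (simp add: R.diff R.scaleR)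
qed

lemma resolvent_eq: "l > w \<Longrightarrow> resolvent DA A l x = R l x"
  unfolding resolvent_def
  by (rule the_equality) (auto simp: R_in_DA A_R R_left_inverse)

end

section \<open>Uniform admissibility of the Yosida approximations\<close>

locale C0_observation = C0_generator S DA A
  for S :: "real \<Rightarrow> 'h \<Rightarrow>\<^sub>L 'h::{banach,second_countable_topology}" and DA A +
  fixes C :: "'h \<Rightarrow> 'h"
  assumes adm: "admissible S DA A C"
begin

lemma subspace_DA: "subspace DA"
  and C_add: "x \<in> DA \<Longrightarrow> y \<in> DA \<Longrightarrow> C (x + y) = C x + C y"
  and C_scaleR: "x \<in> DA \<Longrightarrow> C (c *\<^sub>R x) = c *\<^sub>R C x"
  using adm by (auto simp: admissible_def graph_bounded_linear_def linear_on_subspace_def)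

text \<open>
  On the range of \<open>R l\<close> the graph norm is controlled by \<open>A (R l x) = l *\<^sub>R R l x - x\<close>.\<close>

lemma bounded_linear_CR:
  assumes l: "l > w" shows "bounded_linear (\<lambda>x. C (R l x))"
proof -
  interpret R: bounded_linear "R l" by (rule bounded_linear_R[OF l])
  obtain c where c: "\<And>x. x \<in> DA \<Longrightarrow> norm (C x) \<le> c * graph_norm A x"
    using adm by (auto simp: admissible_def graph_bounded_linear_def)
  obtain r where r: "\<And>x. norm (R l x) \<le> norm x * r" using R.bounded by blast
  show ?thesis
  proof (rule bounded_linear_intro)
    show "C (R l (x + y)) = C (R l x) + C (R l y)" for x y
      by (simp add: R.add C_add R_in_DA[OF l])
    show "C (R l (a *\<^sub>R x)) = a *\<^sub>R C (R l x)" for a x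
      by (simp add: R.scaleR C_scaleR R_in_DA[OF l])
    show "norm (C (R l x)) \<le> norm x * (\<bar>c\<bar> * (r + \<bar>l\<bar> * r + 1))" for x
    proof -
      have "norm (l *\<^sub>R R l x - x) \<le> \<bar>l\<bar> * norm (R l x) + norm x"
        using norm_triangle_ineq4[of "l *\<^sub>R R l x" x] by simp
      also have "\<dots> \<le> \<bar>l\<bar> * (norm x * r) + norm x" using r[of x] by (intro add_mono mult_left_mono) auto
      finally have "graph_norm A (R l x) \<le> norm x * r + (\<bar>l\<bar> * (norm x * r) + norm x)"
        using r[of x] unfolding graph_norm_def A_R[OF l] by linarith
      moreover have "norm (C (R l x)) \<le> \<bar>c\<bar> * graph_norm A (R l x)"
        using c[OF R_in_DA[OF l], of x] by (rule order_trans) (auto intro!: mult_right_mono simp: graph_norm_def)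
      ultimately have "norm (C (R l x)) \<le> \<bar>c\<bar> * (norm x * r + (\<bar>l\<bar> * (norm x * r) + norm x))"
        by (meson abs_ge_zero mult_left_mono order_trans)
      then show ?thesis by (simp add: algebra_simps)
    qed
  qed
qed

lemma DA_range:
  assumes l: "l > w" shows "DA = range (R l)"
proof
  show "DA \<subseteq> range (R l)"
  proof
    fix x assume "x \<in> DA"
    from R_left_inverse[OF l this] show "x \<in> range (R l)" by (rule range_eqI[OF sym])
  qed
qed (use R_in_DA[OF l] in blast)

lemma S_in_DA:
  assumes t: "t \<ge> 0" and x: "x \<in> DA" shows "S t x \<in> DA"
proof -
  have l: "w + 1 > w" by simp
  obtain z where "x = R (w + 1) z" using x DA_range[OF l] by blast
  then show ?thesis using R_in_DA[OF l] S_R[OF l t] by simp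
qed

definition G :: "real \<Rightarrow> 'h \<Rightarrow>\<^sub>L 'h" where "G l = Blinfun (\<lambda>x. C (R l x))"

lemma G_apply: "l > w \<Longrightarrow> G l x = C (R l x)"
  unfolding G_def by (simp add: bounded_linear_Blinfun_apply bounded_linear_CR)

lemma CS_eq: "l > w \<Longrightarrow> C (S' t (R l z)) = G l (S' t z)"
  by (simp add: S'_def S_R G_apply)

lemma borel_measurable_CS':
  assumes "x \<in> DA" "f \<in> borel_measurable M"
  shows "(\<lambda>t. C (S' (f t) x)) \<in> borel_measurable M"
proof -
  obtain z where z: "x = R (w + 1) z" using assms(1) DA_range[of "w + 1"] by auto
  have "(\<lambda>t. G (w + 1) (S' (f t) z)) \<in> borel_measurable M" 
    by (rule borel_measurable_continuous_on[OF _ borel_measurable_S'])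
      (auto intro!: linear_continuous_on blinfun.bounded_linear_right assms)
  then show ?thesis by (simp add: z CS_eq)
qed

text \<open>
  An interval of length \<open>T\<close> is covered by finitely many translates of the interval on which the
  estimate is given, and on the \<open>n\<close>-th translate \<open>S (n * \<alpha>) x\<close> takes the role of \<open>x\<close>.\<close>

lemma admissible_all_horizons:
  "\<exists>c\<ge>0. \<forall>x\<in>DA. (\<integral>\<^sup>+t. indicator {0..T} t * normsq (C (S' t x)) \<partial>lborel) \<le> ennreal (c * (norm x)\<^sup>2)"
proof -
  obtain \<alpha> \<gamma> where a: "\<alpha> > 0"
    and ag: "\<And>x. x \<in> DA \<Longrightarrow> (\<integral>\<^sup>+t\<in>{0..\<alpha>}. normsq (C (S t x)) \<partial>lborel) \<le> ennreal (\<gamma>\<^sup>2 * (norm x)\<^sup>2)"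
    using adm unfolding admissible_def by blast
  have first: "(\<integral>\<^sup>+t. indicator {0..\<alpha>} t * normsq (C (S' t x)) \<partial>lborel) \<le> ennreal (\<gamma>\<^sup>2 * (norm x)\<^sup>2)"
    if "x \<in> DA" for x
    using ag[OF that] by (rule order_trans[rotated])
      (auto intro!: nn_integral_mono simp: indicator_def S'_eq)
  have "\<exists>c\<ge>0. \<forall>x\<in>DA. (\<integral>\<^sup>+t. indicator {0..real n * \<alpha>} t * normsq (C (S' t x)) \<partial>lborel) \<le> ennreal (c * (norm x)\<^sup>2)" for n
  proof (induction n)
    case 0
    have "(\<integral>\<^sup>+t. indicator {0::real} t * normsq (C (S' t x)) \<partial>lborel) = 0" for x
    proof -
      have "(\<integral>\<^sup>+t. indicator {0::real} t * normsq (C (S' t x)) \<partial>lborel) = (\<integral>\<^sup>+t. (normsq (C x)) * indicator {0::real} t \<partial>lborel)"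
        by (rule nn_integral_cong) (auto simp: indicator_def S'_def)
      then show ?thesis by simp
    qed
    then show ?case by (intro exI[of _ 0]) simp
  next
    case (Suc n)
    then obtain c where c: "c \<ge> 0" and cb: "\<And>x. x \<in> DA \<Longrightarrow> (\<integral>\<^sup>+t. indicator {0..real n * \<alpha>} t * normsq (C (S' t x)) \<partial>lborel) \<le> ennreal (c * (norm x)\<^sup>2)"
      by blast
    define N where "N = norm (S (real n * \<alpha>))"
    show ?case
    proof (intro exI[of _ "c + \<gamma>\<^sup>2 * N\<^sup>2"] conjI ballI)
      show "c + \<gamma>\<^sup>2 * N\<^sup>2 \<ge> 0" using c by simp
      fix x assume x: "x \<in> DA"
      note [measurable] = borel_measurable_CS'[OF x]
      let ?f = "\<lambda>t. normsq (C (S' t x))"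
      let ?y = "S (real n * \<alpha>) x"
      have y: "?y \<in> DA" using x a by (intro S_in_DA) auto
      have "(\<integral>\<^sup>+t. indicator {0..real (Suc n) * \<alpha>} t * ?f t \<partial>lborel)
          \<le> (\<integral>\<^sup>+t. indicator {0..real n * \<alpha>} t * ?f t + indicator {real n * \<alpha>..real (Suc n) * \<alpha>} t * ?f t \<partial>lborel)"
        by (rule nn_integral_mono) (auto simp: indicator_def)
      also have "\<dots> = (\<integral>\<^sup>+t. indicator {0..real n * \<alpha>} t * ?f t \<partial>lborel) + (\<integral>\<^sup>+t. indicator {real n * \<alpha>..real (Suc n) * \<alpha>} t * ?f t \<partial>lborel)"
        by (rule nn_integral_add) auto
      also have "(\<integral>\<^sup>+t. indicator {real n * \<alpha>..real (Suc n) * \<alpha>} t * ?f t \<partial>lborel)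
        = (\<integral>\<^sup>+t. indicator {0..\<alpha>} t * normsq (C (S' t ?y)) \<partial>lborel)"
      proof -
        have "(\<integral>\<^sup>+t. indicator {real n * \<alpha>..real (Suc n) * \<alpha>} t * ?f t \<partial>lborel)
          = (\<integral>\<^sup>+t. indicator {real n * \<alpha>..real (Suc n) * \<alpha>} (real n * \<alpha> + 1 * t) * ?f (real n * \<alpha> + 1 * t) \<partial>lborel)"
          by (subst nn_integral_real_affine[where c = 1 and t = "real n * \<alpha>"]) auto
        also have "\<dots> = (\<integral>\<^sup>+t. indicator {0..\<alpha>} t * normsq (C (S' t ?y)) \<partial>lborel)"
        proof (rule nn_integral_cong)
          fix t :: real
          have "S' (real n * \<alpha> + 1 * t) x = S' t ?y" if "t \<ge> 0"
            using that a S_add[of t "real n * \<alpha>" x] by (simp add: S'_def add.commute)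
          then show "indicator {real n * \<alpha>..real (Suc n) * \<alpha>} (real n * \<alpha> + 1 * t) * ?f (real n * \<alpha> + 1 * t)
            = indicator {0..\<alpha>} t * normsq (C (S' t ?y))"
            by (auto simp: indicator_def algebra_simps)
        qed
        finally show ?thesis .
      qed
      also have "\<dots> \<le> ennreal (\<gamma>\<^sup>2 * (norm ?y)\<^sup>2)" by (rule first[OF y])
      also have "\<dots> \<le> ennreal (\<gamma>\<^sup>2 * (N\<^sup>2 * (norm x)\<^sup>2))"
        using norm_blinfun[of "S (real n * \<alpha>)" x]
        by (intro ennreal_leI mult_left_mono) (auto simp: N_def power_mult_distrib[symmetric] intro!: power_mono)
      also note cb[OF x]
      finally have "(\<integral>\<^sup>+t. indicator {0..real (Suc n) * \<alpha>} t * ?f t \<partial>lborel) \<le> ennreal (c * (norm x)\<^sup>2) + ennreal (\<gamma>\<^sup>2 * (N\<^sup>2 * (norm x)\<^sup>2))"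
        by (simp add: add_mono)
      then show "(\<integral>\<^sup>+t. indicator {0..real (Suc n) * \<alpha>} t * ?f t \<partial>lborel) \<le> ennreal ((c + \<gamma>\<^sup>2 * N\<^sup>2) * (norm x)\<^sup>2)"
        using c by (simp add: ennreal_plus[symmetric] algebra_simps del: ennreal_plus)
    qed
  qed
  note horizons = this
  obtain n where n: "T \<le> real n * \<alpha>" using reals_Archimedean3[OF a, rule_format, of T] by (auto intro: less_imp_le)
  obtain c where c: "c \<ge> 0" "\<And>x. x \<in> DA \<Longrightarrow> (\<integral>\<^sup>+t. indicator {0..real n * \<alpha>} t * normsq (C (S' t x)) \<partial>lborel) \<le> ennreal (c * (norm x)\<^sup>2)"
    using horizons[of n] by blast
  have "(\<integral>\<^sup>+t. indicator {0..T} t * normsq (C (S' t x)) \<partial>lborel) \<le> ennreal (c * (norm x)\<^sup>2)" if "x \<in> DA" for x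
    by (rule order_trans[OF nn_integral_mono c(2)[OF that]]) (use n in \<open>auto simp: indicator_def\<close>)
  then show ?thesis using c(1) by blast
qed

text \<open>
  \<open>C\<close> is not bounded on \<open>'h\<close> and cannot be pulled through the Laplace integral directly.  However every
  \<open>x\<close> in the domain of the generator is \<open>R m z\<close> for some \<open>m\<close>, the operator \<open>C R m\<close> is bounded, and
  \<open>C (S' r x)\<close> is \<open>C R m\<close> applied to \<open>S' r z\<close>.\<close>

lemma G_Laplace:
  assumes l: "l > w" and x: "x \<in> DA"
  shows "integrable lborel (\<lambda>r. \<kappa> l r *\<^sub>R C (S' r x))" and "G l x = (LINT r|lborel. \<kappa> l r *\<^sub>R C (S' r x))"
proof -
  define m where "m = w + 1"
  have m: "m > w" by (simp add: m_def)
  obtain z where z: "x = R m z" using x DA_range[OF m] by auto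
  have eq: "\<kappa> l r *\<^sub>R C (S' r x) = G m (\<kappa> l r *\<^sub>R S' r z)" for r
    by (simp add: z CS_eq[OF m] blinfun.scaleR_right)
  show "integrable lborel (\<lambda>r. \<kappa> l r *\<^sub>R C (S' r x))"
    unfolding eq by (rule integrable_bounded_linear[OF blinfun.bounded_linear_right integrable_R[OF l]])
  have "G l x = G m (R l z)" by (simp only: G_apply[OF l] G_apply[OF m] z R_R[OF l m])
  also have "\<dots> = (LINT r|lborel. G m (\<kappa> l r *\<^sub>R S' r z))"
    unfolding R_def by (rule integral_bounded_linear[OF blinfun.bounded_linear_right integrable_R[OF l], symmetric])
  finally show "G l x = (LINT r|lborel. \<kappa> l r *\<^sub>R C (S' r x))" by (simp add: eq)
qed

text \<open>
  Jensen's inequality for the exponential distribution with density \<open>l * \<kappa> l\<close>, in the form of the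
  Cauchy-Schwarz inequality.\<close>

lemma norm_G_sq_le:
  assumes l: "l > w" and x: "x \<in> DA"
  shows "normsq (l *\<^sub>R G l x) \<le> ennreal l * (\<integral>\<^sup>+r. ennreal (\<kappa> l r) * normsq (C (S' r x)) \<partial>lborel)"
proof -
  have l0: "l > 0" using l w_nonneg by simp
  note [measurable] = borel_measurable_CS'[OF x]
  let ?c = "\<lambda>r. norm (C (S' r x))"
  have "ennreal (norm (G l x)) \<le> (\<integral>\<^sup>+r. ennreal (norm (\<kappa> l r *\<^sub>R C (S' r x))) \<partial>lborel)"
    unfolding G_Laplace(2)[OF l x] by (rule integral_norm_bound_ennreal[OF G_Laplace(1)[OF l x]])
  also have "\<dots> = (\<integral>\<^sup>+r. ennreal (sqrt (\<kappa> l r)) * ennreal (sqrt (\<kappa> l r) * ?c r) \<partial>lborel)"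
  proof (rule nn_integral_cong)
    fix r :: real
    have "ennreal (sqrt (\<kappa> l r)) * ennreal (sqrt (\<kappa> l r) * ?c r) = ennreal (sqrt (\<kappa> l r) * (sqrt (\<kappa> l r) * ?c r))"
      by (rule ennreal_mult[symmetric]) auto
    then show "ennreal (norm (\<kappa> l r *\<^sub>R C (S' r x))) = ennreal (sqrt (\<kappa> l r)) * ennreal (sqrt (\<kappa> l r) * ?c r)"
      by (simp flip: mult.assoc)
  qed
  finally have "(ennreal (norm (G l x)))\<^sup>2 \<le> (\<integral>\<^sup>+r. ennreal (sqrt (\<kappa> l r)) * ennreal (sqrt (\<kappa> l r) * ?c r) \<partial>lborel)\<^sup>2"
    by (rule power_mono) simp
  also have "\<dots> \<le> (\<integral>\<^sup>+r. (ennreal (sqrt (\<kappa> l r)))\<^sup>2 \<partial>lborel) * (\<integral>\<^sup>+r. (ennreal (sqrt (\<kappa> l r) * ?c r))\<^sup>2 \<partial>lborel)"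
    by (rule Cauchy_Schwarz_nn_integral) auto
  also have "\<dots> = ennreal (1 / l) * (\<integral>\<^sup>+r. ennreal (\<kappa> l r) * ennreal ((?c r)\<^sup>2) \<partial>lborel)"
  proof -
    have "(ennreal (sqrt (\<kappa> l r)))\<^sup>2 = ennreal (\<kappa> l r)" for r
      by (simp add: ennreal_power)
    moreover have "(ennreal (sqrt (\<kappa> l r) * ?c r))\<^sup>2 = ennreal (\<kappa> l r) * ennreal ((?c r)\<^sup>2)" for r
      by (simp add: ennreal_power power_mult_distrib ennreal_mult)
    ultimately show ?thesis using l0 by (simp add: nn_integral_\<kappa>)
  qed
  finally have "ennreal (l\<^sup>2) * (ennreal (norm (G l x)))\<^sup>2 \<le> ennreal (l\<^sup>2) * (ennreal (1 / l) * (\<integral>\<^sup>+r. ennreal (\<kappa> l r) * ennreal ((?c r)\<^sup>2) \<partial>lborel))"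
    by (rule mult_left_mono) simp
  also have "\<dots> = ennreal l * (\<integral>\<^sup>+r. ennreal (\<kappa> l r) * ennreal ((?c r)\<^sup>2) \<partial>lborel)"
  proof -
    have "ennreal (l\<^sup>2) * ennreal (1 / l) = ennreal l"
      using l0 by (subst ennreal_mult[symmetric]) (auto simp: power2_eq_square)
    then show ?thesis by (simp only: mult.assoc[symmetric])
  qed
  also have "ennreal (l\<^sup>2) * (ennreal (norm (G l x)))\<^sup>2 = normsq (l *\<^sub>R G l x)"
  proof -
    have "(norm (l *\<^sub>R G l x))\<^sup>2 = l\<^sup>2 * (norm (G l x))\<^sup>2" by (simp add: power_mult_distrib)
    then show ?thesis by (simp only: ennreal_mult' zero_le_power2 ennreal_power norm_ge_zero)
  qed
  finally show ?thesis .
qed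

text \<open>
  The operator \<open>l * C R l\<close> averages \<open>C (S' r x)\<close> over an exponential distribution of \<open>r\<close>.  By Jensen's
  inequality its admissibility constant is at most the average of those along the orbit, that is
  \<open>c * l * (\<integral>\<kappa> l r * K\<^sup>2 * exp (2 * w * r))\<close>; this is at most \<open>2 * c * K\<^sup>2\<close> because
  \<open>l / (l - 2 * w) \<le> 2\<close> for \<open>l \<ge> 4 * w + 1\<close>.\<close>

lemma uniform_admissibility_DA:
  assumes c: "c \<ge> 0" and cb: "\<And>x. x \<in> DA \<Longrightarrow> (\<integral>\<^sup>+t. indicator {0..T} t * normsq (C (S' t x)) \<partial>lborel) \<le> ennreal (c * (norm x)\<^sup>2)"
    and l: "l \<ge> 4 * w + 1" and x: "x \<in> DA"
  shows "(\<integral>\<^sup>+t. indicator {0..T} t * normsq (l *\<^sub>R G l (S' t x)) \<partial>lborel) \<le> ennreal (2 * c * K\<^sup>2 * (norm x)\<^sup>2)"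
proof -
  have lw: "l > w" and l2: "l - 2 * w > 0" using l w_nonneg by linarith+
  define cc where "cc t = C (S' t x)" for t
  have [measurable]: "cc \<in> borel_measurable borel"
    unfolding cc_def[abs_def] by (rule borel_measurable_CS'[OF x]) measurable
  have SS: "S' r (S' t x) = S' t (S' r x)" if "t \<ge> 0" "r \<ge> 0" for r t
    using that S_add[of r t x] S_add[of t r x] by (simp add: S'_def add.commute)
  have SS': "S' r (S' t x) = S' (t + r) x" if "t \<ge> 0" "r \<ge> 0" for r t
    using that S_add[of r t x] by (simp add: S'_def add.commute)
  have "(\<integral>\<^sup>+t. indicator {0..T} t * normsq (l *\<^sub>R G l (S' t x)) \<partial>lborel)
    \<le> (\<integral>\<^sup>+t. indicator {0..T} t * (ennreal l * (\<integral>\<^sup>+r. ennreal (\<kappa> l r) * normsq (cc (t + r)) \<partial>lborel)) \<partial>lborel)"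
  proof (rule nn_integral_mono)
    fix t :: real
    show "indicator {0..T} t * normsq (l *\<^sub>R G l (S' t x))
      \<le> indicator {0..T} t * (ennreal l * (\<integral>\<^sup>+r. ennreal (\<kappa> l r) * normsq (cc (t + r)) \<partial>lborel))"
    proof (cases "t \<in> {0..T}")
      case True
      then have t: "t \<ge> 0" by simp
      have "S' t x \<in> DA" using S_in_DA[OF t x] t by (simp add: S'_eq)
      from norm_G_sq_le[OF lw this]
      have "normsq (l *\<^sub>R G l (S' t x)) \<le> ennreal l * (\<integral>\<^sup>+r. ennreal (\<kappa> l r) * normsq (C (S' r (S' t x))) \<partial>lborel)" .
      also have "(\<integral>\<^sup>+r. ennreal (\<kappa> l r) * normsq (C (S' r (S' t x))) \<partial>lborel) = (\<integral>\<^sup>+r. ennreal (\<kappa> l r) * normsq (cc (t + r)) \<partial>lborel)"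
      proof (rule nn_integral_cong)
        fix r :: real
        show "ennreal (\<kappa> l r) * normsq (C (S' r (S' t x))) = ennreal (\<kappa> l r) * normsq (cc (t + r))"
          using SS'[OF t, of r] by (cases "r \<ge> 0") (auto simp: \<kappa>_def cc_def)
      qed
      finally show ?thesis using True by simp
    qed simp
  qed
  also have "\<dots> = ennreal l * (\<integral>\<^sup>+t. (\<integral>\<^sup>+r. indicator {0..T} t * (ennreal (\<kappa> l r) * normsq (cc (t + r))) \<partial>lborel) \<partial>lborel)"
  proof -
    have "indicator {0..T} t * (ennreal l * (\<integral>\<^sup>+r. ennreal (\<kappa> l r) * normsq (cc (t + r)) \<partial>lborel))
        = ennreal l * (\<integral>\<^sup>+r. indicator {0..T} t * (ennreal (\<kappa> l r) * normsq (cc (t + r))) \<partial>lborel)" for t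
      by (subst nn_integral_cmult) (measurable, rule mult.left_commute)
    then have "(\<integral>\<^sup>+t. indicator {0..T} t * (ennreal l * (\<integral>\<^sup>+r. ennreal (\<kappa> l r) * normsq (cc (t + r)) \<partial>lborel)) \<partial>lborel)
        = (\<integral>\<^sup>+t. ennreal l * (\<integral>\<^sup>+r. indicator {0..T} t * (ennreal (\<kappa> l r) * normsq (cc (t + r))) \<partial>lborel) \<partial>lborel)"
      by (intro nn_integral_cong)
    also have "\<dots> = ennreal l * (\<integral>\<^sup>+t. (\<integral>\<^sup>+r. indicator {0..T} t * (ennreal (\<kappa> l r) * normsq (cc (t + r))) \<partial>lborel) \<partial>lborel)"
      by (rule nn_integral_cmult) measurable
    finally show ?thesis .
  qed
  also have "(\<integral>\<^sup>+t. (\<integral>\<^sup>+r. indicator {0..T} t * (ennreal (\<kappa> l r) * normsq (cc (t + r))) \<partial>lborel) \<partial>lborel)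
    = (\<integral>\<^sup>+r. (\<integral>\<^sup>+t. indicator {0..T} t * (ennreal (\<kappa> l r) * normsq (cc (t + r))) \<partial>lborel) \<partial>lborel)"
    by (rule lborel_pair.Fubini') measurable
  also have "\<dots> \<le> (\<integral>\<^sup>+r. ennreal (c * K\<^sup>2 * (norm x)\<^sup>2) * ennreal (\<kappa> (l - 2 * w) r) \<partial>lborel)"
  proof (rule nn_integral_mono)
    fix r :: real
    show "(\<integral>\<^sup>+t. indicator {0..T} t * (ennreal (\<kappa> l r) * normsq (cc (t + r))) \<partial>lborel)
      \<le> ennreal (c * K\<^sup>2 * (norm x)\<^sup>2) * ennreal (\<kappa> (l - 2 * w) r)"
    proof (cases "r \<ge> 0")
      case r: True
      have y: "S' r x \<in> DA" using S_in_DA[OF r x] r by (simp add: S'_eq)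
      note [measurable] = borel_measurable_CS'[OF y]
      have "(\<integral>\<^sup>+t. indicator {0..T} t * (ennreal (\<kappa> l r) * normsq (cc (t + r))) \<partial>lborel)
        = (\<integral>\<^sup>+t. ennreal (\<kappa> l r) * (indicator {0..T} t * normsq (C (S' t (S' r x)))) \<partial>lborel)"
        by (rule nn_integral_cong) (auto simp: indicator_def cc_def SS'[symmetric] SS r)
      also have "\<dots> = ennreal (\<kappa> l r) * (\<integral>\<^sup>+t. indicator {0..T} t * normsq (C (S' t (S' r x))) \<partial>lborel)"
        by (rule nn_integral_cmult) measurable
      also have "\<dots> \<le> ennreal (\<kappa> l r) * ennreal (c * (norm (S' r x))\<^sup>2)"
        by (rule mult_left_mono[OF cb[OF y]]) simp
      also have "\<dots> \<le> ennreal (\<kappa> l r) * ennreal (c * (K * exp (w * r) * norm x)\<^sup>2)"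
        using norm_S'_apply[of r x] r c by (intro mult_left_mono ennreal_leI power_mono) auto
      also have "\<dots> = ennreal (c * K\<^sup>2 * (norm x)\<^sup>2 * \<kappa> (l - 2 * w) r)"
      proof -
        have "exp (- l * r) * (exp (w * r) * exp (w * r)) = exp (- (l - 2 * w) * r)"
          by (simp add: exp_add[symmetric] algebra_simps)
        then have "\<kappa> l r * (c * (K * exp (w * r) * norm x)\<^sup>2) = c * K\<^sup>2 * (norm x)\<^sup>2 * \<kappa> (l - 2 * w) r"
          using r by (simp add: \<kappa>_def power2_eq_square)
        then show ?thesis using c by (simp add: ennreal_mult[symmetric])
      qed
      also have "\<dots> = ennreal (c * K\<^sup>2 * (norm x)\<^sup>2) * ennreal (\<kappa> (l - 2 * w) r)"
        using c by (intro ennreal_mult) auto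
      finally show ?thesis .
    qed (simp add: \<kappa>_def)
  qed
  also have "\<dots> = ennreal (c * K\<^sup>2 * (norm x)\<^sup>2 * (1 / (l - 2 * w)))"
    using c l2 by (subst nn_integral_cmult) (auto simp: nn_integral_\<kappa> ennreal_mult[symmetric] simp del: times_divide_eq_right)
  finally have "(\<integral>\<^sup>+t. indicator {0..T} t * normsq (l *\<^sub>R G l (S' t x)) \<partial>lborel)
      \<le> ennreal l * ennreal (c * K\<^sup>2 * (norm x)\<^sup>2 * (1 / (l - 2 * w)))"
    by (simp add: mult_left_mono)
  also have "\<dots> = ennreal ((c * K\<^sup>2 * (norm x)\<^sup>2) * (l / (l - 2 * w)))"
    using c l2 lw w_nonneg by (subst ennreal_mult[symmetric]) (auto simp: algebra_simps)
  also have "\<dots> \<le> ennreal ((c * K\<^sup>2 * (norm x)\<^sup>2) * 2)"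
    using c l2 l by (intro ennreal_leI mult_left_mono) (auto simp: field_simps)
  finally show ?thesis by (simp add: algebra_simps)
qed

text \<open>
  The bound passes from the dense domain of the generator to all \<open>x\<close> by Fatou's lemma, since
  \<open>l * C R l\<close> is bounded.\<close>

lemma uniform_admissibility:
  "\<exists>c\<ge>0. \<forall>l\<ge>4 * w + 1. \<forall>x. (\<integral>\<^sup>+t. indicator {0..T} t * normsq (l *\<^sub>R G l (S' t x)) \<partial>lborel) \<le> ennreal (c * (norm x)\<^sup>2)"
proof -
  obtain c where c: "c \<ge> 0" and cb: "\<And>x. x \<in> DA \<Longrightarrow> (\<integral>\<^sup>+t. indicator {0..T} t * normsq (C (S' t x)) \<partial>lborel) \<le> ennreal (c * (norm x)\<^sup>2)"
    using admissible_all_horizons[of T] by blast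
  show ?thesis
  proof (intro exI[of _ "2 * c * K\<^sup>2"] conjI allI impI)
    show "2 * c * K\<^sup>2 \<ge> 0" using c by simp
    fix l x assume l: "l \<ge> 4 * w + 1"
    obtain m where m: "\<And>n. m n > w" and lim: "(\<lambda>n. m n *\<^sub>R R (m n) x) \<longlonglongrightarrow> x"
      using R_approx_identity by blast
    define y where "y n = m n *\<^sub>R R (m n) x" for n :: nat
    have y: "y n \<in> DA" for n unfolding y_def using m by (intro subspace_scale[OF subspace_DA] R_in_DA)
    have y_lim: "y \<longlonglongrightarrow> x" using lim unfolding y_def[abs_def] .
    let ?g = "\<lambda>x t. indicator {0..T} t * normsq (l *\<^sub>R G l (S' t x))"
    have meas: "?g z \<in> borel_measurable lborel" for z
    proof -
      have [measurable]: "blinfun_apply (G l) \<in> borel_measurable borel"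
        by (intro borel_measurable_continuous_onI linear_continuous_on blinfun.bounded_linear_right)
      show ?thesis by measurable
    qed
    have "(\<integral>\<^sup>+t. ?g x t \<partial>lborel) = (\<integral>\<^sup>+t. liminf (\<lambda>n. ?g (y n) t) \<partial>lborel)"
    proof (rule nn_integral_cong)
      fix t :: real
      have "(\<lambda>n. normsq (l *\<^sub>R G l (S' t (y n)))) \<longlonglongrightarrow> normsq (l *\<^sub>R G l (S' t x))"
        by (intro tendsto_ennrealI tendsto_intros blinfun.tendsto y_lim tendsto_const)
      then have "(\<lambda>n. ?g (y n) t) \<longlonglongrightarrow> ?g x t"
        by (auto simp: indicator_def)
      then show "?g x t = liminf (\<lambda>n. ?g (y n) t)" by (intro lim_imp_Liminf[symmetric]) auto
    qed
    also have "\<dots> \<le> liminf (\<lambda>n. \<integral>\<^sup>+t. ?g (y n) t \<partial>lborel)"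
      by (rule nn_integral_liminf[OF meas])
    also have "\<dots> \<le> liminf (\<lambda>n. ennreal (2 * c * K\<^sup>2 * (norm (y n))\<^sup>2))"
      by (intro Liminf_mono always_eventually allI uniform_admissibility_DA[OF c cb l y])
    also have "\<dots> = ennreal (2 * c * K\<^sup>2 * (norm x)\<^sup>2)"
      by (intro lim_imp_Liminf tendsto_ennrealI tendsto_intros y_lim) auto
    finally show "(\<integral>\<^sup>+t. ?g x t \<partial>lborel) \<le> ennreal (2 * c * K\<^sup>2 * (norm x)\<^sup>2)" .
  qed
qed

text \<open>
  The Yosida approximations of the observation operator along a sequence of parameters at which the
  uniform bound is available.  They are bounded, are admissible with a common constant, and converge to
  the Yosida extension on its domain.\<close>

definition Y :: "nat \<Rightarrow> 'h \<Rightarrow>\<^sub>L 'h" where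
  "Y n = (4 * w + 1 + real n) *\<^sub>R G (4 * w + 1 + real n)"

lemma Y_eq: "Y n x = C ((4 * w + 1 + real n) *\<^sub>R resolvent DA A (4 * w + 1 + real n) x)"
proof -
  have l: "4 * w + 1 + real n > w" using w_nonneg by simp
  show ?thesis by (simp add: Y_def scaleR_blinfun.rep_eq G_apply[OF l] resolvent_eq[OF l] C_scaleR[OF R_in_DA[OF l]])
qed

lemma Y_tendsto:
  assumes "x \<in> yosida_dom DA A C"
  shows "(\<lambda>n. Y n x) \<longlonglongrightarrow> yosida_ext DA A C x"
proof -
  obtain y where y: "((\<lambda>l. C (l *\<^sub>R resolvent DA A l x)) \<longlongrightarrow> y) at_top"
    using assms unfolding yosida_dom_def by blast
  then have "yosida_ext DA A C x = y"
    using assms tendsto_Lim[OF _ y] unfolding yosida_ext_def by simp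
  with y have "((\<lambda>l. C (l *\<^sub>R resolvent DA A l x)) \<longlongrightarrow> yosida_ext DA A C x) at_top" by simp
  moreover have "filterlim (\<lambda>n. 4 * w + 1 + real n) at_top sequentially"
    by (rule filterlim_tendsto_add_at_top[OF tendsto_const filterlim_real_sequentially])
  ultimately show ?thesis unfolding Y_eq by (rule filterlim_compose)
qed

lemma Y_admissible:
  "\<exists>c\<ge>0. \<forall>n x. (\<integral>\<^sup>+t. indicator {0..T} t * normsq (Y n (S' t x)) \<partial>lborel) \<le> ennreal (c * (norm x)\<^sup>2)"
  using uniform_admissibility[of T] unfolding Y_def by (force simp: scaleR_blinfun.rep_eq)

end

section \<open>Covariance of the increments of the noise\<close>

text \<open>
  \<open>U\<close> is measurable with respect to \<open>FF s\<close>, which is independent of \<open>Y\<close>; so the expectation of the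
  product factorizes.\<close>

lemma (in prob_space) has_bochner_integral_past_indep:
  fixes U :: "'a \<Rightarrow> real" and Y :: "'a \<Rightarrow> 'b::topological_space"
  assumes Y: "indep_of_past M FF s Y" and sub: "subalgebra M (FF s)"
    and U: "U \<in> borel_measurable (FF s)" and \<phi>: "\<phi> \<in> borel_measurable borel"
    and iU: "integrable M U" and i\<phi>: "integrable M (\<lambda>\<omega>. \<phi> (Y \<omega>))"
  shows "has_bochner_integral M (\<lambda>\<omega>. U \<omega> * \<phi> (Y \<omega>)) (expectation U * expectation (\<lambda>\<omega>. \<phi> (Y \<omega>)))"
proof -
  have ind: "indep_set (sets (FF s)) (sets (vimage_algebra (space M) Y borel))"
    using Y by (simp add: indep_of_past_def)
  have spF: "space (FF s) = space M" using sub by (simp add: subalgebra_def)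
  have "indep_var borel U borel (\<lambda>\<omega>. \<phi> (Y \<omega>))"
    unfolding indep_var_eq
  proof (intro conjI)
    show "random_variable borel U" "random_variable borel (\<lambda>\<omega>. \<phi> (Y \<omega>))"
      using iU i\<phi> by auto
    let ?V = "vimage_algebra (space M) Y borel"
    let ?A = "{U -` A \<inter> space M |A. A \<in> sets borel}"
    let ?B = "{(\<lambda>\<omega>. \<phi> (Y \<omega>)) -` A \<inter> space M |A. A \<in> sets borel}"
    have \<phi>Y: "(\<lambda>\<omega>. \<phi> (Y \<omega>)) \<in> borel_measurable ?V"
      by (rule measurable_compose[OF measurable_vimage_algebra1 \<phi>]) auto
    have "?A \<subseteq> sets (FF s)" using measurable_sets[OF U] by (auto simp only: spF)
    then have 1: "sigma_sets (space M) ?A \<subseteq> sets (FF s)"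
      using sets.sigma_sets_subset[of ?A "FF s"] by (simp only: spF)
    have "?B \<subseteq> sets ?V" using measurable_sets[OF \<phi>Y] by (auto simp only: space_vimage_algebra)
    then have 2: "sigma_sets (space M) ?B \<subseteq> sets ?V"
      using sets.sigma_sets_subset[of ?B ?V] by (simp only: space_vimage_algebra)
    show "indep_set (sigma_sets (space M) ?A) (sigma_sets (space M) ?B)"
      using ind unfolding indep_sets2_eq
      by (intro conjI ballI order_trans[OF 1] order_trans[OF 2])
        (auto dest!: subsetD[OF 1] subsetD[OF 2] simp only:)
  qed
  from indep_var_integrable[OF this iU i\<phi>] indep_var_lebesgue_integral[OF this iU i\<phi>]
  show ?thesis by (simp add: has_bochner_integral_iff)
qed

definition overlap :: "real \<Rightarrow> real \<Rightarrow> real \<Rightarrow> real \<Rightarrow> real" where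
  "overlap a b c d = max 0 (min b d - max a c)"

lemma overlap_commute: "overlap a b c d = overlap c d a b"
  unfolding overlap_def min.commute[of b d] max.commute[of a c] ..

locale wiener = prob_space M
  for M :: "'w measure" +
  fixes FF :: "real \<Rightarrow> 'w measure"
    and Q :: "'v \<Rightarrow>\<^sub>L 'v::{real_inner,banach,second_countable_topology}"
    and I :: "nat set" and lam :: "nat \<Rightarrow> real" and e :: "nat \<Rightarrow> 'v"
    and \<beta> :: "nat \<Rightarrow> real \<Rightarrow> 'w \<Rightarrow> real" and W :: "real \<Rightarrow> 'w \<Rightarrow> 'v"
  assumes filtration: "normal_filtration M FF"
    and Q_wiener: "Q_wiener M FF Q I lam e \<beta> W"
begin

lemma subalg: "t \<ge> 0 \<Longrightarrow> subalgebra M (FF t)"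
  and FF_mono: "0 \<le> s \<Longrightarrow> s \<le> t \<Longrightarrow> sets (FF s) \<subseteq> sets (FF t)"
  using filtration[unfolded normal_filtration_def, THEN conjunct1]
    filtration[unfolded normal_filtration_def, THEN conjunct2, THEN conjunct1] by simp_all

lemma space_FF: "t \<ge> 0 \<Longrightarrow> space (FF t) = space M"
  using subalg by (auto simp: subalgebra_def)

lemma sets_FF: "t \<ge> 0 \<Longrightarrow> E \<in> sets (FF t) \<Longrightarrow> E \<in> sets M"
  using subalg by (auto simp: subalgebra_def)

lemma measurable_FF_mono:
  assumes "0 \<le> s" "s \<le> t" "f \<in> borel_measurable (FF s)" shows "f \<in> borel_measurable (FF t)"
proof -
  have "subalgebra (FF t) (FF s)"
    using assms FF_mono space_FF by (auto simp: subalgebra_def)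
  then show ?thesis using assms(3) by (rule measurable_from_subalg)
qed

lemma measurable_FF: "0 \<le> s \<Longrightarrow> f \<in> borel_measurable (FF s) \<Longrightarrow> f \<in> borel_measurable M"
  using measurable_from_subalg[OF subalg] .

lemma Q_wiener_conjuncts:
  "orthonormal_basis I e"
  "\<forall>k\<in>I. lam k \<ge> 0 \<and> Q (e k) = lam k *\<^sub>R e k"
  "lam summable_on I"
  "\<forall>k\<in>I. brownian_motion M FF (\<beta> k)"
  "indep_vars (\<lambda>k. PiM {0..} (\<lambda>_. borel)) (\<lambda>k \<omega>. \<lambda>t\<in>{0..}. \<beta> k t \<omega>) I"
  "\<forall>t\<ge>0. AE \<omega> in M. ((\<lambda>k. (sqrt (lam k) * \<beta> k t \<omega>) *\<^sub>R e k) has_sum W t \<omega>) I"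
  "\<forall>t\<ge>0. W t \<in> borel_measurable (FF t)"
  "\<forall>s\<ge>0. \<forall>t>s. indep_of_past M FF s (\<lambda>\<omega>. W t \<omega> - W s \<omega>)"
proof -
  note q = Q_wiener[unfolded Q_wiener_def]
  show "orthonormal_basis I e" "\<forall>k\<in>I. lam k \<ge> 0 \<and> Q (e k) = lam k *\<^sub>R e k"
    "lam summable_on I" "\<forall>k\<in>I. brownian_motion M FF (\<beta> k)"
    "indep_vars (\<lambda>k. PiM {0..} (\<lambda>_. borel)) (\<lambda>k \<omega>. \<lambda>t\<in>{0..}. \<beta> k t \<omega>) I"
    "\<forall>t\<ge>0. AE \<omega> in M. ((\<lambda>k. (sqrt (lam k) * \<beta> k t \<omega>) *\<^sub>R e k) has_sum W t \<omega>) I"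
    "\<forall>t\<ge>0. W t \<in> borel_measurable (FF t)"
    "\<forall>s\<ge>0. \<forall>t>s. indep_of_past M FF s (\<lambda>\<omega>. W t \<omega> - W s \<omega>)"
    using q by - (elim conjE, assumption)+
qed

lemma e_orth: "j \<in> I \<Longrightarrow> k \<in> I \<Longrightarrow> e j \<bullet> e k = (if j = k then 1 else 0)"
  using Q_wiener_conjuncts(1) by (simp add: orthonormal_basis_def)

lemma lam_nonneg: "k \<in> I \<Longrightarrow> lam k \<ge> 0"
  and BM: "k \<in> I \<Longrightarrow> brownian_motion M FF (\<beta> k)"
  and W_sum: "t \<ge> 0 \<Longrightarrow> AE \<omega> in M. ((\<lambda>k. (sqrt (lam k) * \<beta> k t \<omega>) *\<^sub>R e k) has_sum W t \<omega>) I"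
  and W_meas: "t \<ge> 0 \<Longrightarrow> W t \<in> borel_measurable (FF t)"
  and W_indep: "0 \<le> s \<Longrightarrow> s < t \<Longrightarrow> indep_of_past M FF s (\<lambda>\<omega>. W t \<omega> - W s \<omega>)"
  using Q_wiener_conjuncts(2,4,6,7,8) by simp_all

lemmas lam_summable = Q_wiener_conjuncts(3)
lemmas \<beta>_indep = Q_wiener_conjuncts(5)

lemma norm_e: "k \<in> I \<Longrightarrow> norm (e k) = 1"
  using e_orth[of k k] by (simp add: norm_eq_sqrt_inner)

lemma \<beta>_meas: "k \<in> I \<Longrightarrow> t \<ge> 0 \<Longrightarrow> \<beta> k t \<in> borel_measurable (FF t)"
  and \<beta>_distr: "k \<in> I \<Longrightarrow> 0 \<le> s \<Longrightarrow> s < t \<Longrightarrow>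
      distributed M lborel (\<lambda>\<omega>. \<beta> k t \<omega> - \<beta> k s \<omega>) (normal_density 0 (sqrt (t - s)))"
  and \<beta>_past: "k \<in> I \<Longrightarrow> 0 \<le> s \<Longrightarrow> s < t \<Longrightarrow> indep_of_past M FF s (\<lambda>\<omega>. \<beta> k t \<omega> - \<beta> k s \<omega>)"
  using BM[of k, unfolded brownian_motion_def] by simp_all

definition \<eta> :: "nat \<Rightarrow> real \<Rightarrow> real \<Rightarrow> 'w \<Rightarrow> real" where
  "\<eta> k s t \<omega> = sqrt (lam k) * (\<beta> k t \<omega> - \<beta> k s \<omega>)"

lemma \<eta>_same [simp]: "\<eta> k s s \<omega> = 0" by (simp add: \<eta>_def)

lemma \<eta>_split: "\<eta> k s u \<omega> = \<eta> k s t \<omega> + \<eta> k t u \<omega>" by (simp add: \<eta>_def algebra_simps)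

lemma \<eta>_meas: "k \<in> I \<Longrightarrow> 0 \<le> s \<Longrightarrow> s \<le> t \<Longrightarrow> \<eta> k s t \<in> borel_measurable (FF t)"
  unfolding \<eta>_def[abs_def]
  by (intro borel_measurable_times borel_measurable_const borel_measurable_diff \<beta>_meas)
    (auto intro: measurable_FF_mono[OF _ _ \<beta>_meas])

lemma increment_moments:
  assumes k: "k \<in> I" and s: "0 \<le> s" "s \<le> t"
  shows "has_bochner_integral M (\<eta> k s t) 0"
    and "has_bochner_integral M (\<lambda>\<omega>. (\<eta> k s t \<omega>)\<^sup>2) (lam k * (t - s))"
proof -
  have "has_bochner_integral M (\<eta> k s t) 0 \<and> has_bochner_integral M (\<lambda>\<omega>. (\<eta> k s t \<omega>)\<^sup>2) (lam k * (t - s))"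
  proof (cases "s = t")
    case True
    then show ?thesis by (simp add: has_bochner_integral_zero \<eta>_def[abs_def])
  next
    case False
    then have st: "s < t" using s by simp
    then have pos: "0 < sqrt (t - s)" by simp
    let ?X = "\<lambda>\<omega>. \<beta> k t \<omega> - \<beta> k s \<omega>"
    let ?n = "normal_density 0 (sqrt (t - s))"
    note D = \<beta>_distr[OF k s(1) st]
    have "integrable lborel (\<lambda>x. ?n x * x)" using integrable_normal_moment[OF pos, of 0 1] by simp
    then have i1: "integrable M ?X" using distributed_integrable_var[OF D] by simp
    have "integrable lborel (\<lambda>x. ?n x * x\<^sup>2)" using integrable_normal_moment[OF pos, of 0 2] by simp
    then have i2: "integrable M (\<lambda>\<omega>. (?X \<omega>)\<^sup>2)"
      using distributed_integrable[OF D, of "\<lambda>x. x\<^sup>2"] by simp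
    have e1: "expectation ?X = 0" by (rule normal_distributed_expectation[OF pos D])
    have e2: "expectation (\<lambda>\<omega>. (?X \<omega>)\<^sup>2) = t - s"
      using normal_distributed_variance[OF pos D] e1 st by simp
    have 1: "has_bochner_integral M ?X 0" using i1 e1 by (simp add: has_bochner_integral_iff)
    have 2: "has_bochner_integral M (\<lambda>\<omega>. (?X \<omega>)\<^sup>2) (t - s)" using i2 e2 by (simp add: has_bochner_integral_iff)
    show ?thesis
      using has_bochner_integral_mult_right[OF 1, of "sqrt (lam k)"] has_bochner_integral_mult_right[OF 2, of "lam k"]
      by (simp add: \<eta>_def[abs_def] power_mult_distrib lam_nonneg[OF k])
  qed
  then show "has_bochner_integral M (\<eta> k s t) 0"
    "has_bochner_integral M (\<lambda>\<omega>. (\<eta> k s t \<omega>)\<^sup>2) (lam k * (t - s))" by auto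
qed

lemma past_times_increment:
  assumes k: "k \<in> I" and s: "0 \<le> s" "s \<le> t"
    and U: "U \<in> borel_measurable (FF s)" "integrable M U"
  shows "has_bochner_integral M (\<lambda>\<omega>. U \<omega> * \<eta> k s t \<omega>) 0"
proof (cases "s = t")
  case False
  then have st: "s < t" using s by simp
  have "has_bochner_integral M (\<lambda>\<omega>. U \<omega> * (sqrt (lam k) * (\<beta> k t \<omega> - \<beta> k s \<omega>)))
    (expectation U * expectation (\<lambda>\<omega>. sqrt (lam k) * (\<beta> k t \<omega> - \<beta> k s \<omega>)))"
    using increment_moments(1)[OF k s]
    by (intro has_bochner_integral_past_indep[OF \<beta>_past[OF k s(1) st] subalg[OF s(1)] U(1) _ U(2)])
      (auto simp: \<eta>_def[abs_def] has_bochner_integral_iff)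
  then show ?thesis using increment_moments(1)[OF k s] by (simp add: \<eta>_def[abs_def] has_bochner_integral_iff)
qed (simp add: has_bochner_integral_zero)

lemma W_inner:
  assumes k: "k \<in> I" and t: "t \<ge> 0"
  shows "AE \<omega> in M. W t \<omega> \<bullet> e k = sqrt (lam k) * \<beta> k t \<omega>"
  using W_sum[OF t]
proof eventually_elim
  fix \<omega> assume *: "((\<lambda>k. (sqrt (lam k) * \<beta> k t \<omega>) *\<^sub>R e k) has_sum W t \<omega>) I"
  have 1: "((\<lambda>j. ((sqrt (lam j) * \<beta> j t \<omega>) *\<^sub>R e j) \<bullet> e k) has_sum (W t \<omega> \<bullet> e k)) I"
    using has_sum_bounded_linear[OF bounded_linear_inner_left *] .
  have 2: "((\<lambda>j. ((sqrt (lam j) * \<beta> j t \<omega>) *\<^sub>R e j) \<bullet> e k) has_sum (sqrt (lam k) * \<beta> k t \<omega>)) I"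
    by (rule has_sum_finite_neutralI[of "{k}"]) (use k in \<open>auto simp: e_orth\<close>)
  show "W t \<omega> \<bullet> e k = sqrt (lam k) * \<beta> k t \<omega>" by (rule has_sum_unique[OF 1 2])
qed

text \<open>
  The independence of the Brownian motions is that of their paths in the product space; increments
  are functions of the paths.\<close>

lemma distinct_increments:
  assumes kl: "k \<in> I" "l \<in> I" "k \<noteq> l" and s: "0 \<le> s" "s \<le> t"
  shows "has_bochner_integral M (\<lambda>\<omega>. \<eta> k s t \<omega> * \<eta> l s t \<omega>) 0"
proof -
  let ?N = "\<lambda>k::nat. PiM {0::real..} (\<lambda>_. borel :: real measure)"
  let ?X = "\<lambda>k \<omega>. \<lambda>t\<in>{0..}. \<beta> k t \<omega>"
  define ev where "ev k f = sqrt (lam k) * (f k t - f k s)" for k and f :: "nat \<Rightarrow> real \<Rightarrow> real"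
  have ev: "ev k \<in> borel_measurable (PiM {k} ?N)" for k
    unfolding ev_def[abs_def]
    by (intro borel_measurable_times borel_measurable_const borel_measurable_diff
        measurable_compose[OF measurable_component_singleton[of k "{k}"] measurable_component_singleton]) (use s in auto)
  have "indep_var (PiM {k} ?N) (\<lambda>\<omega>. restrict (\<lambda>i. ?X i \<omega>) {k}) (PiM {l} ?N) (\<lambda>\<omega>. restrict (\<lambda>i. ?X i \<omega>) {l})"
    by (rule indep_var_restrict[OF \<beta>_indep]) (use kl in auto)
  from indep_var_compose[OF this ev ev]
  have ind: "indep_var borel (ev k \<circ> (\<lambda>\<omega>. restrict (\<lambda>i. ?X i \<omega>) {k})) borel (ev l \<circ> (\<lambda>\<omega>. restrict (\<lambda>i. ?X i \<omega>) {l}))" .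
  have eq: "ev k \<circ> (\<lambda>\<omega>. restrict (\<lambda>i. ?X i \<omega>) {k}) = \<eta> k s t" for k
    using s by (auto simp: ev_def \<eta>_def fun_eq_iff)
  have i: "integrable M (\<eta> k s t)" "integrable M (\<eta> l s t)" and e: "expectation (\<eta> k s t) = 0"
    using increment_moments(1)[OF _ s] kl by (auto simp: has_bochner_integral_iff)
  show ?thesis
    using indep_var_integrable[OF ind[unfolded eq] i] indep_var_lebesgue_integral[OF ind[unfolded eq] i] e
    by (simp add: has_bochner_integral_iff)
qed

text \<open>
  For \<open>k = l\<close> the increment of a single Brownian motion is independent of the past.  For \<open>k \<noteq> l\<close> the pair
  of increments has to be independent of the past jointly; this holds because both are, almost surely,
  coordinates of the increment of \<open>W\<close>.\<close>

lemma same_interval_covariance: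
  assumes kl: "k \<in> I" "l \<in> I" and s: "0 \<le> s" "s \<le> t" and E: "E \<in> sets (FF s)"
  shows "has_bochner_integral M (\<lambda>\<omega>. indicator E \<omega> * (\<eta> k s t \<omega> * \<eta> l s t \<omega>)) (if k = l then lam k * prob E * (t - s) else 0)"
proof (cases "s = t")
  case True
  then show ?thesis by (simp add: has_bochner_integral_zero)
next
  case False
  then have st: "s < t" using s by simp
  have EM: "E \<in> sets M" by (rule sets_FF[OF s(1) E])
  have U: "(indicator E :: _ \<Rightarrow> real) \<in> borel_measurable (FF s)" "integrable M (indicator E :: _ \<Rightarrow> real)"
    using E EM by (auto intro!: integrable_real_indicator simp: emeasure_eq_measure)
  show ?thesis
  proof (cases "k = l")
    case True
    have "has_bochner_integral M (\<lambda>\<omega>. indicator E \<omega> * (sqrt (lam k) * (\<beta> k t \<omega> - \<beta> k s \<omega>))\<^sup>2)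
      (expectation (indicator E) * expectation (\<lambda>\<omega>. (sqrt (lam k) * (\<beta> k t \<omega> - \<beta> k s \<omega>))\<^sup>2))"
      using increment_moments(2)[OF kl(1) s]
      by (intro has_bochner_integral_past_indep[OF \<beta>_past[OF kl(1) s(1) st] subalg[OF s(1)] U(1) _ U(2)])
        (auto simp: \<eta>_def[abs_def] has_bochner_integral_iff)
    then show ?thesis using increment_moments(2)[OF kl(1) s] EM True
      by (simp add: \<eta>_def[abs_def] has_bochner_integral_iff power2_eq_square mult_ac)
  next
    case False
    define \<phi> where "\<phi> v = (v \<bullet> e k) * (v \<bullet> e l)" for v
    let ?Y = "\<lambda>\<omega>. W t \<omega> - W s \<omega>"
    have t: "t \<ge> 0" using s by simp
    have AE: "AE \<omega> in M. \<phi> (?Y \<omega>) = \<eta> k s t \<omega> * \<eta> l s t \<omega>"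
      using W_inner[OF kl(1) t] W_inner[OF kl(2) t] W_inner[OF kl(1) s(1)] W_inner[OF kl(2) s(1)]
      by eventually_elim (simp add: \<phi>_def \<eta>_def inner_diff_left algebra_simps)
    have [measurable]: "\<phi> \<in> borel_measurable borel" unfolding \<phi>_def[abs_def] by measurable
    have [measurable]: "W t \<in> borel_measurable M" "W s \<in> borel_measurable M"
      "\<eta> k s t \<in> borel_measurable M" "\<eta> l s t \<in> borel_measurable M"
      using measurable_FF[OF t W_meas[OF t]] measurable_FF[OF s(1) W_meas[OF s(1)]]
        measurable_FF[OF t \<eta>_meas[OF _ s]] kl by auto
    have b: "has_bochner_integral M (\<lambda>\<omega>. \<phi> (?Y \<omega>)) 0"
      by (rule has_bochner_integral_cong_AE[OF _ _ AE, THEN iffD2])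
        (auto intro: distinct_increments[OF kl False s])
    have "has_bochner_integral M (\<lambda>\<omega>. indicator E \<omega> * \<phi> (?Y \<omega>)) (expectation (indicator E) * expectation (\<lambda>\<omega>. \<phi> (?Y \<omega>)))"
      by (rule has_bochner_integral_past_indep[OF W_indep[OF s(1) st] subalg[OF s(1)] U(1) _ U(2)])
        (use b in \<open>auto simp: has_bochner_integral_iff\<close>)
    then have *: "has_bochner_integral M (\<lambda>\<omega>. indicator E \<omega> * \<phi> (?Y \<omega>)) 0"
      using b by (simp add: has_bochner_integral_iff)
    have "has_bochner_integral M (\<lambda>\<omega>. indicator E \<omega> * (\<eta> k s t \<omega> * \<eta> l s t \<omega>)) 0"
      by (subst has_bochner_integral_cong_AE[of _ _ "\<lambda>\<omega>. indicator E \<omega> * \<phi> (?Y \<omega>)"])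
        (use * EM AE in auto)
    then show ?thesis using False by simp
  qed
qed

text \<open>
  Cutting both intervals at \<open>c\<close> and at \<open>min b d\<close> leaves the common piece, whose contribution is known,
  and products in which one increment lies in the past of the other, whose expectations vanish.\<close>

lemma increment_covariance_ordered:
  assumes kl: "k \<in> I" "l \<in> I" and a: "0 \<le> a" "a \<le> b" and c: "a \<le> c" "c \<le> d"
    and E: "E \<in> sets (FF a)" and G: "G \<in> sets (FF c)"
  shows "has_bochner_integral M (\<lambda>\<omega>. (indicator E \<omega> * \<eta> k a b \<omega>) * (indicator G \<omega> * \<eta> l c d \<omega>))
     (if k = l then lam k * prob (E \<inter> G) * overlap a b c d else 0)"
proof -
  have c0: "c \<ge> 0" using a c by simp
  have Ec: "E \<in> sets (FF c)" using FF_mono[OF a(1) c(1)] E by blast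
  have EM: "E \<in> sets M" "G \<in> sets M" using sets_FF[OF a(1) E] sets_FF[OF c0 G] .
  have past: "has_bochner_integral M (\<lambda>\<omega>. (indicator E \<omega> * \<eta> k a m \<omega>) * (indicator G \<omega> * \<eta> l c d \<omega>)) 0"
    if m: "a \<le> m" "m \<le> c" for m
  proof -
    have "has_bochner_integral M (\<lambda>\<omega>. (indicator E \<omega> * indicator G \<omega> * \<eta> k a m \<omega>) * \<eta> l c d \<omega>) 0"
    proof (rule past_times_increment[OF kl(2) c0 c(2)])
      have "\<eta> k a m \<in> borel_measurable (FF c)"
        using measurable_FF_mono[OF _ m(2) \<eta>_meas[OF kl(1) a(1) m(1)]] a m by simp
      then show "(\<lambda>\<omega>. indicator E \<omega> * indicator G \<omega> * \<eta> k a m \<omega>) \<in> borel_measurable (FF c)"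
        using Ec G by measurable
      have "integrable M (\<lambda>\<omega>. indicator (E \<inter> G) \<omega> *\<^sub>R \<eta> k a m \<omega>)"
        by (rule integrable_mult_indicator) (use EM increment_moments(1)[OF kl(1) a(1) m(1)] in \<open>auto simp: has_bochner_integral_iff\<close>)
      then show "integrable M (\<lambda>\<omega>. indicator E \<omega> * indicator G \<omega> * \<eta> k a m \<omega>)"
        by (simp add: indicator_inter_arith)
    qed
    then show ?thesis by (simp add: mult_ac)
  qed
  show ?thesis
  proof (cases "b \<le> c")
    case True
    then have "overlap a b c d = 0" by (auto simp: overlap_def)
    then show ?thesis using past[OF a(2) True] by (simp cong: if_cong)
  next
    case False
    then have cb: "c \<le> b" by simp
    define m where "m = min b d"
    have m: "c \<le> m" "m \<le> b" "m \<le> d" "m = b \<or> m = d" using cb c by (auto simp: m_def)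
    have m0: "m \<ge> 0" using m c0 by simp
    have EG: "E \<inter> G \<in> sets (FF c)" using Ec G by blast
    have core: "has_bochner_integral M (\<lambda>\<omega>. indicator (E \<inter> G) \<omega> * (\<eta> k c m \<omega> * \<eta> l c m \<omega>)) (if k = l then lam k * prob (E \<inter> G) * (m - c) else 0)"
      by (rule same_interval_covariance[OF kl c0 m(1) EG])
    have late: "has_bochner_integral M (\<lambda>\<omega>. (indicator (E \<inter> G) \<omega> * \<eta> i c m \<omega>) * \<eta> j m u \<omega>) 0"
      if i: "i \<in> I" "j \<in> I" and u: "m \<le> u" for i j u
    proof (rule past_times_increment[OF i(2) m0 u])
      have "E \<inter> G \<in> sets (FF m)" using FF_mono[OF c0 m(1)] EG by blast
      then show "(\<lambda>\<omega>. indicator (E \<inter> G) \<omega> * \<eta> i c m \<omega>) \<in> borel_measurable (FF m)"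
        using \<eta>_meas[OF i(1) c0 m(1)] by measurable
      have "integrable M (\<lambda>\<omega>. indicator (E \<inter> G) \<omega> *\<^sub>R \<eta> i c m \<omega>)"
        by (rule integrable_mult_indicator) (use EM increment_moments(1)[OF i(1) c0 m(1)] in \<open>auto simp: has_bochner_integral_iff\<close>)
      then show "integrable M (\<lambda>\<omega>. indicator (E \<inter> G) \<omega> * \<eta> i c m \<omega>)" by simp
    qed
    have "has_bochner_integral M (\<lambda>\<omega>. (indicator E \<omega> * \<eta> k a c \<omega>) * (indicator G \<omega> * \<eta> l c d \<omega>)
        + (indicator (E \<inter> G) \<omega> * (\<eta> k c m \<omega> * \<eta> l c m \<omega>)
        + ((indicator (E \<inter> G) \<omega> * \<eta> l c m \<omega>) * \<eta> k m b \<omega> + (indicator (E \<inter> G) \<omega> * \<eta> k c m \<omega>) * \<eta> l m d \<omega>)))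
       (0 + ((if k = l then lam k * prob (E \<inter> G) * (m - c) else 0) + (0 + 0)))"
      by (intro has_bochner_integral_add past core late kl m c order_refl)
    moreover have "(indicator E \<omega> * \<eta> k a c \<omega>) * (indicator G \<omega> * \<eta> l c d \<omega>)
        + (indicator (E \<inter> G) \<omega> * (\<eta> k c m \<omega> * \<eta> l c m \<omega>)
        + ((indicator (E \<inter> G) \<omega> * \<eta> l c m \<omega>) * \<eta> k m b \<omega> + (indicator (E \<inter> G) \<omega> * \<eta> k c m \<omega>) * \<eta> l m d \<omega>))
      = (indicator E \<omega> * \<eta> k a b \<omega>) * (indicator G \<omega> * \<eta> l c d \<omega>)" for \<omega>
    proof -
      have "\<eta> k m b \<omega> * \<eta> l m d \<omega> = 0" using m(4) by auto
      then show ?thesis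
        unfolding \<eta>_split[of k a b \<omega> c] \<eta>_split[of k c b \<omega> m] \<eta>_split[of l c d \<omega> m] indicator_inter_arith
        by (simp add: algebra_simps)
    qed
    moreover have "overlap a b c d = m - c" using m c by (auto simp: overlap_def m_def)
    ultimately show ?thesis by (simp only: add_0_left add_0_right)
  qed
qed

lemma increment_covariance:
  assumes kl: "k \<in> I" "l \<in> I" and a: "0 \<le> a" "a \<le> b" and c: "0 \<le> c" "c \<le> d"
    and E: "E \<in> sets (FF a)" and G: "G \<in> sets (FF c)"
  shows "has_bochner_integral M (\<lambda>\<omega>. (indicator E \<omega> * \<eta> k a b \<omega>) * (indicator G \<omega> * \<eta> l c d \<omega>))
     (if k = l then lam k * prob (E \<inter> G) * overlap a b c d else 0)"
proof (cases "a \<le> c")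
  case True
  then show ?thesis by (intro increment_covariance_ordered assms)
next
  case False
  then have "c \<le> a" by simp
  from increment_covariance_ordered[OF kl(2,1) c this a(2) G E]
  show ?thesis by (simp add: mult.commute Int_commute overlap_commute eq_commute cong: if_cong)
qed

end

section \<open>The Ito isometry for elementary processes\<close>

lemma norm_add_sq_le: "(norm (x + y))\<^sup>2 \<le> 2 * (norm x)\<^sup>2 + 2 * (norm (y::'a::real_normed_vector))\<^sup>2"
proof -
  have "(norm (x + y))\<^sup>2 \<le> (norm x + norm y)\<^sup>2" by (intro power_mono norm_triangle_ineq) auto
  also have "\<dots> \<le> 2 * (norm x)\<^sup>2 + 2 * (norm y)\<^sup>2"
    using zero_le_power2[of "norm x - norm y"] by (simp add: power2_sum power2_diff)
  finally show ?thesis .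
qed

lemma nn_integral_has_bochner_integral:
  fixes f :: "'a \<Rightarrow> real"
  assumes "has_bochner_integral M f x" "\<And>\<omega>. 0 \<le> f \<omega>"
  shows "(\<integral>\<^sup>+\<omega>. ennreal (f \<omega>) \<partial>M) = ennreal x"
  using assms by (subst nn_integral_eq_integral) (auto simp: has_bochner_integral_iff)

lemma norm_sum_scaleR_sq:
  fixes v :: "'i \<Rightarrow> 'a::real_inner"
  shows "(norm (\<Sum>x\<in>X. z x *\<^sub>R v x))\<^sup>2 = (\<Sum>x\<in>X. \<Sum>y\<in>X. (z x * z y) * (v x \<bullet> v y))"
proof -
  let ?f = "\<lambda>x. z x *\<^sub>R v x"
  have "sum ?f X \<bullet> sum ?f X = (\<Sum>x\<in>X. ?f x \<bullet> sum ?f X)" by (rule inner_sum_left)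
  also have "\<dots> = (\<Sum>x\<in>X. \<Sum>y\<in>X. ?f x \<bullet> ?f y)" by (simp only: inner_sum_right)
  also have "\<dots> = (\<Sum>x\<in>X. \<Sum>y\<in>X. (z x * z y) * (v x \<bullet> v y))"
    by (intro sum.cong refl) (simp add: mult_ac)
  finally show ?thesis unfolding power2_norm_eq_inner .
qed

lemma indicator_prod_lborel:
  fixes a b c d :: real
  shows "has_bochner_integral lborel (\<lambda>s. indicator {a<..b} s * indicator {c<..d} s :: real) (overlap a b c d)"
proof -
  have eq: "(\<lambda>s. indicator {a<..b} s * indicator {c<..d} s) = (indicator {max a c<..min b d} :: real \<Rightarrow> real)"
    by (auto simp: indicator_def fun_eq_iff)
  show ?thesis
  proof (cases "max a c \<le> min b d")
    case True
    then have em: "emeasure lborel {max a c<..min b d} = ennreal (overlap a b c d)"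
      by (subst emeasure_lborel_Ioc) (auto simp: overlap_def)
    have "has_bochner_integral lborel (indicator {max a c<..min b d} :: real \<Rightarrow> real) (measure lborel {max a c<..min b d})"
      by (rule has_bochner_integral_real_indicator) (auto simp: em)
    moreover have "measure lborel {max a c<..min b d} = overlap a b c d"
      using True by (simp add: measure_def em) (simp add: overlap_def)
    ultimately show ?thesis unfolding eq by simp
  next
    case False
    then have "(indicator {max a c<..min b d} :: real \<Rightarrow> real) = (\<lambda>_. 0)" "overlap a b c d = 0"
      by (auto simp: overlap_def fun_eq_iff indicator_def)
    then show ?thesis unfolding eq by (simp only: has_bochner_integral_zero)
  qed
qed

text \<open>
  Joint measurability on a bounded time interval is turned into joint measurability on all times, so
  that all later integrals can be taken with respect to \<open>lborel\<close>.\<close>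

lemma measurable_extend_by_zero:
  fixes f :: "real \<times> 'w \<Rightarrow> 'b::real_normed_vector"
  assumes f: "f \<in> borel_measurable (restrict_space borel A \<Otimes>\<^sub>M M)" and A: "A \<in> sets borel"
  shows "(\<lambda>p. indicator A (fst p) *\<^sub>R f p) \<in> borel_measurable (borel \<Otimes>\<^sub>M M)"
proof -
  let ?P = "borel \<Otimes>\<^sub>M M :: (real \<times> 'w) measure"
  let ?\<Omega> = "A \<times> space M"
  have \<Omega>: "?\<Omega> \<inter> space ?P \<in> sets ?P" using A by auto
  have "(\<lambda>p. p) \<in> restrict_space ?P ?\<Omega> \<rightarrow>\<^sub>M restrict_space borel A \<Otimes>\<^sub>M M"
  proof (subst measurable_pair_iff, intro conjI)
    have "fst \<in> restrict_space ?P ?\<Omega> \<rightarrow>\<^sub>M borel" by (rule measurable_restrict_space1) simp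
    then show "fst \<circ> (\<lambda>p. p) \<in> restrict_space ?P ?\<Omega> \<rightarrow>\<^sub>M restrict_space borel A"
      by (auto intro!: measurable_restrict_space2 simp: comp_def space_restrict_space)
    have "snd \<in> restrict_space ?P ?\<Omega> \<rightarrow>\<^sub>M M" by (rule measurable_restrict_space1) simp
    then show "snd \<circ> (\<lambda>p. p) \<in> restrict_space ?P ?\<Omega> \<rightarrow>\<^sub>M M" by (simp add: comp_def)
  qed
  from measurable_compose[OF this f] have "f \<in> borel_measurable (restrict_space ?P ?\<Omega>)" .
  then have "(\<lambda>p. indicator ?\<Omega> p *\<^sub>R f p) \<in> borel_measurable ?P"
    by (subst (asm) borel_measurable_restrict_space_iff[OF \<Omega>])
  then show ?thesis
    by (rule measurable_cong[THEN iffD1, rotated]) (auto simp: indicator_def space_pair_measure)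
qed

text \<open>
  The square of the Hilbert-Schmidt norm as an extended nonnegative number.  It agrees with
  \<open>HS_norm\<close> when the squares are summable and is infinite otherwise, where \<open>HS_norm\<close> defaults to
  \<open>0\<close>; so it dominates its partial sums and depends measurably on its coordinates in all cases.\<close>

definition hs2 :: "nat set \<Rightarrow> (nat \<Rightarrow> real) \<Rightarrow> (nat \<Rightarrow> 'v) \<Rightarrow> ('v \<Rightarrow> 'h::real_normed_vector) \<Rightarrow> ennreal" where
  "hs2 I lam e D = (\<Sum>k. indicator I k * normsq (sqrt (lam k) *\<^sub>R D (e k)))"

lemma HS_norm_sq:
  assumes "(\<lambda>k. (norm (sqrt (lam k) *\<^sub>R D (e k)))\<^sup>2) summable_on I"
  shows "ennreal ((HS_norm I lam e D)\<^sup>2) = hs2 I lam e D"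
proof -
  let ?f = "\<lambda>k. (norm (sqrt (lam k) *\<^sub>R D (e k)))\<^sup>2"
  have "(?f has_sum infsum ?f I) I" using assms by (rule has_sum_infsum)
  then have "((\<lambda>k. indicator I k * ?f k) has_sum infsum ?f I) UNIV"
    by (subst has_sum_cong_neutral[where S = UNIV and T = I and g = ?f]) auto
  then have s: "(\<lambda>k. indicator I k * ?f k) sums infsum ?f I" by (rule has_sum_imp_sums)
  have "hs2 I lam e D = (\<Sum>k. ennreal (indicator I k * ?f k))"
    unfolding hs2_def by (intro suminf_cong) (auto simp: indicator_def)
  also have "\<dots> = ennreal (infsum ?f I)"
    using s by (subst suminf_ennreal2) (auto simp: sums_iff)
  finally show ?thesis by (simp add: HS_norm_def infsum_nonneg)
qed

text \<open>
  The form in which quadratic triangle inequalities are applied to Hilbert-Schmidt norms, coordinate by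
  coordinate.\<close>

lemma hs2_combine:
  assumes "\<And>k. k \<in> I \<Longrightarrow> (norm (D (e k)))\<^sup>2 \<le> c1 * (norm (D1 (e k)))\<^sup>2 + c2 * (norm (D2 (e k)))\<^sup>2 + c3 * (norm (D3 (e k)))\<^sup>2"
    and c: "c1 \<ge> 0" "c2 \<ge> 0" "c3 \<ge> 0"
  shows "hs2 I lam e D \<le> ennreal c1 * hs2 I lam e D1 + ennreal c2 * hs2 I lam e D2 + ennreal c3 * hs2 I lam e D3"
proof -
  let ?h = "\<lambda>D k. normsq (sqrt (lam k) *\<^sub>R D (e k))"
  have "hs2 I lam e D \<le> (\<Sum>k. ennreal c1 * (indicator I k * ?h D1 k) + ennreal c2 * (indicator I k * ?h D2 k) + ennreal c3 * (indicator I k * ?h D3 k))"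
    unfolding hs2_def
  proof (rule suminf_le)
    fix k
    show "indicator I k * ?h D k \<le> ennreal c1 * (indicator I k * ?h D1 k) + ennreal c2 * (indicator I k * ?h D2 k) + ennreal c3 * (indicator I k * ?h D3 k)"
    proof (cases "k \<in> I")
      case True
      have "(sqrt (lam k))\<^sup>2 * (norm (D (e k)))\<^sup>2 \<le> (sqrt (lam k))\<^sup>2 * (c1 * (norm (D1 (e k)))\<^sup>2 + c2 * (norm (D2 (e k)))\<^sup>2 + c3 * (norm (D3 (e k)))\<^sup>2)"
        by (rule mult_left_mono[OF assms(1)[OF True]]) simp
      then have "(norm (sqrt (lam k) *\<^sub>R D (e k)))\<^sup>2 \<le> c1 * (norm (sqrt (lam k) *\<^sub>R D1 (e k)))\<^sup>2 + c2 * (norm (sqrt (lam k) *\<^sub>R D2 (e k)))\<^sup>2 + c3 * (norm (sqrt (lam k) *\<^sub>R D3 (e k)))\<^sup>2"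
        by (simp only: norm_scaleR power_mult_distrib power2_abs) (simp add: algebra_simps)
      then show ?thesis using True c by (simp add: ennreal_mult[symmetric] ennreal_plus[symmetric] ennreal_leI del: ennreal_plus)
    qed simp
  qed auto
  also have "\<dots> = ennreal c1 * hs2 I lam e D1 + ennreal c2 * hs2 I lam e D2 + ennreal c3 * hs2 I lam e D3"
    unfolding hs2_def by (simp add: suminf_add[symmetric])
  finally show ?thesis .
qed

lemma borel_measurable_hs2:
  assumes "\<And>k. k \<in> I \<Longrightarrow> (\<lambda>x. sqrt (lam k) *\<^sub>R D x (e k)) \<in> borel_measurable N"
  shows "(\<lambda>x. hs2 I lam e (D x)) \<in> borel_measurable N"
  unfolding hs2_def
proof (rule borel_measurable_suminf_order)
  fix k show "(\<lambda>x. indicator I k * normsq (sqrt (lam k) *\<^sub>R D x (e k))) \<in> borel_measurable N"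
  proof (cases "k \<in> I")
    case True
    note [measurable] = assms[OF True]
    show ?thesis by measurable
  qed simp
qed

context wiener begin

text \<open>
  The Ito isometry for finitely many coordinates of the noise.  Expanding both squares gives the same
  double sum over pairs of summands: on the left by the covariance of increments, on the right because
  the product of two interval indicators integrates to the overlap.\<close>

lemma ito_isometry_truncated:
  fixes v :: "nat \<Rightarrow> nat \<Rightarrow> 'h::{real_inner,banach,second_countable_topology}"
  assumes J: "finite J" "J \<subseteq> I"
    and ab: "\<And>i. i < n \<Longrightarrow> 0 \<le> a i \<and> a i \<le> b i \<and> b i \<le> t \<and> E i \<in> sets (FF (a i))"
  shows "(\<integral>\<^sup>+\<omega>. normsq (\<Sum>k\<in>J. \<Sum>i<n. (indicator (E i) \<omega> * \<eta> k (a i) (b i) \<omega>) *\<^sub>R v i k) \<partial>M)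
    = (\<integral>\<^sup>+\<omega>. \<integral>\<^sup>+s. (\<Sum>k\<in>J. normsq (sqrt (lam k) *\<^sub>R (\<Sum>i<n. (indicator {a i<..b i} s * indicator (E i) \<omega>) *\<^sub>R v i k))) \<partial>lborel \<partial>M)"
proof -
  define V where "V = (\<Sum>k\<in>J. \<Sum>i<n. \<Sum>j<n. lam k * (prob (E i \<inter> E j) * overlap (a i) (b i) (a j) (b j)) * (v i k \<bullet> v j k))"
  have EM: "E i \<in> sets M" if "i < n" for i using sets_FF ab[OF that] by blast
  have lhs: "has_bochner_integral M (\<lambda>\<omega>. (norm (\<Sum>k\<in>J. \<Sum>i<n. (indicator (E i) \<omega> * \<eta> k (a i) (b i) \<omega>) *\<^sub>R v i k))\<^sup>2) V"
  proof -
    let ?X = "J \<times> {..<n}"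
    let ?z = "\<lambda>\<omega> x. indicator (E (snd x)) \<omega> * \<eta> (fst x) (a (snd x)) (b (snd x)) \<omega>"
    let ?v = "\<lambda>x. v (snd x) (fst x)"
    let ?c = "\<lambda>x y. if fst x = fst y then lam (fst x) * prob (E (snd x) \<inter> E (snd y)) * overlap (a (snd x)) (b (snd x)) (a (snd y)) (b (snd y)) else 0"
    have 1: "(\<Sum>k\<in>J. \<Sum>i<n. (indicator (E i) \<omega> * \<eta> k (a i) (b i) \<omega>) *\<^sub>R v i k) = (\<Sum>x\<in>?X. ?z \<omega> x *\<^sub>R ?v x)" for \<omega>
      by (simp add: sum.cartesian_product split_beta')
    have "has_bochner_integral M (\<lambda>\<omega>. \<Sum>x\<in>?X. \<Sum>y\<in>?X. (?z \<omega> x * ?z \<omega> y) * (?v x \<bullet> ?v y)) (\<Sum>x\<in>?X. \<Sum>y\<in>?X. ?c x y * (?v x \<bullet> ?v y))"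
      using J ab by (intro has_bochner_integral_sum has_bochner_integral_mult_left increment_covariance) auto
    moreover have "(\<Sum>x\<in>?X. \<Sum>y\<in>?X. ?c x y * (?v x \<bullet> ?v y)) = V"
    proof -
      have "(\<Sum>x\<in>?X. \<Sum>y\<in>?X. ?c x y * (?v x \<bullet> ?v y)) =
        (\<Sum>k\<in>J. \<Sum>i<n. \<Sum>l\<in>J. \<Sum>j<n. (if k = l then lam k * prob (E i \<inter> E j) * overlap (a i) (b i) (a j) (b j) else 0) * (v i k \<bullet> v j l))"
        by (simp only: sum.cartesian_product' fst_conv snd_conv)
      also have "\<dots> = V" unfolding V_def
      proof (rule sum.cong[OF refl], rule sum.cong[OF refl])
        fix k i assume k: "k \<in> J"
        have "(\<Sum>l\<in>J. \<Sum>j<n. (if k = l then lam k * prob (E i \<inter> E j) * overlap (a i) (b i) (a j) (b j) else 0) * (v i k \<bullet> v j l))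
          = (\<Sum>l\<in>J. if k = l then (\<Sum>j<n. lam k * (prob (E i \<inter> E j) * overlap (a i) (b i) (a j) (b j)) * (v i k \<bullet> v j l)) else 0)"
          by (intro sum.cong refl) (auto simp: mult.assoc)
        then show "(\<Sum>l\<in>J. \<Sum>j<n. (if k = l then lam k * prob (E i \<inter> E j) * overlap (a i) (b i) (a j) (b j) else 0) * (v i k \<bullet> v j l))
          = (\<Sum>j<n. lam k * (prob (E i \<inter> E j) * overlap (a i) (b i) (a j) (b j)) * (v i k \<bullet> v j k))"
          using J k by simp
      qed
      finally show ?thesis .
    qed
    ultimately show ?thesis unfolding 1 norm_sum_scaleR_sq by simp
  qed
  let ?g = "\<lambda>\<omega> s. \<Sum>k\<in>J. (norm (sqrt (lam k) *\<^sub>R (\<Sum>i<n. (indicator {a i<..b i} s * indicator (E i) \<omega>) *\<^sub>R v i k)))\<^sup>2"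
  let ?G = "\<lambda>\<omega>. \<Sum>k\<in>J. \<Sum>i<n. \<Sum>j<n. lam k * (indicator (E i \<inter> E j) \<omega> * overlap (a i) (b i) (a j) (b j)) * (v i k \<bullet> v j k)"
  have inner: "has_bochner_integral lborel (?g \<omega>) (?G \<omega>)" for \<omega>
  proof -
    have "?g \<omega> s = (\<Sum>k\<in>J. \<Sum>i<n. \<Sum>j<n. lam k * (indicator (E i \<inter> E j) \<omega> * (indicator {a i<..b i} s * indicator {a j<..b j} s)) * (v i k \<bullet> v j k))" for s
    proof (rule sum.cong[OF refl])
      fix k assume "k \<in> J"
      then have lamk: "(sqrt (lam k))\<^sup>2 = lam k" using lam_nonneg J by auto
      then show "(norm (sqrt (lam k) *\<^sub>R (\<Sum>i<n. (indicator {a i<..b i} s * indicator (E i) \<omega>) *\<^sub>R v i k)))\<^sup>2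
        = (\<Sum>i<n. \<Sum>j<n. lam k * (indicator (E i \<inter> E j) \<omega> * (indicator {a i<..b i} s * indicator {a j<..b j} s)) * (v i k \<bullet> v j k))"
        unfolding norm_scaleR power_mult_distrib power2_abs norm_sum_scaleR_sq
        by (simp only: lamk sum_distrib_left indicator_inter_arith mult_ac)
    qed
    then show ?thesis
      by (simp only:) (intro has_bochner_integral_sum has_bochner_integral_mult_left has_bochner_integral_mult_right indicator_prod_lborel)
  qed
  have g0: "?g \<omega> s \<ge> 0" for \<omega> s by (intro sum_nonneg) auto
  have G: "(\<integral>\<^sup>+s. ennreal (?g \<omega> s) \<partial>lborel) = ennreal (?G \<omega>)" for \<omega>
    by (rule nn_integral_has_bochner_integral[OF inner g0])
  have G0: "?G \<omega> \<ge> 0" for \<omega>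
  proof -
    have "?G \<omega> = (LINT s|lborel. ?g \<omega> s)" using inner[of \<omega>] by (simp only: has_bochner_integral_iff)
    also have "\<dots> \<ge> 0" by (rule Bochner_Integration.integral_nonneg[OF g0])
    finally show ?thesis .
  qed
  have outer: "has_bochner_integral M ?G V"
    unfolding V_def
    by (intro has_bochner_integral_sum has_bochner_integral_mult_left has_bochner_integral_mult_right has_bochner_integral_real_indicator)
      (auto simp: EM emeasure_eq_measure)
  have "(\<integral>\<^sup>+\<omega>. \<integral>\<^sup>+s. (\<Sum>k\<in>J. normsq (sqrt (lam k) *\<^sub>R (\<Sum>i<n. (indicator {a i<..b i} s * indicator (E i) \<omega>) *\<^sub>R v i k))) \<partial>lborel \<partial>M)
    = (\<integral>\<^sup>+\<omega>. \<integral>\<^sup>+s. ennreal (?g \<omega> s) \<partial>lborel \<partial>M)"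
    by (intro nn_integral_cong sum_ennreal) auto
  also have "\<dots> = ennreal V" unfolding G by (rule nn_integral_has_bochner_integral[OF outer G0])
  finally show ?thesis using nn_integral_has_bochner_integral[OF lhs] by simp
qed

lemma sum_list_nth: "(\<Sum>x\<leftarrow>xs. f x) = (\<Sum>i<length xs. f (xs ! i))"
  by (simp add: sum_list_sum_nth atLeast0LessThan)

text \<open>
  The definitions coerce the operators of the whole list to functions before summing; here they stay
  operators.\<close>

lemma elem_process_eq: "elem_process p s \<omega> v =
    (\<Sum>x\<leftarrow>p. (indicator {fst x<..fst (snd x)} s * indicator (fst (snd (snd x))) \<omega>) *\<^sub>R blinfun_apply (snd (snd (snd x))) v)"
  by (simp add: elem_process_def comp_def split_beta')

lemma elem_integral_eq: "elem_integral W p t \<omega> =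
    (\<Sum>x\<leftarrow>p. indicator (fst (snd (snd x))) \<omega> *\<^sub>R blinfun_apply (snd (snd (snd x))) (W (min (fst (snd x)) t) \<omega> - W (min (fst x) t) \<omega>))"
  by (simp add: elem_integral_def comp_def split_beta')

lemma W_partial_sums:
  assumes t: "t \<ge> 0"
  shows "AE \<omega> in M. (\<lambda>N. \<Sum>k\<in>{..<N} \<inter> I. (sqrt (lam k) * \<beta> k t \<omega>) *\<^sub>R e k) \<longlonglongrightarrow> W t \<omega>"
  using W_sum[OF t]
proof eventually_elim
  fix \<omega> assume *: "((\<lambda>k. (sqrt (lam k) * \<beta> k t \<omega>) *\<^sub>R e k) has_sum W t \<omega>) I"
  let ?f = "\<lambda>k. (sqrt (lam k) * \<beta> k t \<omega>) *\<^sub>R e k"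
  from * have "((\<lambda>k. if k \<in> I then ?f k else 0) has_sum W t \<omega>) UNIV"
    by (subst has_sum_cong_neutral[where S = UNIV and T = I and g = ?f]) auto
  then have "(\<lambda>k. if k \<in> I then ?f k else 0) sums W t \<omega>" by (rule has_sum_imp_sums)
  then show "(\<lambda>N. \<Sum>k\<in>{..<N} \<inter> I. ?f k) \<longlonglongrightarrow> W t \<omega>"
    by (simp add: sums_def sum.inter_restrict)
qed

text \<open>
  The partial sums over the coordinates of the noise converge almost surely, so Fatou's lemma turns
  the isometries of the partial sums into an inequality.\<close>

lemma ito_inequality:
  fixes p :: "('w, 'v, 'h::{real_inner,banach,second_countable_topology}) elementary"
  assumes p: "elementary FF p" and t: "t \<ge> 0"
  shows "(\<integral>\<^sup>+\<omega>. normsq (elem_integral W p t \<omega>) \<partial>M)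
    \<le> (\<integral>\<^sup>+\<omega>. \<integral>\<^sup>+s. indicator {0..t} s * hs2 I lam e (elem_process p s \<omega>) \<partial>lborel \<partial>M)"
proof -
  define n where "n = length p"
  define a0 b0 E0 B where "a0 i = fst (p ! i)" and "b0 i = fst (snd (p ! i))"
    and "E0 i = fst (snd (snd (p ! i)))" and "B i = snd (snd (snd (p ! i)))" for i
  have pi: "p ! i = (a0 i, b0 i, E0 i, B i)" for i by (simp add: a0_def b0_def E0_def B_def)
  have el: "0 \<le> a0 i" "a0 i \<le> b0 i" "E0 i \<in> sets (FF (a0 i))" if "i < n" for i
    using p nth_mem[of i p] that by (auto simp: elementary_def n_def pi)
  \<comment> \<open>Intervals are cut off at \<open>t\<close>; a summand that starts after \<open>t\<close> gets the empty event, which is measurable at time \<open>t\<close>.\<close>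
  define a b E where "a i = min (a0 i) t" and "b i = min (b0 i) t" and "E i = (if a0 i \<le> t then E0 i else {})" for i
  have ab: "0 \<le> a i \<and> a i \<le> b i \<and> b i \<le> t \<and> E i \<in> sets (FF (a i))" if "i < n" for i
    using el[OF that] t by (auto simp: a_def b_def E_def min_def)
  have proc: "elem_process p s \<omega> v = (\<Sum>i<n. (indicator {a i<..b i} s * indicator (E i) \<omega>) *\<^sub>R B i v)" if "s \<le> t" for s \<omega> v
    unfolding elem_process_eq sum_list_nth pi n_def[symmetric] fst_conv snd_conv
    by (intro sum.cong refl arg_cong2[where f = "(*\<^sub>R)"]) (use that in \<open>auto simp: a_def b_def E_def indicator_def\<close>)
  have int: "elem_integral W p t \<omega> = (\<Sum>i<n. indicator (E i) \<omega> *\<^sub>R B i (W (b i) \<omega> - W (a i) \<omega>))" for \<omega>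
    unfolding elem_integral_eq sum_list_nth pi n_def[symmetric] fst_conv snd_conv
  proof (intro sum.cong refl)
    fix i assume "i \<in> {..<n}"
    then have "a0 i \<le> b0 i" using el by auto
    then show "indicator (E0 i) \<omega> *\<^sub>R B i (W (min (b0 i) t) \<omega> - W (min (a0 i) t) \<omega>) = indicator (E i) \<omega> *\<^sub>R B i (W (b i) \<omega> - W (a i) \<omega>)"
      by (auto simp: E_def a_def b_def min_def)
  qed
  let ?J = "\<lambda>N::nat. {..<N} \<inter> I"
  let ?S = "\<lambda>N \<omega>. \<Sum>k\<in>?J N. \<Sum>i<n. (indicator (E i) \<omega> * \<eta> k (a i) (b i) \<omega>) *\<^sub>R B i (e k)"
  have EM: "E i \<in> sets M" if "i < n" for i using sets_FF ab[OF that] by blast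
  have meas: "?S N \<in> borel_measurable M" for N
  proof (intro borel_measurable_sum borel_measurable_scaleR borel_measurable_times borel_measurable_const)
    fix k i assume "k \<in> ?J N" "i \<in> {..<n}"
    then show "\<eta> k (a i) (b i) \<in> borel_measurable M" "(indicator (E i) :: 'w \<Rightarrow> real) \<in> borel_measurable M"
      using ab[of i] EM[of i] by (auto intro!: measurable_FF[OF _ \<eta>_meas, of "b i"])
  qed
  have "AE \<omega> in M. \<forall>i\<in>{..<n}. (\<lambda>N. \<Sum>k\<in>?J N. (sqrt (lam k) * \<beta> k (a i) \<omega>) *\<^sub>R e k) \<longlonglongrightarrow> W (a i) \<omega>
     \<and> (\<lambda>N. \<Sum>k\<in>?J N. (sqrt (lam k) * \<beta> k (b i) \<omega>) *\<^sub>R e k) \<longlonglongrightarrow> W (b i) \<omega>"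
  proof (rule AE_finite_allI)
    fix i assume "i \<in> {..<n}"
    then have "a i \<ge> 0" "b i \<ge> 0" using ab[of i] by auto
    from W_partial_sums[OF this(1)] W_partial_sums[OF this(2)]
    show "AE \<omega> in M. (\<lambda>N. \<Sum>k\<in>?J N. (sqrt (lam k) * \<beta> k (a i) \<omega>) *\<^sub>R e k) \<longlonglongrightarrow> W (a i) \<omega>
     \<and> (\<lambda>N. \<Sum>k\<in>?J N. (sqrt (lam k) * \<beta> k (b i) \<omega>) *\<^sub>R e k) \<longlonglongrightarrow> W (b i) \<omega>"
      by eventually_elim blast
  qed simp
  then have lim: "AE \<omega> in M. (\<lambda>N. ?S N \<omega>) \<longlonglongrightarrow> elem_integral W p t \<omega>"
  proof eventually_elim
    fix \<omega> assume *: "\<forall>i\<in>{..<n}. (\<lambda>N. \<Sum>k\<in>?J N. (sqrt (lam k) * \<beta> k (a i) \<omega>) *\<^sub>R e k) \<longlonglongrightarrow> W (a i) \<omega>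
     \<and> (\<lambda>N. \<Sum>k\<in>?J N. (sqrt (lam k) * \<beta> k (b i) \<omega>) *\<^sub>R e k) \<longlonglongrightarrow> W (b i) \<omega>"
    have "(\<lambda>N. \<Sum>i<n. indicator (E i) \<omega> *\<^sub>R B i ((\<Sum>k\<in>?J N. (sqrt (lam k) * \<beta> k (b i) \<omega>) *\<^sub>R e k) - (\<Sum>k\<in>?J N. (sqrt (lam k) * \<beta> k (a i) \<omega>) *\<^sub>R e k)))
      \<longlonglongrightarrow> (\<Sum>i<n. indicator (E i) \<omega> *\<^sub>R B i (W (b i) \<omega> - W (a i) \<omega>))"
      using * by (intro tendsto_sum tendsto_scaleR tendsto_const blinfun.tendsto tendsto_diff) auto
    moreover have "(\<Sum>i<n. indicator (E i) \<omega> *\<^sub>R B i ((\<Sum>k\<in>?J N. (sqrt (lam k) * \<beta> k (b i) \<omega>) *\<^sub>R e k) - (\<Sum>k\<in>?J N. (sqrt (lam k) * \<beta> k (a i) \<omega>) *\<^sub>R e k)))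
      = ?S N \<omega>" for N
      by (subst sum.swap) (simp add: sum_subtractf[symmetric] scaleR_left.diff[symmetric] \<eta>_def
        blinfun.sum_right blinfun.scaleR_right scaleR_sum_right right_diff_distrib)
    ultimately show "(\<lambda>N. ?S N \<omega>) \<longlonglongrightarrow> elem_integral W p t \<omega>" unfolding int by simp
  qed
  have "(\<integral>\<^sup>+\<omega>. normsq (elem_integral W p t \<omega>) \<partial>M) = (\<integral>\<^sup>+\<omega>. liminf (\<lambda>N. normsq (?S N \<omega>)) \<partial>M)"
  proof (rule nn_integral_cong_AE)
    show "AE \<omega> in M. normsq (elem_integral W p t \<omega>) = liminf (\<lambda>N. normsq (?S N \<omega>))"
      using lim
    proof eventually_elim
      fix \<omega> assume "(\<lambda>N. ?S N \<omega>) \<longlonglongrightarrow> elem_integral W p t \<omega>"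
      then have "(\<lambda>N. normsq (?S N \<omega>)) \<longlonglongrightarrow> normsq (elem_integral W p t \<omega>)"
        by (intro tendsto_ennrealI tendsto_power tendsto_norm)
      then show "normsq (elem_integral W p t \<omega>) = liminf (\<lambda>N. normsq (?S N \<omega>))"
        by (rule lim_imp_Liminf[OF trivial_limit_sequentially, symmetric])
    qed
  qed
  also have "\<dots> \<le> liminf (\<lambda>N. \<integral>\<^sup>+\<omega>. normsq (?S N \<omega>) \<partial>M)"
  proof (rule nn_integral_liminf)
    show "(\<lambda>\<omega>. normsq (?S N \<omega>)) \<in> borel_measurable M" for N
      by (rule measurable_compose[OF meas[of N]]) measurable
  qed
  also have "\<dots> \<le> liminf (\<lambda>N. (\<integral>\<^sup>+\<omega>. \<integral>\<^sup>+s. indicator {0..t} s * hs2 I lam e (elem_process p s \<omega>) \<partial>lborel \<partial>M))"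
  proof (intro Liminf_mono always_eventually allI)
    fix N
    have "(\<integral>\<^sup>+\<omega>. normsq (?S N \<omega>) \<partial>M) = (\<integral>\<^sup>+\<omega>. \<integral>\<^sup>+s. (\<Sum>k\<in>?J N. normsq (sqrt (lam k) *\<^sub>R (\<Sum>i<n. (indicator {a i<..b i} s * indicator (E i) \<omega>) *\<^sub>R B i (e k)))) \<partial>lborel \<partial>M)"
      by (rule ito_isometry_truncated) (use ab in auto)
    also have "\<dots> \<le> (\<integral>\<^sup>+\<omega>. \<integral>\<^sup>+s. indicator {0..t} s * hs2 I lam e (elem_process p s \<omega>) \<partial>lborel \<partial>M)"
    proof (intro nn_integral_mono)
      fix \<omega> s
      show "(\<Sum>k\<in>?J N. normsq (sqrt (lam k) *\<^sub>R (\<Sum>i<n. (indicator {a i<..b i} s * indicator (E i) \<omega>) *\<^sub>R B i (e k))))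
         \<le> indicator {0..t} s * hs2 I lam e (elem_process p s \<omega>)"
      proof (cases "s \<in> {0..t}")
        case True
        have "(\<Sum>k\<in>?J N. normsq (sqrt (lam k) *\<^sub>R elem_process p s \<omega> (e k)))
          = (\<Sum>k<N. indicator I k * normsq (sqrt (lam k) *\<^sub>R elem_process p s \<omega> (e k)))"
          by (rule sum.mono_neutral_cong_left) (auto simp: indicator_def)
        also have "\<dots> \<le> hs2 I lam e (elem_process p s \<omega>)"
          unfolding hs2_def by (rule sum_le_suminf) auto
        finally show ?thesis using True by (simp add: proc)
      next
        case False
        then have "i < n \<Longrightarrow> indicator {a i<..b i} s = (0::real)" for i using ab[of i] by (auto simp: indicator_def)
        then show ?thesis by simp
      qed
    qed
    finally show "(\<integral>\<^sup>+\<omega>. normsq (?S N \<omega>) \<partial>M) \<le> (\<integral>\<^sup>+\<omega>. \<integral>\<^sup>+s. indicator {0..t} s * hs2 I lam e (elem_process p s \<omega>) \<partial>lborel \<partial>M)" .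
  qed
  finally show ?thesis by (simp add: Liminf_const)
qed

end

section \<open>Mean square bounds for stochastic integrals\<close>

lemma summable_sq_add:
  fixes f g :: "nat \<Rightarrow> 'a::real_normed_vector"
  assumes "(\<lambda>k. (norm (f k))\<^sup>2) summable_on I" "(\<lambda>k. (norm (g k))\<^sup>2) summable_on I"
  shows "(\<lambda>k. (norm (f k - g k))\<^sup>2) summable_on I"
proof (rule summable_on_comparison_test)
  show "(\<lambda>k. 2 * (norm (f k))\<^sup>2 + 2 * (norm (g k))\<^sup>2) summable_on I"
    by (intro summable_on_add summable_on_cmult_right assms)
  show "(norm (f k - g k))\<^sup>2 \<le> 2 * (norm (f k))\<^sup>2 + 2 * (norm (g k))\<^sup>2" for k
    using norm_add_sq_le[of "f k" "- g k"] by simp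
qed simp

lemma (in prob_space) nn_integral_iterated_combination:
  assumes [measurable]: "A1 \<in> borel_measurable (borel \<Otimes>\<^sub>M M)" "A2 \<in> borel_measurable (borel \<Otimes>\<^sub>M M)"
    "A3 \<in> borel_measurable (borel \<Otimes>\<^sub>M M)"
  shows "(\<integral>\<^sup>+\<omega>. \<integral>\<^sup>+s. c1 * A1 (s, \<omega>) + c2 * A2 (s, \<omega>) + c3 * A3 (s, \<omega>) \<partial>lborel \<partial>M)
    = c1 * (\<integral>\<^sup>+\<omega>. \<integral>\<^sup>+s. A1 (s, \<omega>) \<partial>lborel \<partial>M) + c2 * (\<integral>\<^sup>+\<omega>. \<integral>\<^sup>+s. A2 (s, \<omega>) \<partial>lborel \<partial>M)
      + c3 * (\<integral>\<^sup>+\<omega>. \<integral>\<^sup>+s. A3 (s, \<omega>) \<partial>lborel \<partial>M)"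
proof -
  have inner: "(\<integral>\<^sup>+s. c1 * A1 (s, \<omega>) + c2 * A2 (s, \<omega>) + c3 * A3 (s, \<omega>) \<partial>lborel)
    = c1 * (\<integral>\<^sup>+s. A1 (s, \<omega>) \<partial>lborel) + c2 * (\<integral>\<^sup>+s. A2 (s, \<omega>) \<partial>lborel) + c3 * (\<integral>\<^sup>+s. A3 (s, \<omega>) \<partial>lborel)"
    if [measurable]: "\<omega> \<in> space M" for \<omega>
    by (simp add: nn_integral_add nn_integral_cmult)
  have "(\<integral>\<^sup>+\<omega>. \<integral>\<^sup>+s. c1 * A1 (s, \<omega>) + c2 * A2 (s, \<omega>) + c3 * A3 (s, \<omega>) \<partial>lborel \<partial>M)
    = (\<integral>\<^sup>+\<omega>. c1 * (\<integral>\<^sup>+s. A1 (s, \<omega>) \<partial>lborel) + c2 * (\<integral>\<^sup>+s. A2 (s, \<omega>) \<partial>lborel) + c3 * (\<integral>\<^sup>+s. A3 (s, \<omega>) \<partial>lborel) \<partial>M)"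
    by (rule nn_integral_cong) (rule inner)
  then show ?thesis by (simp add: nn_integral_add nn_integral_cmult)
qed

lemma hs2_indicator:
  "indicator A s * hs2 I lam e D = hs2 I lam e (\<lambda>v. indicator A s *\<^sub>R D v)"
  by (cases "s \<in> A") (simp_all add: hs2_def)

context wiener begin

lemma elem_process_HS:
  fixes p :: "('w, 'v, 'h::{real_inner,banach,second_countable_topology}) elementary"
  shows "(\<lambda>k. (norm (sqrt (lam k) *\<^sub>R elem_process p s \<omega> (e k)))\<^sup>2) summable_on I"
proof -
  define c where "c = (\<Sum>x\<leftarrow>p. norm (snd (snd (snd x))))"
  have bd: "norm (elem_process p s \<omega> v) \<le> c * norm v" for v
    unfolding elem_process_eq c_def
  proof (induction p)
    case (Cons x p)
    let ?T = "(indicator {fst x<..fst (snd x)} s * indicator (fst (snd (snd x))) \<omega>) *\<^sub>R blinfun_apply (snd (snd (snd x))) v"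
    have "norm ?T \<le> norm (blinfun_apply (snd (snd (snd x))) v)" by (auto simp: indicator_def)
    also have "\<dots> \<le> norm (snd (snd (snd x))) * norm v" by (rule norm_blinfun)
    finally have T: "norm ?T \<le> norm (snd (snd (snd x))) * norm v" .
    then show ?case using Cons.IH norm_triangle_ineq[of ?T] by (simp add: distrib_right) (smt (verit, best) norm_triangle_ineq)
  qed simp
  have c0: "c \<ge> 0" unfolding c_def by (rule sum_list_nonneg) auto
  show ?thesis
  proof (rule summable_on_comparison_test)
    show "(\<lambda>k. lam k * c\<^sup>2) summable_on I" by (intro summable_on_cmult_left lam_summable)
    fix k assume k: "k \<in> I"
    have "(norm (elem_process p s \<omega> (e k)))\<^sup>2 \<le> c\<^sup>2"
      using bd[of "e k"] norm_e[OF k] by (intro power_mono) auto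
    then show "(norm (sqrt (lam k) *\<^sub>R elem_process p s \<omega> (e k)))\<^sup>2 \<le> lam k * c\<^sup>2"
      using lam_nonneg[OF k] by (simp add: power_mult_distrib mult_left_mono)
  qed simp
qed

lemma elem_process_measurable:
  fixes p :: "('w, 'v, 'h::{real_inner,banach,second_countable_topology}) elementary"
  assumes "elementary FF p"
  shows "(\<lambda>x. elem_process p (fst x) (snd x) v) \<in> borel_measurable (borel \<Otimes>\<^sub>M M)"
  using assms unfolding elem_process_eq
proof (induction p)
  case (Cons x p)
  have 1: "fst (snd (snd x)) \<in> sets M" and 2: "elementary FF p"
    using Cons.prems sets_FF[of "fst x"] by (auto simp: elementary_def split_beta')
  note [measurable] = Cons.IH[OF 2] 1
  show ?case by simp
qed simp

lemma elem_integral_measurable: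
  fixes p :: "('w, 'v, 'h::{real_inner,banach,second_countable_topology}) elementary"
  assumes "elementary FF p" and t: "t \<ge> 0"
  shows "elem_integral W p t \<in> borel_measurable M"
  using assms(1) unfolding elem_integral_eq[abs_def]
proof (induction p)
  case (Cons x p)
  have 1: "fst (snd (snd x)) \<in> sets M" and 2: "elementary FF p" and 3: "0 \<le> fst x" "0 \<le> fst (snd x)"
    using Cons.prems sets_FF[of "fst x"] by (auto simp: elementary_def split_beta')
  have [measurable]: "W (min (fst x) t) \<in> borel_measurable M" "W (min (fst (snd x)) t) \<in> borel_measurable M"
    using 3 t by (auto intro!: measurable_FF[OF _ W_meas])
  have [measurable]: "blinfun_apply B \<in> borel_measurable borel" for B :: "'v \<Rightarrow>\<^sub>L 'h"
    by (intro borel_measurable_continuous_onI linear_continuous_on blinfun.bounded_linear_right)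
  note [measurable] = Cons.IH[OF 2] 1
  show ?case by simp
qed simp

text \<open>
  For the elementary processes approximating \<open>\<Phi>1\<close> and \<open>\<Phi>2\<close>, the process \<open>L (p1 - p2)\<close> is again
  elementary, with integral \<open>L\<close> applied to the difference of the integrals.  The Ito inequality for it
  passes to the limit; the factor \<open>4\<close> comes from two uses of \<open>(a + b)\<^sup>2 \<le> 2 * a\<^sup>2 + 2 * b\<^sup>2\<close>.\<close>

lemma stoch_integral_diff_bound:
  fixes L :: "'h \<Rightarrow>\<^sub>L 'h::{real_inner,banach,second_countable_topology}"
  assumes t: "t \<ge> 0"
    and 1: "has_stoch_integral M FF I lam e W \<Phi>1 t Y1" and 2: "has_stoch_integral M FF I lam e W \<Phi>2 t Y2"
  shows "(\<integral>\<^sup>+\<omega>. normsq (L (Y1 \<omega> - Y2 \<omega>)) \<partial>M)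
    \<le> 4 * (\<integral>\<^sup>+\<omega>. \<integral>\<^sup>+s. indicator {0..t} s * hs2 I lam e (\<lambda>v. L (\<Phi>1 s \<omega> v - \<Phi>2 s \<omega> v)) \<partial>lborel \<partial>M)"
proof -
  define N2 where "N2 = (norm L)\<^sup>2"
  have N2: "N2 \<ge> 0" by (simp add: N2_def)
  have L2: "(norm (L u))\<^sup>2 \<le> N2 * (norm u)\<^sup>2" for u
    using norm_blinfun[of L u] by (simp add: N2_def power_mult_distrib[symmetric] power_mono)
  have [measurable]: "blinfun_apply L \<in> borel_measurable borel"
    by (intro borel_measurable_continuous_onI linear_continuous_on blinfun.bounded_linear_right)
  define ind where "ind s = (indicator {0..t} s :: ennreal)" for s
  have [measurable]: "ind \<in> borel_measurable borel" unfolding ind_def[abs_def] by measurable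
  define \<Delta> where "\<Delta> p \<Phi> = (\<integral>\<^sup>+\<omega>. \<integral>\<^sup>+s. ind s * hs2 I lam e (\<lambda>v. elem_process p s \<omega> v - \<Phi> s \<omega> v) \<partial>lborel \<partial>M)"
    for p :: "('w, 'v, 'h) elementary" and \<Phi> :: "real \<Rightarrow> 'w \<Rightarrow> 'v \<Rightarrow> 'h"
  define \<epsilon> where "\<epsilon> p Y = (\<integral>\<^sup>+\<omega>. normsq (elem_integral W p t \<omega> - Y \<omega>) \<partial>M)"
    for p :: "('w, 'v, 'h) elementary" and Y
  have approx: "\<exists>p. (\<forall>n. elementary FF (p n)) \<and> (\<lambda>n. \<Delta> (p n) \<Phi>) \<longlonglongrightarrow> 0 \<and> (\<lambda>n. \<epsilon> (p n) Y) \<longlonglongrightarrow> 0"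
    if h: "has_stoch_integral M FF I lam e W \<Phi> t Y" for \<Phi> :: "real \<Rightarrow> 'w \<Rightarrow> 'v \<Rightarrow> 'h" and Y
  proof -
    obtain p where p: "\<forall>n. elementary FF (p n)"
      and l1: "(\<lambda>n. \<integral>\<^sup>+\<omega>. (\<integral>\<^sup>+s\<in>{0..t}. ennreal ((HS_norm I lam e (\<lambda>v. elem_process (p n) s \<omega> v - \<Phi> s \<omega> v))\<^sup>2) \<partial>lborel) \<partial>M) \<longlonglongrightarrow> 0"
      and l2: "(\<lambda>n. \<epsilon> (p n) Y) \<longlonglongrightarrow> 0"
      using h unfolding has_stoch_integral_def \<epsilon>_def by blast
    have "(\<integral>\<^sup>+\<omega>. (\<integral>\<^sup>+s\<in>{0..t}. ennreal ((HS_norm I lam e (\<lambda>v. elem_process (p n) s \<omega> v - \<Phi> s \<omega> v))\<^sup>2) \<partial>lborel) \<partial>M) = \<Delta> (p n) \<Phi>" for n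
      unfolding \<Delta>_def
    proof (intro nn_integral_cong)
      fix \<omega> s assume \<omega>: "\<omega> \<in> space M"
      show "ennreal ((HS_norm I lam e (\<lambda>v. elem_process (p n) s \<omega> v - \<Phi> s \<omega> v))\<^sup>2) * indicator {0..t} s
        = ind s * hs2 I lam e (\<lambda>v. elem_process (p n) s \<omega> v - \<Phi> s \<omega> v)"
      proof (cases "s \<in> {0..t}")
        case True
        then have "\<Phi> s \<omega> \<in> L20 I lam e" using h \<omega> by (simp add: has_stoch_integral_def)
        then have "(\<lambda>k. (norm (sqrt (lam k) *\<^sub>R \<Phi> s \<omega> (e k)))\<^sup>2) summable_on I" by (simp add: L20_def)
        from summable_sq_add[OF elem_process_HS this]
        have "(\<lambda>k. (norm (sqrt (lam k) *\<^sub>R (elem_process (p n) s \<omega> (e k) - \<Phi> s \<omega> (e k))))\<^sup>2) summable_on I"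
          by (simp only: scaleR_diff_right)
        from HS_norm_sq[where D = "\<lambda>v. elem_process (p n) s \<omega> v - \<Phi> s \<omega> v", OF this] show ?thesis using True by (simp add: ind_def)
      qed (simp add: ind_def)
    qed
    then show ?thesis using p l1 l2 by auto
  qed
  have meas\<Phi>: "(\<lambda>x. indicator {0..t} (fst x) *\<^sub>R (sqrt (lam k) *\<^sub>R \<Phi> (fst x) (snd x) (e k))) \<in> borel_measurable (borel \<Otimes>\<^sub>M M)"
    if h: "has_stoch_integral M FF I lam e W \<Phi> t Y" and k: "k \<in> I" for k and \<Phi> :: "real \<Rightarrow> 'w \<Rightarrow> 'v \<Rightarrow> 'h" and Y
  proof -
    have "(\<lambda>(s, \<omega>). sqrt (lam k) *\<^sub>R \<Phi> s \<omega> (e k)) \<in> borel_measurable (restrict_space borel {0..t} \<Otimes>\<^sub>M M)"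
      using h k by (simp add: has_stoch_integral_def)
    from measurable_extend_by_zero[OF this] show ?thesis by (simp add: split_beta')
  qed
  have meas: "(\<lambda>x. ind (fst x) * hs2 I lam e (\<lambda>v. elem_process p (fst x) (snd x) v - \<Phi> (fst x) (snd x) v)) \<in> borel_measurable (borel \<Otimes>\<^sub>M M)"
    if p: "elementary FF p" and h: "has_stoch_integral M FF I lam e W \<Phi> t Y"
    for p and \<Phi> :: "real \<Rightarrow> 'w \<Rightarrow> 'v \<Rightarrow> 'h" and Y
    unfolding ind_def hs2_indicator
  proof (rule borel_measurable_hs2)
    fix k assume k: "k \<in> I"
    note [measurable] = meas\<Phi>[OF h k] elem_process_measurable[OF p, of "e k"]
    have "(\<lambda>x. indicator {0..t} (fst x) *\<^sub>R (sqrt (lam k) *\<^sub>R elem_process p (fst x) (snd x) (e k))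
        - indicator {0..t} (fst x) *\<^sub>R (sqrt (lam k) *\<^sub>R \<Phi> (fst x) (snd x) (e k))) \<in> borel_measurable (borel \<Otimes>\<^sub>M M)"
      by measurable
    then show "(\<lambda>x. sqrt (lam k) *\<^sub>R indicator {0..t} (fst x) *\<^sub>R (elem_process p (fst x) (snd x) (e k) - \<Phi> (fst x) (snd x) (e k)))
        \<in> borel_measurable (borel \<Otimes>\<^sub>M M)"
      by (simp add: scaleR_diff_right mult.commute)
  qed
  have measL: "(\<lambda>x. ind (fst x) * hs2 I lam e (\<lambda>v. L (\<Phi>1 (fst x) (snd x) v - \<Phi>2 (fst x) (snd x) v))) \<in> borel_measurable (borel \<Otimes>\<^sub>M M)"
    unfolding ind_def hs2_indicator
  proof (rule borel_measurable_hs2)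
    fix k assume k: "k \<in> I"
    note [measurable] = meas\<Phi>[OF 1 k] meas\<Phi>[OF 2 k]
    have "(\<lambda>x. L (indicator {0..t} (fst x) *\<^sub>R (sqrt (lam k) *\<^sub>R \<Phi>1 (fst x) (snd x) (e k))
        - indicator {0..t} (fst x) *\<^sub>R (sqrt (lam k) *\<^sub>R \<Phi>2 (fst x) (snd x) (e k)))) \<in> borel_measurable (borel \<Otimes>\<^sub>M M)"
      by measurable
    then show "(\<lambda>x. sqrt (lam k) *\<^sub>R indicator {0..t} (fst x) *\<^sub>R L (\<Phi>1 (fst x) (snd x) (e k) - \<Phi>2 (fst x) (snd x) (e k)))
        \<in> borel_measurable (borel \<Otimes>\<^sub>M M)"
      by (simp add: scaleR_diff_right blinfun.diff_right blinfun.scaleR_right mult.commute)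
  qed
  obtain p1 where p1: "\<And>n. elementary FF (p1 n)" and \<Delta>1: "(\<lambda>n. \<Delta> (p1 n) \<Phi>1) \<longlonglongrightarrow> 0" and \<epsilon>1: "(\<lambda>n. \<epsilon> (p1 n) Y1) \<longlonglongrightarrow> 0"
    using approx[OF 1] by blast
  obtain p2 where p2: "\<And>n. elementary FF (p2 n)" and \<Delta>2: "(\<lambda>n. \<Delta> (p2 n) \<Phi>2) \<longlonglongrightarrow> 0" and \<epsilon>2: "(\<lambda>n. \<epsilon> (p2 n) Y2) \<longlonglongrightarrow> 0"
    using approx[OF 2] by blast
  have [measurable]: "Y1 \<in> borel_measurable M" "Y2 \<in> borel_measurable M"
    using 1 2 by (auto simp: has_stoch_integral_def)
  define R where "R = (\<integral>\<^sup>+\<omega>. \<integral>\<^sup>+s. ind s * hs2 I lam e (\<lambda>v. L (\<Phi>1 s \<omega> v - \<Phi>2 s \<omega> v)) \<partial>lborel \<partial>M)"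
  \<comment> \<open>The elementary process \<open>L (p1 n - p2 n)\<close>, as one list.\<close>
  define P where "P n = map (\<lambda>x. (fst x, fst (snd x), fst (snd (snd x)), L o\<^sub>L snd (snd (snd x)))) (p1 n)
      @ map (\<lambda>x. (fst x, fst (snd x), fst (snd (snd x)), - (L o\<^sub>L snd (snd (snd x))))) (p2 n)" for n
  have P_el: "elementary FF (P n)" for n
    using p1[of n] p2[of n] by (fastforce simp: elementary_def P_def)
  have sum_L: "(\<Sum>x\<leftarrow>xs. c x *\<^sub>R blinfun_apply L (g x)) = L (\<Sum>x\<leftarrow>xs. c x *\<^sub>R g x)"
    for xs :: "('w, 'v, 'h) elementary" and c g
    by (induction xs) (auto simp: blinfun.add_right blinfun.scaleR_right blinfun.zero_right)
  have sum_mL: "(\<Sum>x\<leftarrow>xs. - (c x *\<^sub>R blinfun_apply L (g x))) = - L (\<Sum>x\<leftarrow>xs. c x *\<^sub>R g x)"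
    for xs :: "('w, 'v, 'h) elementary" and c g
    by (induction xs) (auto simp: blinfun.add_right blinfun.scaleR_right blinfun.zero_right)
  have P_proc: "elem_process (P n) s \<omega> v = L (elem_process (p1 n) s \<omega> v - elem_process (p2 n) s \<omega> v)" for n s \<omega> v
    unfolding elem_process_eq P_def
    by (simp add: comp_def uminus_blinfun.rep_eq sum_L sum_mL blinfun.diff_right)
  have P_int: "elem_integral W (P n) t \<omega> = L (elem_integral W (p1 n) t \<omega> - elem_integral W (p2 n) t \<omega>)" for n \<omega>
    unfolding elem_integral_eq P_def
    by (simp add: comp_def uminus_blinfun.rep_eq sum_L sum_mL) (rule blinfun.diff_right[symmetric])
  have step1: "(\<integral>\<^sup>+\<omega>. \<integral>\<^sup>+s. ind s * hs2 I lam e (elem_process (P n) s \<omega>) \<partial>lborel \<partial>M)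
      \<le> 2 * R + ennreal (4 * N2) * \<Delta> (p1 n) \<Phi>1 + ennreal (4 * N2) * \<Delta> (p2 n) \<Phi>2" for n
  proof -
    let ?A1 = "\<lambda>x. ind (fst x) * hs2 I lam e (\<lambda>v. L (\<Phi>1 (fst x) (snd x) v - \<Phi>2 (fst x) (snd x) v))"
    let ?A2 = "\<lambda>x. ind (fst x) * hs2 I lam e (\<lambda>v. elem_process (p1 n) (fst x) (snd x) v - \<Phi>1 (fst x) (snd x) v)"
    let ?A3 = "\<lambda>x. ind (fst x) * hs2 I lam e (\<lambda>v. elem_process (p2 n) (fst x) (snd x) v - \<Phi>2 (fst x) (snd x) v)"
    have "(\<integral>\<^sup>+\<omega>. \<integral>\<^sup>+s. ind s * hs2 I lam e (elem_process (P n) s \<omega>) \<partial>lborel \<partial>M)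
      \<le> (\<integral>\<^sup>+\<omega>. \<integral>\<^sup>+s. 2 * ?A1 (s, \<omega>) + ennreal (4 * N2) * ?A2 (s, \<omega>) + ennreal (4 * N2) * ?A3 (s, \<omega>) \<partial>lborel \<partial>M)"
    proof (intro nn_integral_mono)
      fix \<omega> s
      have "hs2 I lam e (elem_process (P n) s \<omega>) \<le> ennreal 2 * hs2 I lam e (\<lambda>v. L (\<Phi>1 s \<omega> v - \<Phi>2 s \<omega> v))
         + ennreal (4 * N2) * hs2 I lam e (\<lambda>v. elem_process (p1 n) s \<omega> v - \<Phi>1 s \<omega> v)
         + ennreal (4 * N2) * hs2 I lam e (\<lambda>v. elem_process (p2 n) s \<omega> v - \<Phi>2 s \<omega> v)"
      proof (rule hs2_combine)
        fix k
        let ?u = "elem_process (p1 n) s \<omega> (e k) - \<Phi>1 s \<omega> (e k)" and ?v = "elem_process (p2 n) s \<omega> (e k) - \<Phi>2 s \<omega> (e k)"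
        let ?f = "L (\<Phi>1 s \<omega> (e k) - \<Phi>2 s \<omega> (e k))"
        have eq: "elem_process (P n) s \<omega> (e k) = ?f + (L ?u + - L ?v)"
          by (simp add: P_proc blinfun.diff_right)
        have "(norm (?f + (L ?u + - L ?v)))\<^sup>2 \<le> 2 * (norm ?f)\<^sup>2 + 2 * (norm (L ?u + - L ?v))\<^sup>2"
          by (rule norm_add_sq_le)
        also have "(norm (L ?u + - L ?v))\<^sup>2 \<le> 2 * (norm (L ?u))\<^sup>2 + 2 * (norm (L ?v))\<^sup>2"
          using norm_add_sq_le[of "L ?u" "- L ?v"] by simp
        also note L2[of ?u]
        also note L2[of ?v]
        finally show "(norm (elem_process (P n) s \<omega> (e k)))\<^sup>2 \<le> 2 * (norm ?f)\<^sup>2 + (4 * N2) * (norm ?u)\<^sup>2 + (4 * N2) * (norm ?v)\<^sup>2"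
          unfolding eq by simp
      qed (use N2 in auto)
      from mult_left_mono[OF this, of "ind s"]
      show "ind s * hs2 I lam e (elem_process (P n) s \<omega>) \<le> 2 * ?A1 (s, \<omega>) + ennreal (4 * N2) * ?A2 (s, \<omega>) + ennreal (4 * N2) * ?A3 (s, \<omega>)"
        by (simp add: distrib_left mult.left_commute)
    qed
    also have "\<dots> = 2 * (\<integral>\<^sup>+\<omega>. \<integral>\<^sup>+s. ?A1 (s, \<omega>) \<partial>lborel \<partial>M) + ennreal (4 * N2) * (\<integral>\<^sup>+\<omega>. \<integral>\<^sup>+s. ?A2 (s, \<omega>) \<partial>lborel \<partial>M)
        + ennreal (4 * N2) * (\<integral>\<^sup>+\<omega>. \<integral>\<^sup>+s. ?A3 (s, \<omega>) \<partial>lborel \<partial>M)"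
      by (rule nn_integral_iterated_combination[OF measL meas[OF p1 1] meas[OF p2 2]])
    finally show ?thesis by (simp add: R_def \<Delta>_def)
  qed
  have step2: "(\<integral>\<^sup>+\<omega>. normsq (L (Y1 \<omega> - Y2 \<omega>)) \<partial>M)
      \<le> 2 * (\<integral>\<^sup>+\<omega>. normsq (elem_integral W (P n) t \<omega>) \<partial>M) + ennreal (4 * N2) * \<epsilon> (p1 n) Y1 + ennreal (4 * N2) * \<epsilon> (p2 n) Y2" for n
  proof -
    let ?J = "\<lambda>p \<omega>. elem_integral W p t \<omega>"
    have [measurable]: "?J (P n) \<in> borel_measurable M" "?J (p1 n) \<in> borel_measurable M" "?J (p2 n) \<in> borel_measurable M"
      by (intro elem_integral_measurable P_el p1 p2 t)+
    have "(\<integral>\<^sup>+\<omega>. normsq (L (Y1 \<omega> - Y2 \<omega>)) \<partial>M)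
      \<le> (\<integral>\<^sup>+\<omega>. 2 * normsq (?J (P n) \<omega>) + ennreal (4 * N2) * normsq (?J (p1 n) \<omega> - Y1 \<omega>)
        + ennreal (4 * N2) * normsq (?J (p2 n) \<omega> - Y2 \<omega>) \<partial>M)"
    proof (rule nn_integral_mono)
      fix \<omega>
      let ?u = "?J (p1 n) \<omega> - Y1 \<omega>" and ?v = "?J (p2 n) \<omega> - Y2 \<omega>"
      have eq: "L (Y1 \<omega> - Y2 \<omega>) = ?J (P n) \<omega> + (- L ?u + L ?v)"
        by (simp add: P_int blinfun.diff_right)
      have "(norm (L (Y1 \<omega> - Y2 \<omega>)))\<^sup>2 \<le> 2 * (norm (?J (P n) \<omega>))\<^sup>2 + 2 * (norm (- L ?u + L ?v))\<^sup>2"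
        unfolding eq by (rule norm_add_sq_le)
      also have "(norm (- L ?u + L ?v))\<^sup>2 \<le> 2 * (norm (L ?u))\<^sup>2 + 2 * (norm (L ?v))\<^sup>2"
        using norm_add_sq_le[of "- L ?u" "L ?v"] by simp
      also note L2[of ?u]
      also note L2[of ?v]
      finally have "(norm (L (Y1 \<omega> - Y2 \<omega>)))\<^sup>2 \<le> 2 * (norm (?J (P n) \<omega>))\<^sup>2 + 4 * N2 * (norm ?u)\<^sup>2 + 4 * N2 * (norm ?v)\<^sup>2"
        by simp
      from ennreal_leI[OF this]
      show "normsq (L (Y1 \<omega> - Y2 \<omega>)) \<le> 2 * normsq (?J (P n) \<omega>) + ennreal (4 * N2) * normsq ?u
        + ennreal (4 * N2) * normsq ?v"
        using N2 by (simp add: ennreal_mult)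
    qed
    also have "\<dots> = 2 * (\<integral>\<^sup>+\<omega>. normsq (elem_integral W (P n) t \<omega>) \<partial>M) + ennreal (4 * N2) * \<epsilon> (p1 n) Y1 + ennreal (4 * N2) * \<epsilon> (p2 n) Y2"
      unfolding \<epsilon>_def by (simp add: nn_integral_add nn_integral_cmult)
    finally show ?thesis .
  qed
  have bound: "(\<integral>\<^sup>+\<omega>. normsq (L (Y1 \<omega> - Y2 \<omega>)) \<partial>M)
      \<le> 2 * (2 * R + ennreal (4 * N2) * \<Delta> (p1 n) \<Phi>1 + ennreal (4 * N2) * \<Delta> (p2 n) \<Phi>2) + ennreal (4 * N2) * \<epsilon> (p1 n) Y1 + ennreal (4 * N2) * \<epsilon> (p2 n) Y2" for n
  proof -
    have "(\<integral>\<^sup>+\<omega>. normsq (elem_integral W (P n) t \<omega>) \<partial>M)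
        \<le> 2 * R + ennreal (4 * N2) * \<Delta> (p1 n) \<Phi>1 + ennreal (4 * N2) * \<Delta> (p2 n) \<Phi>2"
      using ito_inequality[OF P_el t, of n] step1[of n] unfolding ind_def by (rule order_trans)
    then show ?thesis
      by (intro order_trans[OF step2[of n]] add_right_mono mult_left_mono) auto
  qed
  have "(\<lambda>n. 2 * (2 * R + ennreal (4 * N2) * \<Delta> (p1 n) \<Phi>1 + ennreal (4 * N2) * \<Delta> (p2 n) \<Phi>2) + ennreal (4 * N2) * \<epsilon> (p1 n) Y1 + ennreal (4 * N2) * \<epsilon> (p2 n) Y2)
     \<longlonglongrightarrow> 2 * (2 * R + ennreal (4 * N2) * 0 + ennreal (4 * N2) * 0) + ennreal (4 * N2) * 0 + ennreal (4 * N2) * 0"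
    by (intro tendsto_add ennreal_tendsto_cmult tendsto_const \<Delta>1 \<Delta>2 \<epsilon>1 \<epsilon>2) auto
  from LIMSEQ_le_const[OF this, of "\<integral>\<^sup>+\<omega>. normsq (L (Y1 \<omega> - Y2 \<omega>)) \<partial>M"] bound
  have "(\<integral>\<^sup>+\<omega>. normsq (L (Y1 \<omega> - Y2 \<omega>)) \<partial>M) \<le> 2 * (2 * R)" by auto
  also have "2 * (2 * R) = 4 * R" by (simp add: mult.assoc[symmetric])
  finally show ?thesis by (simp add: R_def ind_def)
qed

end

section \<open>Gronwall and absorption arguments\<close>

lemma norm_add3_sq_le: "(norm (x + y + z))\<^sup>2 \<le> 3 * (norm x)\<^sup>2 + 3 * (norm y)\<^sup>2 + 3 * (norm (z::'a::real_normed_vector))\<^sup>2"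
proof -
  have "(norm (x + y + z))\<^sup>2 \<le> (norm x + norm y + norm z)\<^sup>2"
    by (intro power_mono order_trans[OF norm_triangle_ineq] add_mono norm_triangle_ineq) auto
  also have "\<dots> \<le> 3 * (norm x)\<^sup>2 + 3 * (norm y)\<^sup>2 + 3 * (norm z)\<^sup>2"
    using zero_le_power2[of "norm x - norm y"] zero_le_power2[of "norm x - norm z"] zero_le_power2[of "norm y - norm z"]
    by (simp add: power2_eq_square algebra_simps)
  finally show ?thesis .
qed

text \<open>
  Reflecting time turns the integrand into \<open>exp (m * t)\<close> times the Laplace kernel.\<close>

lemma nn_integral_exp_upto:
  assumes m: "m > 0"
  shows "(\<integral>\<^sup>+s. indicator {0..t} s * ennreal (exp (m * s)) \<partial>lborel) \<le> ennreal (exp (m * t) / m)"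
proof -
  have "(\<integral>\<^sup>+s. indicator {0..t} s * ennreal (exp (m * s)) \<partial>lborel) \<le> (\<integral>\<^sup>+s. ennreal (exp (m * t)) * ennreal (\<kappa> m (t + (-1) * s)) \<partial>lborel)"
  proof (rule nn_integral_mono)
    fix s :: real
    have "exp (m * s) = exp (m * t) * exp (- m * (t - s))" by (simp add: exp_add[symmetric] algebra_simps)
    then show "indicator {0..t} s * ennreal (exp (m * s)) \<le> ennreal (exp (m * t)) * ennreal (\<kappa> m (t + (-1) * s))"
      by (auto simp: indicator_def \<kappa>_def ennreal_mult[symmetric])
  qed
  also have "\<dots> = ennreal (exp (m * t)) * (\<integral>\<^sup>+s. ennreal (\<kappa> m (t + (-1) * s)) \<partial>lborel)"
    by (rule nn_integral_cmult) measurable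
  also have "(\<integral>\<^sup>+s. ennreal (\<kappa> m (t + (-1) * s)) \<partial>lborel) = ennreal (1 / m)"
    using nn_integral_real_affine[of "\<lambda>s. ennreal (\<kappa> m s)" "-1" t] nn_integral_\<kappa>[OF m] by simp
  also have "ennreal (exp (m * t)) * ennreal (1 / m) = ennreal (exp (m * t) / m)"
    using m by (simp add: ennreal_mult[symmetric])
  finally show ?thesis .
qed

text \<open>
  With weight \<open>exp (- 2 * (b + 1) * t)\<close> the integral term contributes at most half the supremum
  \<open>Sp\<close> of the weighted function, so \<open>Sp \<le> a + Sp / 2\<close>; as \<open>Sp\<close> is finite by the a priori bound \<open>B\<close>, it is
  at most \<open>2 * a\<close>.\<close>

lemma gronwall_nn_integral:
  fixes v :: "real \<Rightarrow> ennreal"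
  assumes [measurable]: "v \<in> borel_measurable borel"
    and a: "a \<ge> 0" and b: "b \<ge> 0"
    and bounded: "\<And>t. 0 \<le> t \<Longrightarrow> t \<le> T \<Longrightarrow> v t \<le> ennreal B"
    and v: "\<And>t. 0 \<le> t \<Longrightarrow> t \<le> T \<Longrightarrow> v t \<le> ennreal a + ennreal b * (\<integral>\<^sup>+s. indicator {0..t} s * v s \<partial>lborel)"
    and t: "0 \<le> t" "t \<le> T"
  shows "v t \<le> ennreal (2 * a * exp (2 * (b + 1) * T))"
proof -
  define m where "m = 2 * (b + 1)"
  have m: "m > 0" using b by (simp add: m_def)
  define y where "y s = v s * ennreal (exp (- m * s))" for s
  define Sp where "Sp = (SUP s\<in>{0..T}. y s)"
  have vy: "v s = y s * ennreal (exp (m * s))" for s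
    by (simp add: y_def mult.assoc ennreal_mult[symmetric] exp_add[symmetric])
  have Sp_le: "Sp \<le> ennreal B"
    unfolding Sp_def
  proof (rule SUP_least)
    fix s assume s: "s \<in> {0..T}"
    have "y s \<le> ennreal B * 1" unfolding y_def
      using s m by (intro mult_mono bounded) (auto simp: mult_nonneg_nonneg)
    then show "y s \<le> ennreal B" by simp
  qed
  then obtain p where p: "p \<ge> 0" "Sp = ennreal p" by (cases Sp) (auto simp: top_unique)
  have ys: "y s \<le> ennreal (a + p / 2)" if s: "0 \<le> s" "s \<le> T" for s
  proof -
    have "(\<integral>\<^sup>+r. indicator {0..s} r * v r \<partial>lborel) \<le> (\<integral>\<^sup>+r. ennreal p * (indicator {0..s} r * ennreal (exp (m * r))) \<partial>lborel)"
    proof (rule nn_integral_mono)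
      fix r :: real
      have "r \<in> {0..s} \<Longrightarrow> y r \<le> ennreal p" unfolding p(2)[symmetric] Sp_def using s by (intro SUP_upper) auto
      then show "indicator {0..s} r * v r \<le> ennreal p * (indicator {0..s} r * ennreal (exp (m * r)))"
        by (auto simp: indicator_def vy intro!: mult_right_mono)
    qed
    also have "\<dots> = ennreal p * (\<integral>\<^sup>+r. indicator {0..s} r * ennreal (exp (m * r)) \<partial>lborel)"
      by (rule nn_integral_cmult) measurable
    also have "\<dots> \<le> ennreal p * ennreal (exp (m * s) / m)"
      by (intro mult_left_mono nn_integral_exp_upto m) simp
    also have "\<dots> = ennreal (p * (exp (m * s) / m))" using p m by (intro ennreal_mult[symmetric]) auto
    finally have "ennreal b * (\<integral>\<^sup>+r. indicator {0..s} r * v r \<partial>lborel) \<le> ennreal b * ennreal (p * (exp (m * s) / m))"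
      by (rule mult_left_mono) simp
    then have "v s \<le> ennreal a + ennreal b * ennreal (p * (exp (m * s) / m))"
      by (intro order_trans[OF v[OF s]] add_left_mono)
    also have "\<dots> = ennreal (a + b * (p * (exp (m * s) / m)))"
      using a b p m by (simp add: ennreal_mult[symmetric] ennreal_plus[symmetric] del: ennreal_plus)
    finally have "y s \<le> ennreal (a + b * (p * (exp (m * s) / m))) * ennreal (exp (- m * s))"
      unfolding y_def by (rule mult_right_mono) simp
    also have "\<dots> = ennreal ((a + b * (p * (exp (m * s) / m))) * exp (- m * s))"
      using a b p m by (subst ennreal_mult) auto
    also have "\<dots> \<le> ennreal (a + p / 2)"
    proof (rule ennreal_leI)
      have "(a + b * (p * (exp (m * s) / m))) * exp (- m * s) = a * exp (- m * s) + p * (b / m) * (exp (m * s) * exp (- m * s))"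
        by (simp add: algebra_simps)
      also have "exp (m * s) * exp (- m * s) = 1" by (simp add: exp_add[symmetric])
      also have "a * exp (- m * s) \<le> a * 1" using a m s by (intro mult_left_mono) auto
      also have "p * (b / m) * 1 \<le> p * (1 / 2)" 
      proof -
        have "b / m \<le> 1 / 2" using b by (simp add: m_def field_simps)
        then show ?thesis using p by (simp only: mult_1_right mult_left_mono)
      qed
      finally show "(a + b * (p * (exp (m * s) / m))) * exp (- m * s) \<le> a + p / 2" by simp
    qed
    finally show ?thesis .
  qed
  have "Sp \<le> ennreal (a + p / 2)" unfolding Sp_def by (rule SUP_least) (auto intro: ys)
  then have "p \<le> a + p / 2" unfolding p(2) using p a by (subst (asm) ennreal_le_iff) auto
  then have "p \<le> 2 * a" by simp
  have "v t \<le> ennreal p * ennreal (exp (m * t))"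
    unfolding vy[of t] p(2)[symmetric] Sp_def using t by (intro mult_right_mono SUP_upper) auto
  also have "\<dots> = ennreal (p * exp (m * t))" using p by (simp add: ennreal_mult)
  also have "\<dots> \<le> ennreal (2 * a * exp (2 * (b + 1) * T))"
    using \<open>p \<le> 2 * a\<close> p a m t b unfolding m_def[symmetric] by (intro ennreal_leI mult_mono) auto
  finally show ?thesis .
qed

lemma liminf_affine_ennreal:
  fixes a :: "nat \<Rightarrow> ennreal"
  shows "liminf (\<lambda>n. ennreal c + ennreal d * a n) = ennreal c + ennreal d * liminf a"
proof -
  have "liminf (\<lambda>n. (\<lambda>x. ennreal c + ennreal d * x) (a n)) = (\<lambda>x. ennreal c + ennreal d * x) (liminf a)"
  proof (rule Liminf_compose_continuous_mono)
    show "continuous_on UNIV (\<lambda>x. ennreal c + ennreal d * x)"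
      by (intro continuous_on_add_ennreal continuous_on_const ennreal_continuous_on_cmult continuous_on_id) auto
    show "mono (\<lambda>x. ennreal c + ennreal d * x)"
      by (intro monoI add_left_mono mult_left_mono) auto
  qed simp
  then show ?thesis .
qed

text \<open>
  Half of \<open>U\<close> can be subtracted from both sides because \<open>U\<close> is finite.\<close>

lemma absorb_half:
  fixes U l :: ennreal
  assumes "U < \<infinity>" "c \<ge> 0" "U \<le> ennreal c + ennreal (1/2) * U + 3 * l"
  shows "U \<le> ennreal (2 * c) + 6 * l"
proof (cases l)
  case (real l')
  obtain u where u: "U = ennreal u" "u \<ge> 0" using assms(1) by (cases U) auto
  have "ennreal c + ennreal (1/2) * ennreal u + ennreal 3 * ennreal l' = ennreal (c + (1/2) * u + 3 * l')"
    using assms(2) u(2) real(1) by (simp only: ennreal_mult[symmetric] ennreal_plus[symmetric])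
  then have "ennreal u \<le> ennreal (c + (1/2) * u + 3 * l')"
    using assms(3) unfolding u(1) real(2) by simp
  then have "u \<le> c + (1/2) * u + 3 * l'" using assms(2) u real by (subst (asm) ennreal_le_iff) auto
  then have "ennreal u \<le> ennreal (2 * c + 6 * l')" by (intro ennreal_leI) simp
  also have "\<dots> = ennreal (2 * c) + ennreal 6 * ennreal l'"
    using assms(2) real(1) by (simp add: ennreal_mult ennreal_plus)
  finally show ?thesis unfolding u(1) real(2) by simp
next
  case top
  then show ?thesis by (simp add: ennreal_mult_top)
qed

section \<open>The stochastic evolution equation\<close>

text \<open>
  The indicator of \<open>{0..t}\<close> at \<open>s\<close>, and its product with a vector, written so that they are visibly
  measurable in both times.\<close>

definition low :: "real \<Rightarrow> real \<Rightarrow> ennreal" where "low t s = (if 0 \<le> s \<and> s \<le> t then 1 else 0)"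

lemma borel_measurable_low [measurable (raw)]:
  assumes [measurable]: "f \<in> borel_measurable M" "g \<in> borel_measurable M"
  shows "(\<lambda>x. low (f x) (g x)) \<in> borel_measurable M"
  unfolding low_def by measurable

lemma low_indicator: "low t s = indicator {0..t} s" by (simp add: low_def indicator_def)

definition trunc :: "real \<Rightarrow> real \<Rightarrow> 'a \<Rightarrow> 'a::real_normed_vector" where
  "trunc t s x = (if 0 \<le> s \<and> s \<le> t then x else 0)"

lemma borel_measurable_trunc [measurable (raw)]:
  assumes [measurable]: "f \<in> borel_measurable M" "g \<in> borel_measurable M" "h \<in> borel_measurable M"
  shows "(\<lambda>x. trunc (f x) (g x) (h x)) \<in> borel_measurable M"
  unfolding trunc_def by measurable

lemma trunc_indicator: "trunc t s x = indicator {0..t} s *\<^sub>R x" by (simp add: trunc_def indicator_def)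

locale stochastic_equation = wiener M FF Q I lam e \<beta> W + C0_observation S DA A C
  for M :: "'w measure" and FF :: "real \<Rightarrow> 'w measure"
    and Q :: "'v \<Rightarrow>\<^sub>L 'v::{real_inner,banach,second_countable_topology}"
    and I :: "nat set" and lam :: "nat \<Rightarrow> real" and e :: "nat \<Rightarrow> 'v"
    and \<beta> :: "nat \<Rightarrow> real \<Rightarrow> 'w \<Rightarrow> real" and W :: "real \<Rightarrow> 'w \<Rightarrow> 'v"
    and S :: "real \<Rightarrow> 'h \<Rightarrow>\<^sub>L 'h::{real_inner,banach,second_countable_topology}"
    and DA A C +
  fixes F :: "'h \<Rightarrow> 'h" and Mu :: "'h \<Rightarrow> 'v \<Rightarrow> 'h" and k T :: real
  assumes Mu_L20: "Mu x \<in> L20 I lam e"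
    and k_pos: "k > 0"
    and lip: "norm (F x - F y) + HS_norm I lam e (\<lambda>v. Mu x v - Mu y v) \<le> k * norm (x - y)"
    and T_pos: "T > 0"
begin

lemma HS_norm_nonneg: "HS_norm I lam e D \<ge> 0"
  by (simp add: HS_norm_def infsum_nonneg)

lemma F_lip: "norm (F x - F y) \<le> k * norm (x - y)"
  and Mu_lip: "HS_norm I lam e (\<lambda>v. Mu x v - Mu y v) \<le> k * norm (x - y)"
  using lip[of x y] HS_norm_nonneg[of "\<lambda>v. Mu x v - Mu y v"] norm_ge_zero[of "F x - F y"] by linarith+

lemma hs2_Mu: "hs2 I lam e (\<lambda>v. Mu x v - Mu y v) \<le> ennreal (k\<^sup>2 * (norm (x - y))\<^sup>2)"
proof -
  have "(\<lambda>j. (norm (sqrt (lam j) *\<^sub>R Mu x (e j) - sqrt (lam j) *\<^sub>R Mu y (e j)))\<^sup>2) summable_on I"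
    using Mu_L20[of x] Mu_L20[of y] by (intro summable_sq_add) (auto simp: L20_def)
  then have "hs2 I lam e (\<lambda>v. Mu x v - Mu y v) = ennreal ((HS_norm I lam e (\<lambda>v. Mu x v - Mu y v))\<^sup>2)"
    by (intro HS_norm_sq[symmetric]) (simp add: scaleR_diff_right)
  also have "\<dots> \<le> ennreal ((k * norm (x - y))\<^sup>2)"
    by (intro ennreal_leI power_mono Mu_lip HS_norm_nonneg)
  finally show ?thesis by (simp add: power_mult_distrib)
qed

lemma borel_measurable_F [measurable]: "F \<in> borel_measurable borel"
proof (rule borel_measurable_continuous_onI)
  have "k-lipschitz_on UNIV F" by (rule lipschitz_onI) (use k_pos F_lip in \<open>auto simp: dist_norm\<close>)
  then show "continuous_on UNIV F" by (rule lipschitz_on_continuous_on)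
qed

text \<open>
  A single coordinate is dominated by the Hilbert-Schmidt norm and is therefore Lipschitz continuous.\<close>

lemma borel_measurable_Mu:
  assumes j: "j \<in> I" shows "(\<lambda>x. sqrt (lam j) *\<^sub>R Mu x (e j)) \<in> borel_measurable borel"
proof (rule borel_measurable_continuous_onI)
  have "norm (sqrt (lam j) *\<^sub>R Mu x (e j) - sqrt (lam j) *\<^sub>R Mu y (e j)) \<le> k * norm (x - y)" for x y
  proof -
    have "normsq (sqrt (lam j) *\<^sub>R (Mu x (e j) - Mu y (e j)))
        \<le> (\<Sum>i\<in>{j}. indicator I i * normsq (sqrt (lam i) *\<^sub>R (Mu x (e i) - Mu y (e i))))"
      using j by simp
    also have "\<dots> \<le> hs2 I lam e (\<lambda>v. Mu x v - Mu y v)"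
      unfolding hs2_def by (rule sum_le_suminf) auto
    also have "\<dots> \<le> ennreal (k\<^sup>2 * (norm (x - y))\<^sup>2)" by (rule hs2_Mu)
    finally have "(norm (sqrt (lam j) *\<^sub>R (Mu x (e j) - Mu y (e j))))\<^sup>2 \<le> (k * norm (x - y))\<^sup>2"
      by (subst (asm) ennreal_le_iff) (auto simp: power_mult_distrib)
    then have "norm (sqrt (lam j) *\<^sub>R (Mu x (e j) - Mu y (e j))) \<le> k * norm (x - y)"
      using k_pos by (auto intro: power2_le_imp_le)
    then show ?thesis by (simp only: scaleR_diff_right)
  qed
  then have "k-lipschitz_on UNIV (\<lambda>x. sqrt (lam j) *\<^sub>R Mu x (e j))"
    by (intro lipschitz_onI) (use k_pos in \<open>auto simp: dist_norm\<close>)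
  then show "continuous_on UNIV (\<lambda>x. sqrt (lam j) *\<^sub>R Mu x (e j))" by (rule lipschitz_on_continuous_on)
qed

lemma borel_measurable_blinfun [measurable (raw)]:
  fixes L :: "'h \<Rightarrow>\<^sub>L 'h"
  assumes "f \<in> borel_measurable N" shows "(\<lambda>x. L (f x)) \<in> borel_measurable N"
  by (rule measurable_compose[OF assms borel_measurable_continuous_onI])
    (intro linear_continuous_on blinfun.bounded_linear_right)

definition KT where "KT = K * exp (w * T)"

lemma KT_pos: "KT > 0" using K_ge_1 by (simp add: KT_def)

lemma norm_S'_KT: "t \<le> T \<Longrightarrow> norm (S' t x) \<le> KT * norm x"
proof -
  assume t: "t \<le> T"
  have "norm (S' t x) \<le> K * exp (w * max 0 t) * norm x" by (rule norm_S'_apply)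
  also have "\<dots> \<le> KT * norm x"
    unfolding KT_def using t T_pos w_nonneg K_ge_1 by (intro mult_right_mono mult_left_mono) (auto intro!: mult_left_mono)
  finally show ?thesis .
qed

definition cT where "cT = (SOME c. c \<ge> 0 \<and> (\<forall>n x. (\<integral>\<^sup>+t. indicator {0..T} t * normsq (Y n (S' t x)) \<partial>lborel) \<le> ennreal (c * (norm x)\<^sup>2)))"

lemma cT_nonneg: "cT \<ge> 0"
  and cT: "(\<integral>\<^sup>+t. low T t * normsq (Y n (S' t x)) \<partial>lborel) \<le> ennreal (cT * (norm x)\<^sup>2)"
proof -
  have "cT \<ge> 0 \<and> (\<forall>n x. (\<integral>\<^sup>+t. indicator {0..T} t * normsq (Y n (S' t x)) \<partial>lborel) \<le> ennreal (cT * (norm x)\<^sup>2))"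
    unfolding cT_def by (rule someI_ex) (rule Y_admissible)
  then show "cT \<ge> 0" "(\<integral>\<^sup>+t. low T t * normsq (Y n (S' t x)) \<partial>lborel) \<le> ennreal (cT * (norm x)\<^sup>2)"
    by (auto simp: low_indicator)
qed

lemma low_mult_commute: "r \<le> T \<Longrightarrow> low r t * low t s * a \<le> low r s * (low T (t - s) * a)"
  by (auto simp: low_def)

lemma shifted_admissibility:
  assumes r: "r \<le> T"
  shows "(\<integral>\<^sup>+t. low r t * low t s * normsq (Y n (S' (t - s) u)) \<partial>lborel) \<le> low r s * ennreal (cT * (norm u)\<^sup>2)"
proof -
  have "(\<integral>\<^sup>+t. low r t * low t s * normsq (Y n (S' (t - s) u)) \<partial>lborel)
     \<le> (\<integral>\<^sup>+t. low r s * (low T (t - s) * normsq (Y n (S' (t - s) u))) \<partial>lborel)"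
    by (intro nn_integral_mono low_mult_commute r)
  also have "\<dots> = low r s * (\<integral>\<^sup>+t. low T (t - s) * normsq (Y n (S' (t - s) u)) \<partial>lborel)"
    by (rule nn_integral_cmult) measurable
  also have "(\<integral>\<^sup>+t. low T (t - s) * normsq (Y n (S' (t - s) u)) \<partial>lborel)
    = (\<integral>\<^sup>+t. low T t * normsq (Y n (S' t u)) \<partial>lborel)"
    by (subst nn_integral_real_affine[where c = 1 and t = s]) auto
  finally show ?thesis using cT[of n u] by (meson mult_left_mono order_trans zero_le)
qed

text \<open>
  Splitting the integrand as \<open>exp (m * s)\<close> times \<open>exp (- m * s)\<close>, the first factor has square integral at
  most \<open>exp (2 * m * t) / (2 * m)\<close> over \<open>{0..t}\<close>.  The exponential weight thus gains a factor
  \<open>1 / (2 * m)\<close>, which can be made small.\<close>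

lemma convolution_Cauchy_Schwarz:
  fixes g :: "real \<Rightarrow> 'h" and L :: "'h \<Rightarrow>\<^sub>L 'h"
  assumes m: "m > 0" and [measurable]: "g \<in> borel_measurable borel"
    and i: "integrable lborel (\<lambda>s. trunc t s (S' (t - s) (g s)))"
  shows "ennreal (exp (- 2 * m * t) * (norm (L (LINT s|lborel. trunc t s (S' (t - s) (g s)))))\<^sup>2)
    \<le> ennreal (1 / (2 * m)) * (\<integral>\<^sup>+s. low t s * ennreal (exp (- 2 * m * s) * (norm (L (S' (t - s) (g s))))\<^sup>2) \<partial>lborel)"
proof -
  let ?f = "\<lambda>s. trunc t s (S' (t - s) (g s))"
  let ?n = "\<lambda>s. norm (L (S' (t - s) (g s)))"
  have iL: "integrable lborel (\<lambda>s. L (?f s))"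
    by (rule integrable_bounded_linear[OF blinfun.bounded_linear_right i])
  have "ennreal (norm (L (LINT s|lborel. ?f s))) = ennreal (norm (LINT s|lborel. L (?f s)))"
    by (simp add: integral_bounded_linear[OF blinfun.bounded_linear_right i])
  also have "\<dots> \<le> (\<integral>\<^sup>+s. ennreal (norm (L (?f s))) \<partial>lborel)"
    by (rule integral_norm_bound_ennreal[OF iL])
  also have "\<dots> = (\<integral>\<^sup>+s. (low t s * ennreal (exp (m * s))) * (low t s * ennreal (exp (- m * s) * ?n s)) \<partial>lborel)"
  proof (rule nn_integral_cong)
    fix s
    have "ennreal (exp (m * s)) * ennreal (exp (- m * s) * ?n s) = ennreal (?n s)"
      by (simp add: ennreal_mult[symmetric] mult.assoc[symmetric] exp_add[symmetric])
    then show "ennreal (norm (L (?f s))) = (low t s * ennreal (exp (m * s))) * (low t s * ennreal (exp (- m * s) * ?n s))"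
      by (simp add: low_def trunc_def blinfun.zero_right)
  qed
  finally have "(ennreal (norm (L (LINT s|lborel. ?f s))))\<^sup>2 \<le> (\<integral>\<^sup>+s. (low t s * ennreal (exp (m * s))) * (low t s * ennreal (exp (- m * s) * ?n s)) \<partial>lborel)\<^sup>2"
    by (rule power_mono) simp
  also have "\<dots> \<le> (\<integral>\<^sup>+s. (low t s * ennreal (exp (m * s)))\<^sup>2 \<partial>lborel) * (\<integral>\<^sup>+s. (low t s * ennreal (exp (- m * s) * ?n s))\<^sup>2 \<partial>lborel)"
    by (rule Cauchy_Schwarz_nn_integral) measurable
  also have "(\<integral>\<^sup>+s. (low t s * ennreal (exp (m * s)))\<^sup>2 \<partial>lborel) = (\<integral>\<^sup>+s. indicator {0..t} s * ennreal (exp ((2 * m) * s)) \<partial>lborel)"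
    by (rule nn_integral_cong) (auto simp: low_def ennreal_power exp_double[symmetric] mult.assoc)
  also have "(\<integral>\<^sup>+s. (low t s * ennreal (exp (- m * s) * ?n s))\<^sup>2 \<partial>lborel)
      = (\<integral>\<^sup>+s. low t s * ennreal (exp (- 2 * m * s) * (?n s)\<^sup>2) \<partial>lborel)" (is "_ = ?I")
  proof (rule nn_integral_cong)
    fix s
    have "(exp (- m * s) * ?n s)\<^sup>2 = exp (- 2 * m * s) * (?n s)\<^sup>2"
      by (simp add: power_mult_distrib exp_double[symmetric] mult.assoc)
    then show "(low t s * ennreal (exp (- m * s) * ?n s))\<^sup>2 = low t s * ennreal (exp (- 2 * m * s) * (?n s)\<^sup>2)"
      by (auto simp: low_def ennreal_power)
  qed
  also have "(\<integral>\<^sup>+s. indicator {0..t} s * ennreal (exp ((2 * m) * s)) \<partial>lborel) * ?I \<le> ennreal (exp (2 * m * t) / (2 * m)) * ?I"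
    using m by (intro mult_right_mono nn_integral_exp_upto) auto
  finally have *: "(ennreal (norm (L (LINT s|lborel. ?f s))))\<^sup>2 \<le> ennreal (exp (2 * m * t) / (2 * m)) * ?I" by simp
  have "ennreal (exp (- 2 * m * t) * (norm (L (LINT s|lborel. ?f s)))\<^sup>2) = ennreal (exp (- 2 * m * t)) * (ennreal (norm (L (LINT s|lborel. ?f s))))\<^sup>2"
    by (simp add: ennreal_mult ennreal_power)
  also have "\<dots> \<le> ennreal (exp (- 2 * m * t)) * (ennreal (exp (2 * m * t) / (2 * m)) * ?I)"
    by (rule mult_left_mono[OF *]) simp
  also have "\<dots> = ennreal (1 / (2 * m)) * ?I"
  proof -
    have "exp (- 2 * m * t) * (exp (2 * m * t) / (2 * m)) = 1 / (2 * m)"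
      by (simp add: exp_add[symmetric])
    then have "ennreal (exp (- 2 * m * t)) * ennreal (exp (2 * m * t) / (2 * m)) = ennreal (1 / (2 * m))"
      using m by (subst ennreal_mult[symmetric]) auto
    then show ?thesis by (simp only: mult.assoc[symmetric])
  qed
  finally show ?thesis .
qed

abbreviation sol where "sol x X \<equiv> mild_solution M FF I lam e W S DA A C F Mu T x X"

text \<open>
  A solution, its observation \<open>obs\<close> by the Yosida extension, the drift convolution \<open>conv\<close> and the remaining
  part \<open>noise\<close> of the variation of constants formula, as functions of time and chance.  Unlike the
  stochastic convolution, which is given for each time only up to a null set, \<open>noise\<close> is jointly
  measurable.\<close>

definition ext :: "(real \<Rightarrow> 'w \<Rightarrow> 'h) \<Rightarrow> real \<times> 'w \<Rightarrow> 'h" where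
  "ext X p = trunc T (fst p) (X (fst p) (snd p))"

definition obs :: "(real \<Rightarrow> 'w \<Rightarrow> 'h) \<Rightarrow> real \<times> 'w \<Rightarrow> 'h" where
  "obs X = ext (\<lambda>t \<omega>. yosida_ext DA A C (X t \<omega>))"

definition conv :: "(real \<Rightarrow> 'w \<Rightarrow> 'h) \<Rightarrow> real \<times> 'w \<Rightarrow> 'h" where
  "conv X p = (LINT s|lborel. trunc (fst p) s (S' (fst p - s) (F (obs X (s, snd p)))))"

definition noise :: "'h \<Rightarrow> (real \<Rightarrow> 'w \<Rightarrow> 'h) \<Rightarrow> real \<times> 'w \<Rightarrow> 'h" where
  "noise x X p = ext X p - (S' (fst p) x + conv X p)"

lemma ext_measurable:
  assumes "(\<lambda>(t, \<omega>). X t \<omega>) \<in> borel_measurable (restrict_space borel {0..T} \<Otimes>\<^sub>M M)"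
  shows "ext X \<in> borel_measurable (borel \<Otimes>\<^sub>M M)"
  using measurable_extend_by_zero[OF assms] unfolding ext_def[abs_def] trunc_indicator by (simp add: split_beta')

lemma sol_measurable:
  assumes "sol x X"
  shows "ext X \<in> borel_measurable (borel \<Otimes>\<^sub>M M)" and "obs X \<in> borel_measurable (borel \<Otimes>\<^sub>M M)"
  using assms unfolding obs_def mild_solution_def C_adapted_def by (auto intro!: ext_measurable)

lemma conv_measurable:
  assumes "sol x X" shows "conv X \<in> borel_measurable (borel \<Otimes>\<^sub>M M)"
proof -
  note [measurable] = sol_measurable[OF assms]
  show ?thesis unfolding conv_def[abs_def] by measurable
qed

lemma noise_measurable:
  assumes "sol x X" shows "noise x X \<in> borel_measurable (borel \<Otimes>\<^sub>M M)"
proof -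
  note [measurable] = sol_measurable[OF assms] conv_measurable[OF assms]
  show ?thesis unfolding noise_def[abs_def] by measurable
qed

lemma noise_stoch_integral:
  assumes X: "sol x X" and t: "t \<in> {0..T}"
  shows "\<exists>Z. has_stoch_integral M FF I lam e W (\<lambda>s \<omega> v. S (t - s) (Mu (X s \<omega>) v)) t Z \<and> (AE \<omega> in M. noise x X (t, \<omega>) = Z \<omega>)"
proof -
  have "\<exists>Z. has_stoch_integral M FF I lam e W (\<lambda>s \<omega> v. S (t - s) (Mu (X s \<omega>) v)) t Z \<and>
        (AE \<omega> in M. X t \<omega> = S t x + (LINT s:{0..t}|lborel. S (t - s) (F (yosida_ext DA A C (X s \<omega>)))) + Z \<omega>)"
    using X t unfolding mild_solution_def by blast
  then obtain Z where Z: "has_stoch_integral M FF I lam e W (\<lambda>s \<omega> v. S (t - s) (Mu (X s \<omega>) v)) t Z"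
    and eq: "AE \<omega> in M. X t \<omega> = S t x + (LINT s:{0..t}|lborel. S (t - s) (F (yosida_ext DA A C (X s \<omega>)))) + Z \<omega>"
    by blast
  have "(LINT s:{0..t}|lborel. S (t - s) (F (yosida_ext DA A C (X s \<omega>)))) = conv X (t, \<omega>)" for \<omega>
    unfolding set_lebesgue_integral_def conv_def
    by (rule Bochner_Integration.integral_cong)
      (use t in \<open>auto simp: trunc_def indicator_def obs_def ext_def S'_eq\<close>)
  then have "AE \<omega> in M. noise x X (t, \<omega>) = Z \<omega>"
    using eq t by (auto elim!: eventually_mono simp: noise_def ext_def trunc_def S'_eq)
  with Z show ?thesis by blast
qed

end

section \<open>The difference of two solutions\<close>

locale solution_pair = stochastic_equation M FF Q I lam e \<beta> W S DA A C F Mu k T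
  for M :: "'w measure" and FF
    and Q :: "'v \<Rightarrow>\<^sub>L 'v::{real_inner,banach,second_countable_topology}" and I lam e \<beta> W
    and S :: "real \<Rightarrow> 'h \<Rightarrow>\<^sub>L 'h::{real_inner,banach,second_countable_topology}" and DA A C F Mu k T +
  fixes x1 x2 :: 'h and X1 X2 :: "real \<Rightarrow> 'w \<Rightarrow> 'h"
  assumes X1: "sol x1 X1" and X2: "sol x2 X2"
begin

sublocale time_omega: pair_sigma_finite lborel M
  by unfold_locales

definition D where "D p = ext X1 p - ext X2 p"
definition h where "h p = obs X1 p - obs X2 p"
definition g where "g p = F (obs X1 p) - F (obs X2 p)"
definition Z where "Z p = noise x1 X1 p - noise x2 X2 p"
definition cv where "cv p = (LINT s|lborel. trunc (fst p) s (S' (fst p - s) (g (s, snd p))))"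
definition m where "m j p = sqrt (lam j) *\<^sub>R Mu (ext X1 p) (e j) - sqrt (lam j) *\<^sub>R Mu (ext X2 p) (e j)"
definition v where "v s = (\<integral>\<^sup>+\<omega>. normsq (D (s, \<omega>)) \<partial>M)"

lemmas [measurable] = sol_measurable[OF X1] sol_measurable[OF X2] conv_measurable[OF X1] conv_measurable[OF X2]
  noise_measurable[OF X1] noise_measurable[OF X2]

lemma D_measurable [measurable]: "D \<in> borel_measurable (borel \<Otimes>\<^sub>M M)"
  and h_measurable [measurable]: "h \<in> borel_measurable (borel \<Otimes>\<^sub>M M)"
  and g_measurable [measurable]: "g \<in> borel_measurable (borel \<Otimes>\<^sub>M M)"
  and Z_measurable [measurable]: "Z \<in> borel_measurable (borel \<Otimes>\<^sub>M M)"
  unfolding D_def[abs_def] h_def[abs_def] g_def[abs_def] Z_def[abs_def] by measurable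

lemma m_measurable [measurable]: "j \<in> I \<Longrightarrow> m j \<in> borel_measurable (borel \<Otimes>\<^sub>M M)"
  unfolding m_def[abs_def]
  by (intro borel_measurable_diff measurable_compose[OF _ borel_measurable_Mu] sol_measurable[OF X1] sol_measurable[OF X2])

lemma v_measurable [measurable]: "v \<in> borel_measurable borel"
  unfolding v_def[abs_def] by measurable

lemma norm_g: "norm (g p) \<le> k * norm (h p)"
  unfolding g_def h_def by (rule F_lip)

lemma sum_m: "(\<Sum>j. indicator I j * normsq (m j p)) \<le> ennreal (k\<^sup>2 * (norm (D p))\<^sup>2)"
  using hs2_Mu[of "ext X1 p" "ext X2 p"] by (simp add: hs2_def m_def D_def scaleR_diff_right[symmetric])

text \<open>
  The squared Hilbert-Schmidt norm of the integrand of the stochastic convolution at time \<open>t\<close>, observed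
  by \<open>L\<close>.\<close>

definition \<Theta> :: "('h \<Rightarrow>\<^sub>L 'h) \<Rightarrow> real \<Rightarrow> real \<times> 'w \<Rightarrow> ennreal" where "\<Theta> L t p = (\<Sum>j. indicator I j * normsq (blinfun_apply L (S' (t - fst p) (m j p))))"

lemma \<Theta>_measurable [measurable (raw)]:
  assumes [measurable]: "f \<in> borel_measurable N" "p \<in> N \<rightarrow>\<^sub>M borel \<Otimes>\<^sub>M M"
  shows "(\<lambda>x. \<Theta> L (f x) (p x)) \<in> borel_measurable N"
  unfolding \<Theta>_def
proof (rule borel_measurable_suminf_order)
  fix j show "(\<lambda>x. indicator I j * normsq (L (S' (f x - fst (p x)) (m j (p x))))) \<in> borel_measurable N"
  proof (cases "j \<in> I")
    case True
    note [measurable] = measurable_compose[OF assms(2) m_measurable[OF True]]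
    show ?thesis by measurable
  qed simp
qed

lemma Z_bound:
  fixes L :: "'h \<Rightarrow>\<^sub>L 'h"
  assumes t: "t \<in> {0..T}"
  shows "(\<integral>\<^sup>+\<omega>. normsq (blinfun_apply L (Z (t, \<omega>))) \<partial>M)
     \<le> 4 * (\<integral>\<^sup>+\<omega>. \<integral>\<^sup>+s. low t s * \<Theta> L t (s, \<omega>) \<partial>lborel \<partial>M)"
proof -
  obtain Z1 where Z1: "has_stoch_integral M FF I lam e W (\<lambda>s \<omega> v. S (t - s) (Mu (X1 s \<omega>) v)) t Z1"
    and e1: "AE \<omega> in M. noise x1 X1 (t, \<omega>) = Z1 \<omega>" using noise_stoch_integral[OF X1 t] by blast
  obtain Z2 where Z2: "has_stoch_integral M FF I lam e W (\<lambda>s \<omega> v. S (t - s) (Mu (X2 s \<omega>) v)) t Z2"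
    and e2: "AE \<omega> in M. noise x2 X2 (t, \<omega>) = Z2 \<omega>" using noise_stoch_integral[OF X2 t] by blast
  have "AE \<omega> in M. normsq (L (Z (t, \<omega>))) = normsq (L (Z1 \<omega> - Z2 \<omega>))"
    using e1 e2 by eventually_elim (simp add: Z_def)
  then have "(\<integral>\<^sup>+\<omega>. normsq (L (Z (t, \<omega>))) \<partial>M) = (\<integral>\<^sup>+\<omega>. normsq (L (Z1 \<omega> - Z2 \<omega>)) \<partial>M)"
    by (rule nn_integral_cong_AE)
  also have "\<dots> \<le> 4 * (\<integral>\<^sup>+\<omega>. \<integral>\<^sup>+s. indicator {0..t} s * hs2 I lam e (\<lambda>v. L (S (t - s) (Mu (X1 s \<omega>) v) - S (t - s) (Mu (X2 s \<omega>) v))) \<partial>lborel \<partial>M)"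
    using t by (intro stoch_integral_diff_bound Z1 Z2) auto
  also have "(\<integral>\<^sup>+\<omega>. \<integral>\<^sup>+s. indicator {0..t} s * hs2 I lam e (\<lambda>v. L (S (t - s) (Mu (X1 s \<omega>) v) - S (t - s) (Mu (X2 s \<omega>) v))) \<partial>lborel \<partial>M)
     = (\<integral>\<^sup>+\<omega>. \<integral>\<^sup>+s. low t s * \<Theta> L t (s, \<omega>) \<partial>lborel \<partial>M)"
  proof (intro nn_integral_cong)
    fix \<omega> s
    show "indicator {0..t} s * hs2 I lam e (\<lambda>v. L (S (t - s) (Mu (X1 s \<omega>) v) - S (t - s) (Mu (X2 s \<omega>) v))) = low t s * \<Theta> L t (s, \<omega>)"
    proof (cases "s \<in> {0..t}")
      case True
      then have s: "0 \<le> s" "s \<le> t" "s \<le> T" using t by auto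
      have "sqrt (lam j) *\<^sub>R L (S (t - s) (Mu (X1 s \<omega>) (e j)) - S (t - s) (Mu (X2 s \<omega>) (e j))) = L (S' (t - s) (m j (s, \<omega>)))" for j
        using s by (simp add: S'_eq m_def ext_def trunc_def blinfun.diff_right blinfun.scaleR_right scaleR_diff_right)
      then show ?thesis using s by (simp add: low_def hs2_def \<Theta>_def)
    qed (auto simp: low_def)
  qed
  finally show ?thesis .
qed

lemma noise_second_moment:
  assumes r: "r \<in> {0..T}"
  shows "(\<integral>\<^sup>+\<omega>. normsq (Z (r, \<omega>)) \<partial>M) \<le> ennreal (4 * KT\<^sup>2 * k\<^sup>2) * (\<integral>\<^sup>+s. low r s * v s \<partial>lborel)"
proof -
  have "(\<integral>\<^sup>+\<omega>. normsq (Z (r, \<omega>)) \<partial>M) \<le> 4 * (\<integral>\<^sup>+\<omega>. \<integral>\<^sup>+s. low r s * \<Theta> id_blinfun r (s, \<omega>) \<partial>lborel \<partial>M)"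
    using Z_bound[OF r, of id_blinfun] by simp
  also have "\<dots> \<le> 4 * (\<integral>\<^sup>+\<omega>. \<integral>\<^sup>+s. ennreal (KT\<^sup>2 * k\<^sup>2) * (low r s * normsq (D (s, \<omega>))) \<partial>lborel \<partial>M)"
  proof (intro mult_left_mono nn_integral_mono)
    fix \<omega> s
    show "low r s * \<Theta> id_blinfun r (s, \<omega>) \<le> ennreal (KT\<^sup>2 * k\<^sup>2) * (low r s * normsq (D (s, \<omega>)))"
    proof (cases "0 \<le> s \<and> s \<le> r")
      case True
      have "\<Theta> id_blinfun r (s, \<omega>) \<le> (\<Sum>j. ennreal (KT\<^sup>2) * (indicator I j * normsq (m j (s, \<omega>))))"
        unfolding \<Theta>_def
      proof (rule suminf_le)
        fix j
        have "norm (S' (r - s) (m j (s, \<omega>))) \<le> KT * norm (m j (s, \<omega>))" using r True by (intro norm_S'_KT) auto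
        then have "(norm (S' (r - s) (m j (s, \<omega>))))\<^sup>2 \<le> KT\<^sup>2 * (norm (m j (s, \<omega>)))\<^sup>2"
          by (metis norm_ge_zero power_mono power_mult_distrib)
        then have "normsq (S' (r - s) (m j (s, \<omega>))) \<le> ennreal (KT\<^sup>2) * normsq (m j (s, \<omega>))"
          by (simp add: ennreal_mult[symmetric] ennreal_leI)
        then show "indicator I j * normsq (id_blinfun (S' (r - fst (s, \<omega>)) (m j (s, \<omega>)))) \<le> ennreal (KT\<^sup>2) * (indicator I j * normsq (m j (s, \<omega>)))"
          by (simp add: indicator_def)
      qed auto
      also have "\<dots> = ennreal (KT\<^sup>2) * (\<Sum>j. indicator I j * normsq (m j (s, \<omega>)))" by simp
      also have "\<dots> \<le> ennreal (KT\<^sup>2) * ennreal (k\<^sup>2 * (norm (D (s, \<omega>)))\<^sup>2)" by (intro mult_left_mono sum_m) simp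
      also have "\<dots> = ennreal (KT\<^sup>2 * k\<^sup>2) * normsq (D (s, \<omega>))" by (simp add: ennreal_mult mult.assoc)
      finally show ?thesis using True by (simp add: low_def)
    qed (auto simp: low_def)
  qed simp
  also have "(\<integral>\<^sup>+\<omega>. \<integral>\<^sup>+s. ennreal (KT\<^sup>2 * k\<^sup>2) * (low r s * normsq (D (s, \<omega>))) \<partial>lborel \<partial>M)
      = (\<integral>\<^sup>+s. \<integral>\<^sup>+\<omega>. ennreal (KT\<^sup>2 * k\<^sup>2) * (low r s * normsq (D (s, \<omega>))) \<partial>M \<partial>lborel)"
    by (rule time_omega.Fubini') measurable
  also have "\<dots> = ennreal (KT\<^sup>2 * k\<^sup>2) * (\<integral>\<^sup>+s. low r s * v s \<partial>lborel)"
    by (simp add: nn_integral_cmult v_def)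
  finally show ?thesis by (simp add: ennreal_mult mult.assoc)
qed

text \<open>
  By Ito's inequality and Fubini's theorem the integral over \<open>t\<close> can be done first, for a fixed value of
  the diffusion difference at time \<open>s\<close>; there the admissibility estimate for \<open>Y n\<close> applies, with a constant
  that does not depend on \<open>n\<close>.\<close>

lemma noise_observation:
  assumes r: "r \<in> {0..T}"
  shows "(\<integral>\<^sup>+\<omega>. \<integral>\<^sup>+t. low r t * normsq (Y n (Z (t, \<omega>))) \<partial>lborel \<partial>M)
     \<le> ennreal (4 * cT * k\<^sup>2) * (\<integral>\<^sup>+s. low r s * v s \<partial>lborel)"
proof -
  have "(\<integral>\<^sup>+\<omega>. \<integral>\<^sup>+t. low r t * normsq (Y n (Z (t, \<omega>))) \<partial>lborel \<partial>M)
      = (\<integral>\<^sup>+t. \<integral>\<^sup>+\<omega>. low r t * normsq (Y n (Z (t, \<omega>))) \<partial>M \<partial>lborel)"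
    by (rule time_omega.Fubini') measurable
  also have "\<dots> = (\<integral>\<^sup>+t. low r t * (\<integral>\<^sup>+\<omega>. normsq (Y n (Z (t, \<omega>))) \<partial>M) \<partial>lborel)"
    by (simp add: nn_integral_cmult)
  also have "\<dots> \<le> (\<integral>\<^sup>+t. low r t * (4 * (\<integral>\<^sup>+\<omega>. \<integral>\<^sup>+s. low t s * \<Theta> (Y n) t (s, \<omega>) \<partial>lborel \<partial>M)) \<partial>lborel)"
  proof (rule nn_integral_mono)
    fix t
    show "low r t * (\<integral>\<^sup>+\<omega>. normsq (Y n (Z (t, \<omega>))) \<partial>M) \<le> low r t * (4 * (\<integral>\<^sup>+\<omega>. \<integral>\<^sup>+s. low t s * \<Theta> (Y n) t (s, \<omega>) \<partial>lborel \<partial>M))"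
      using Z_bound[of t "Y n"] r by (auto simp: low_def)
  qed
  also have "\<dots> = (\<integral>\<^sup>+t. \<integral>\<^sup>+\<omega>. 4 * (\<integral>\<^sup>+s. low r t * low t s * \<Theta> (Y n) t (s, \<omega>) \<partial>lborel) \<partial>M \<partial>lborel)"
  proof (rule nn_integral_cong)
    fix t
    have "(\<integral>\<^sup>+\<omega>. 4 * (\<integral>\<^sup>+s. low r t * low t s * \<Theta> (Y n) t (s, \<omega>) \<partial>lborel) \<partial>M)
      = (\<integral>\<^sup>+\<omega>. (4 * low r t) * (\<integral>\<^sup>+s. low t s * \<Theta> (Y n) t (s, \<omega>) \<partial>lborel) \<partial>M)"
    proof (rule nn_integral_cong)
      fix \<omega> assume [measurable]: "\<omega> \<in> space M"
      have "(\<integral>\<^sup>+s. low r t * (low t s * \<Theta> (Y n) t (s, \<omega>)) \<partial>lborel) = low r t * (\<integral>\<^sup>+s. low t s * \<Theta> (Y n) t (s, \<omega>) \<partial>lborel)"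
        by (rule nn_integral_cmult) measurable
      then show "4 * (\<integral>\<^sup>+s. low r t * low t s * \<Theta> (Y n) t (s, \<omega>) \<partial>lborel) = (4 * low r t) * (\<integral>\<^sup>+s. low t s * \<Theta> (Y n) t (s, \<omega>) \<partial>lborel)"
        by (simp add: mult.assoc)
    qed
    also have "\<dots> = (4 * low r t) * (\<integral>\<^sup>+\<omega>. \<integral>\<^sup>+s. low t s * \<Theta> (Y n) t (s, \<omega>) \<partial>lborel \<partial>M)"
      by (rule nn_integral_cmult) measurable
    finally show "low r t * (4 * (\<integral>\<^sup>+\<omega>. \<integral>\<^sup>+s. low t s * \<Theta> (Y n) t (s, \<omega>) \<partial>lborel \<partial>M))
      = (\<integral>\<^sup>+\<omega>. 4 * (\<integral>\<^sup>+s. low r t * low t s * \<Theta> (Y n) t (s, \<omega>) \<partial>lborel) \<partial>M)"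
      by (simp add: mult_ac)
  qed
  also have "\<dots> = (\<integral>\<^sup>+\<omega>. \<integral>\<^sup>+t. 4 * (\<integral>\<^sup>+s. low r t * low t s * \<Theta> (Y n) t (s, \<omega>) \<partial>lborel) \<partial>lborel \<partial>M)"
    by (rule time_omega.Fubini'[symmetric]) measurable
  also have "\<dots> \<le> (\<integral>\<^sup>+\<omega>. \<integral>\<^sup>+s. ennreal (4 * cT * k\<^sup>2) * (low r s * normsq (D (s, \<omega>))) \<partial>lborel \<partial>M)"
  proof (rule nn_integral_mono)
    fix \<omega> assume [measurable]: "\<omega> \<in> space M"
    have "(\<integral>\<^sup>+t. (\<integral>\<^sup>+s. low r t * low t s * \<Theta> (Y n) t (s, \<omega>) \<partial>lborel) \<partial>lborel)
      = (\<integral>\<^sup>+s. (\<integral>\<^sup>+t. low r t * low t s * \<Theta> (Y n) t (s, \<omega>) \<partial>lborel) \<partial>lborel)"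
      by (rule lborel_pair.Fubini') measurable
    also have "\<dots> \<le> (\<integral>\<^sup>+s. ennreal (cT * k\<^sup>2) * (low r s * normsq (D (s, \<omega>))) \<partial>lborel)"
    proof (rule nn_integral_mono)
      fix s
      let ?f = "\<lambda>j t. low r t * low t s * normsq (Y n (S' (t - s) (m j (s, \<omega>))))"
      have "(\<integral>\<^sup>+t. low r t * low t s * \<Theta> (Y n) t (s, \<omega>) \<partial>lborel) = (\<integral>\<^sup>+t. (\<Sum>j. indicator I j * ?f j t) \<partial>lborel)"
        by (simp add: \<Theta>_def ennreal_suminf_cmult[symmetric] mult.left_commute del: ennreal_suminf_cmult)
      also have "\<dots> = (\<Sum>j. \<integral>\<^sup>+t. indicator I j * ?f j t \<partial>lborel)" by (rule nn_integral_suminf) measurable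
      also have "\<dots> \<le> (\<Sum>j. (low r s * ennreal cT) * (indicator I j * normsq (m j (s, \<omega>))))"
      proof (rule suminf_le)
        fix j
        have "(\<integral>\<^sup>+t. indicator I j * ?f j t \<partial>lborel) = indicator I j * (\<integral>\<^sup>+t. ?f j t \<partial>lborel)"
          by (rule nn_integral_cmult) measurable
        also have "\<dots> \<le> indicator I j * (low r s * ennreal (cT * (norm (m j (s, \<omega>)))\<^sup>2))"
          using r by (intro mult_left_mono shifted_admissibility) auto
        finally show "(\<integral>\<^sup>+t. indicator I j * ?f j t \<partial>lborel) \<le> (low r s * ennreal cT) * (indicator I j * normsq (m j (s, \<omega>)))"
          using cT_nonneg by (simp add: ennreal_mult mult_ac)
      qed auto
      also have "\<dots> = (low r s * ennreal cT) * (\<Sum>j. indicator I j * normsq (m j (s, \<omega>)))" by simp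
      also have "\<dots> \<le> (low r s * ennreal cT) * ennreal (k\<^sup>2 * (norm (D (s, \<omega>)))\<^sup>2)" by (intro mult_left_mono sum_m) simp
      also have "\<dots> = ennreal (cT * k\<^sup>2) * (low r s * normsq (D (s, \<omega>)))"
        using cT_nonneg by (simp add: ennreal_mult mult_ac)
      finally show "(\<integral>\<^sup>+t. low r t * low t s * \<Theta> (Y n) t (s, \<omega>) \<partial>lborel) \<le> ennreal (cT * k\<^sup>2) * (low r s * normsq (D (s, \<omega>)))" .
    qed
    finally have swap: "(\<integral>\<^sup>+t. (\<integral>\<^sup>+s. low r t * low t s * \<Theta> (Y n) t (s, \<omega>) \<partial>lborel) \<partial>lborel)
      \<le> (\<integral>\<^sup>+s. ennreal (cT * k\<^sup>2) * (low r s * normsq (D (s, \<omega>))) \<partial>lborel)" .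
    have c: "4 * ennreal (cT * k\<^sup>2) = ennreal (4 * cT * k\<^sup>2)"
      using cT_nonneg by (simp add: mult.assoc ennreal_mult')
    have "(\<integral>\<^sup>+t. 4 * (\<integral>\<^sup>+s. low r t * low t s * \<Theta> (Y n) t (s, \<omega>) \<partial>lborel) \<partial>lborel)
       = 4 * (\<integral>\<^sup>+t. (\<integral>\<^sup>+s. low r t * low t s * \<Theta> (Y n) t (s, \<omega>) \<partial>lborel) \<partial>lborel)"
      by (rule nn_integral_cmult) measurable
    also have "\<dots> \<le> 4 * (\<integral>\<^sup>+s. ennreal (cT * k\<^sup>2) * (low r s * normsq (D (s, \<omega>))) \<partial>lborel)"
      by (rule mult_left_mono[OF swap]) simp
    also have "\<dots> = (\<integral>\<^sup>+s. 4 * (ennreal (cT * k\<^sup>2) * (low r s * normsq (D (s, \<omega>)))) \<partial>lborel)"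
      by (rule nn_integral_cmult[symmetric]) measurable
    also have "\<dots> = (\<integral>\<^sup>+s. ennreal (4 * cT * k\<^sup>2) * (low r s * normsq (D (s, \<omega>))) \<partial>lborel)"
      by (simp only: mult.assoc[symmetric] c)
    finally show "(\<integral>\<^sup>+t. 4 * (\<integral>\<^sup>+s. low r t * low t s * \<Theta> (Y n) t (s, \<omega>) \<partial>lborel) \<partial>lborel)
      \<le> (\<integral>\<^sup>+s. ennreal (4 * cT * k\<^sup>2) * (low r s * normsq (D (s, \<omega>))) \<partial>lborel)" .
  qed
  also have "\<dots> = (\<integral>\<^sup>+s. \<integral>\<^sup>+\<omega>. ennreal (4 * cT * k\<^sup>2) * (low r s * normsq (D (s, \<omega>))) \<partial>M \<partial>lborel)"
    by (rule time_omega.Fubini') measurable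
  also have "\<dots> = ennreal (4 * cT * k\<^sup>2) * (\<integral>\<^sup>+s. low r s * v s \<partial>lborel)"
    by (simp add: nn_integral_cmult v_def)
  finally show ?thesis .
qed

text \<open>
  The paths on which the pointwise argument below runs.\<close>

definition good :: "'w \<Rightarrow> bool" where
  "good \<omega> \<longleftrightarrow> \<omega> \<in> space M \<and> (AE s in lborel. s \<in> {0..T} \<longrightarrow> X1 s \<omega> \<in> yosida_dom DA A C \<and> X2 s \<omega> \<in> yosida_dom DA A C)
     \<and> (\<integral>\<^sup>+s. normsq (obs X1 (s, \<omega>)) \<partial>lborel) < \<infinity> \<and> (\<integral>\<^sup>+s. normsq (obs X2 (s, \<omega>)) \<partial>lborel) < \<infinity>"

lemma AE_good: "AE \<omega> in M. good \<omega>"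
proof -
  have dom: "AE \<omega> in M. AE t\<in>{0..T} in lborel. X t \<omega> \<in> yosida_dom DA A C" if "sol x X" for x X
    using that by (simp add: mild_solution_def)
  have fin: "AE \<omega> in M. (\<integral>\<^sup>+s. normsq (obs X (s, \<omega>)) \<partial>lborel) < \<infinity>" if "sol x X" for x X
  proof -
    have "(\<integral>\<^sup>+s. normsq (obs X (s, \<omega>)) \<partial>lborel) = (\<integral>\<^sup>+t\<in>{0..T}. normsq (yosida_ext DA A C (X t \<omega>)) \<partial>lborel)" for \<omega>
      by (rule nn_integral_cong) (auto simp: obs_def ext_def trunc_def indicator_def)
    then show ?thesis using that by (simp add: mild_solution_def)
  qed
  show ?thesis
    using dom[OF X1] dom[OF X2] fin[OF X1] fin[OF X2] AE_space
  proof eventually_elim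
    case (elim \<omega>)
    from elim(1,2) have "AE s in lborel. s \<in> {0..T} \<longrightarrow> X1 s \<omega> \<in> yosida_dom DA A C \<and> X2 s \<omega> \<in> yosida_dom DA A C"
      by eventually_elim auto
    then show ?case using elim by (simp add: good_def)
  qed
qed

text \<open>
  On a bounded interval square integrability of the observation implies integrability, and \<open>F\<close> grows at
  most linearly.\<close>

lemma integrable_convolution:
  assumes X: "sol x X" and [measurable]: "\<omega> \<in> space M"
    and fin: "(\<integral>\<^sup>+s. normsq (obs X (s, \<omega>)) \<partial>lborel) < \<infinity>" and t: "t \<in> {0..T}"
  shows "integrable lborel (\<lambda>s. trunc t s (S' (t - s) (F (obs X (s, \<omega>)))))"
proof -
  note [measurable] = sol_measurable[OF X]
  let ?b = "\<lambda>s. KT * ((norm (F 0) + k) * indicator {0..T} s + k * (norm (obs X (s, \<omega>)))\<^sup>2)"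
  show ?thesis
  proof (rule Bochner_Integration.integrable_bound)
    have "integrable lborel (\<lambda>s. (norm (obs X (s, \<omega>)))\<^sup>2)"
      using fin by (intro integrableI_nonneg) auto
    then show "integrable lborel ?b"
      by (intro integrable_mult_right Bochner_Integration.integrable_add integrable_real_indicator) (auto simp: emeasure_lborel_Icc_eq)
    show "AE s in lborel. norm (trunc t s (S' (t - s) (F (obs X (s, \<omega>))))) \<le> norm (?b s)"
    proof (rule AE_I2)
      fix s
      let ?y = "obs X (s, \<omega>)"
      show "norm (trunc t s (S' (t - s) (F ?y))) \<le> norm (?b s)"
      proof (cases "0 \<le> s \<and> s \<le> t")
        case True
        have "norm (F ?y) \<le> norm (F 0) + k * norm ?y"
          using norm_triangle_ineq[of "F 0" "F ?y - F 0"] F_lip[of ?y 0] by simp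
        also have "norm ?y \<le> 1 + (norm ?y)\<^sup>2"
          using zero_le_power2[of "norm ?y - 1"] by (simp add: power2_diff) (smt (verit) zero_le_power2)
        finally have "norm (F ?y) \<le> norm (F 0) + k * (1 + (norm ?y)\<^sup>2)"
          using k_pos by (simp add: mult_left_mono)
        then have "KT * norm (F ?y) \<le> ?b s"
          using True t KT_pos by (intro mult_left_mono) (auto simp: algebra_simps)
        moreover have "norm (S' (t - s) (F ?y)) \<le> KT * norm (F ?y)" using True t by (intro norm_S'_KT) auto
        ultimately show ?thesis using True by (simp add: trunc_def)
      qed (auto simp: trunc_def)
    qed
  qed measurable
qed

lemma decomposition:
  assumes \<omega>: "good \<omega>" and t: "t \<in> {0..T}"
  shows "integrable lborel (\<lambda>s. trunc t s (S' (t - s) (g (s, \<omega>))))"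
    and "D (t, \<omega>) = S' t (x1 - x2) + cv (t, \<omega>) + Z (t, \<omega>)"
proof -
  have i1: "integrable lborel (\<lambda>s. trunc t s (S' (t - s) (F (obs X1 (s, \<omega>)))))"
    and i2: "integrable lborel (\<lambda>s. trunc t s (S' (t - s) (F (obs X2 (s, \<omega>)))))"
    using \<omega> by (auto intro!: integrable_convolution[OF X1 _ _ t] integrable_convolution[OF X2 _ _ t] simp: good_def)
  have eq: "trunc t s (S' (t - s) (F (obs X1 (s, \<omega>)))) - trunc t s (S' (t - s) (F (obs X2 (s, \<omega>)))) = trunc t s (S' (t - s) (g (s, \<omega>)))" for s
    by (simp add: trunc_def g_def blinfun.diff_right)
  show "integrable lborel (\<lambda>s. trunc t s (S' (t - s) (g (s, \<omega>))))"
    using Bochner_Integration.integrable_diff[OF i1 i2] unfolding eq .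
  have "cv (t, \<omega>) = conv X1 (t, \<omega>) - conv X2 (t, \<omega>)"
    using Bochner_Integration.integral_diff[OF i1 i2] unfolding eq by (simp add: cv_def conv_def)
  then show "D (t, \<omega>) = S' t (x1 - x2) + cv (t, \<omega>) + Z (t, \<omega>)"
    by (simp add: D_def Z_def noise_def blinfun.diff_right)
qed

end

section \<open>Mean square dependence on the initial value\<close>

context stochastic_equation begin

text \<open>
  The weight exponent is chosen such that \<open>3 / (2 * \<mu>) * cT * k\<^sup>2 \<le> 1 / 2\<close>.\<close>

definition \<mu> where "\<mu> = 3 * cT * k\<^sup>2 + 1"

lemma \<mu>_pos: "\<mu> > 0"
  using cT_nonneg by (simp add: \<mu>_def add_nonneg_pos)

text \<open>
  The factor by which three times the squared drift convolution is bounded in terms of the weighted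
  energy of the observation.\<close>

definition b0 where "b0 = 3 * (exp (2 * \<mu> * T) * (KT\<^sup>2 * k\<^sup>2 / (2 * \<mu>)))"

lemma b0_nonneg: "b0 \<ge> 0" using \<mu>_pos by (simp add: b0_def)

text \<open>
  The constant that Gronwall's inequality produces from \<open>second_moment_inequality\<close> below.\<close>

definition growth where "growth = 2 * (3 * KT\<^sup>2 + b0 * (6 * cT)) * exp (2 * (b0 * (24 * cT * k\<^sup>2) + 12 * KT\<^sup>2 * k\<^sup>2 + 1) * T)"

lemma second_moment_bounded:
  assumes "sol x X"
  shows "\<exists>B\<ge>0. \<forall>t\<in>{0..T}. (\<integral>\<^sup>+\<omega>. normsq (X t \<omega>) \<partial>M) \<le> ennreal B"
proof -
  have i: "\<And>t. t \<in> {0..T} \<Longrightarrow> integrable M (\<lambda>\<omega>. (norm (X t \<omega>))\<^sup>2)"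
    and c: "continuous_on {0..T} (\<lambda>t. sqrt (\<integral>\<omega>. (norm (X t \<omega>))\<^sup>2 \<partial>M))"
    using assms by (auto simp: mild_solution_def C_adapted_def)
  have "bounded ((\<lambda>t. sqrt (\<integral>\<omega>. (norm (X t \<omega>))\<^sup>2 \<partial>M)) ` {0..T})"
    by (intro compact_imp_bounded compact_continuous_image c compact_Icc)
  then obtain b where "\<forall>y\<in>(\<lambda>t. sqrt (\<integral>\<omega>. (norm (X t \<omega>))\<^sup>2 \<partial>M)) ` {0..T}. norm y \<le> b"
    unfolding bounded_iff by blast
  then have b: "\<bar>sqrt (\<integral>\<omega>. (norm (X t \<omega>))\<^sup>2 \<partial>M)\<bar> \<le> b" if "t \<in> {0..T}" for t
    using that by simp
  show ?thesis
  proof (intro exI[of _ "b\<^sup>2"] conjI ballI)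
    fix t assume t: "t \<in> {0..T}"
    have "(\<integral>\<omega>. (norm (X t \<omega>))\<^sup>2 \<partial>M) \<ge> 0" by (rule Bochner_Integration.integral_nonneg) simp
    then have "(\<integral>\<omega>. (norm (X t \<omega>))\<^sup>2 \<partial>M) \<le> b\<^sup>2"
      using b[OF t] by (metis abs_ge_zero power2_abs power_mono real_sqrt_pow2)
    then show "(\<integral>\<^sup>+\<omega>. normsq (X t \<omega>) \<partial>M) \<le> ennreal (b\<^sup>2)"
      using i[OF t] by (subst nn_integral_eq_integral) (auto intro: ennreal_leI)
  qed simp
qed

end

context solution_pair begin

text \<open>
  The weighted energy of the observation difference up to time \<open>r\<close>.\<close>

definition U where "U r \<omega> = (\<integral>\<^sup>+t. low r t * ennreal (exp (- 2 * \<mu> * t) * (norm (h (t, \<omega>)))\<^sup>2) \<partial>lborel)"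

lemma U_measurable [measurable]: "U r \<in> borel_measurable M"
  unfolding U_def[abs_def] by measurable

lemma convolution_bound:
  fixes L :: "'h \<Rightarrow>\<^sub>L 'h"
  assumes \<omega>: "good \<omega>" and t: "t \<in> {0..T}"
  shows "ennreal (exp (- 2 * \<mu> * t) * (norm (L (cv (t, \<omega>))))\<^sup>2)
    \<le> ennreal (1 / (2 * \<mu>)) * (\<integral>\<^sup>+s. low t s * ennreal (exp (- 2 * \<mu> * s) * (norm (L (S' (t - s) (g (s, \<omega>)))))\<^sup>2) \<partial>lborel)"
proof -
  have [measurable]: "\<omega> \<in> space M" using \<omega> by (simp add: good_def)
  show ?thesis
    unfolding cv_def fst_conv snd_conv
    by (rule convolution_Cauchy_Schwarz[OF \<mu>_pos _ decomposition(1)[OF \<omega> t]]) measurable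
qed

lemma convolution_observation:
  assumes \<omega>: "good \<omega>" and r: "r \<in> {0..T}"
  shows "(\<integral>\<^sup>+t. low r t * (\<integral>\<^sup>+s. low t s * ennreal (exp (- 2 * \<mu> * s) * (norm (Y n (S' (t - s) (g (s, \<omega>)))))\<^sup>2) \<partial>lborel) \<partial>lborel)
    \<le> ennreal (cT * k\<^sup>2) * U r \<omega>"
proof -
  have [measurable]: "\<omega> \<in> space M" using \<omega> by (simp add: good_def)
  let ?e = "\<lambda>s. exp (- 2 * \<mu> * s)"
  let ?f = "\<lambda>t s. (norm (Y n (S' (t - s) (g (s, \<omega>)))))\<^sup>2"
  have "(\<integral>\<^sup>+t. low r t * (\<integral>\<^sup>+s. low t s * ennreal (?e s * ?f t s) \<partial>lborel) \<partial>lborel)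
      = (\<integral>\<^sup>+t. (\<integral>\<^sup>+s. ennreal (?e s) * (low r t * low t s * ennreal (?f t s)) \<partial>lborel) \<partial>lborel)"
  proof (rule nn_integral_cong)
    fix t
    have "low r t * (\<integral>\<^sup>+s. low t s * ennreal (?e s * ?f t s) \<partial>lborel) = (\<integral>\<^sup>+s. low r t * (low t s * ennreal (?e s * ?f t s)) \<partial>lborel)"
      by (rule nn_integral_cmult[symmetric]) measurable
    also have "\<dots> = (\<integral>\<^sup>+s. ennreal (?e s) * (low r t * low t s * ennreal (?f t s)) \<partial>lborel)"
      by (rule nn_integral_cong) (simp add: ennreal_mult mult_ac)
    finally show "low r t * (\<integral>\<^sup>+s. low t s * ennreal (?e s * ?f t s) \<partial>lborel) = (\<integral>\<^sup>+s. ennreal (?e s) * (low r t * low t s * ennreal (?f t s)) \<partial>lborel)" .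
  qed
  also have "\<dots> = (\<integral>\<^sup>+s. (\<integral>\<^sup>+t. ennreal (?e s) * (low r t * low t s * ennreal (?f t s)) \<partial>lborel) \<partial>lborel)"
    by (rule lborel_pair.Fubini') measurable
  also have "\<dots> \<le> (\<integral>\<^sup>+s. ennreal (cT * k\<^sup>2) * (low r s * ennreal (?e s * (norm (h (s, \<omega>)))\<^sup>2)) \<partial>lborel)"
  proof (rule nn_integral_mono)
    fix s
    have "(\<integral>\<^sup>+t. ennreal (?e s) * (low r t * low t s * ennreal (?f t s)) \<partial>lborel) = ennreal (?e s) * (\<integral>\<^sup>+t. low r t * low t s * ennreal (?f t s) \<partial>lborel)"
      by (rule nn_integral_cmult) measurable
    also have "\<dots> \<le> ennreal (?e s) * (low r s * ennreal (cT * (norm (g (s, \<omega>)))\<^sup>2))"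
      using r by (intro mult_left_mono shifted_admissibility) auto
    also have "\<dots> \<le> ennreal (?e s) * (low r s * ennreal (cT * (k * norm (h (s, \<omega>)))\<^sup>2))"
      using cT_nonneg norm_g[of "(s, \<omega>)"] by (intro mult_left_mono ennreal_leI power_mono) auto
    also have "\<dots> = ennreal (cT * k\<^sup>2) * (low r s * ennreal (?e s * (norm (h (s, \<omega>)))\<^sup>2))"
      using cT_nonneg by (simp add: ennreal_mult power_mult_distrib mult_ac)
    finally show "(\<integral>\<^sup>+t. ennreal (?e s) * (low r t * low t s * ennreal (?f t s)) \<partial>lborel)
      \<le> ennreal (cT * k\<^sup>2) * (low r s * ennreal (?e s * (norm (h (s, \<omega>)))\<^sup>2))" .
  qed
  also have "\<dots> = ennreal (cT * k\<^sup>2) * U r \<omega>"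
    unfolding U_def by (rule nn_integral_cmult) measurable
  finally show ?thesis .
qed

text \<open>
  The three terms of the decomposition of \<open>D\<close> are the orbit of the initial difference, bounded by
  admissibility, the drift convolution, bounded by the weighted convolution estimate, and the noise, which
  is kept.  By the choice of \<open>\<mu>\<close> the convolution contributes at most half of the energy \<open>U\<close>.\<close>

lemma pathwise_bound:
  assumes \<omega>: "good \<omega>" and r: "r \<in> {0..T}"
  shows "(\<integral>\<^sup>+t. low r t * ennreal (exp (- 2 * \<mu> * t) * (norm (Y n (D (t, \<omega>))))\<^sup>2) \<partial>lborel)
    \<le> ennreal (3 * cT * (norm (x1 - x2))\<^sup>2) + ennreal (1/2) * U r \<omega>
      + 3 * (\<integral>\<^sup>+t. low r t * normsq (Y n (Z (t, \<omega>))) \<partial>lborel)"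
proof -
  have [measurable]: "\<omega> \<in> space M" using \<omega> by (simp add: good_def)
  let ?e = "\<lambda>s. exp (- 2 * \<mu> * s)"
  let ?a = "\<lambda>t. low r t * normsq (Y n (S' t (x1 - x2)))"
  let ?b = "\<lambda>t. low r t * (\<integral>\<^sup>+s. low t s * ennreal (?e s * (norm (Y n (S' (t - s) (g (s, \<omega>)))))\<^sup>2) \<partial>lborel)"
  let ?c = "\<lambda>t. low r t * normsq (Y n (Z (t, \<omega>)))"
  have "(\<integral>\<^sup>+t. low r t * ennreal (?e t * (norm (Y n (D (t, \<omega>))))\<^sup>2) \<partial>lborel)
    \<le> (\<integral>\<^sup>+t. 3 * ?a t + ennreal (3 / (2 * \<mu>)) * ?b t + 3 * ?c t \<partial>lborel)"
  proof (rule nn_integral_mono)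
    fix t
    show "low r t * ennreal (?e t * (norm (Y n (D (t, \<omega>))))\<^sup>2) \<le> 3 * ?a t + ennreal (3 / (2 * \<mu>)) * ?b t + 3 * ?c t"
    proof (cases "0 \<le> t \<and> t \<le> r")
      case True
      then have t: "t \<in> {0..T}" using r by auto
      let ?A = "(norm (Y n (S' t (x1 - x2))))\<^sup>2" and ?B = "(norm (Y n (cv (t, \<omega>))))\<^sup>2" and ?C = "(norm (Y n (Z (t, \<omega>))))\<^sup>2"
      have e: "0 \<le> ?e t" "?e t \<le> 1" using True \<mu>_pos by auto
      have "(norm (Y n (D (t, \<omega>))))\<^sup>2 \<le> 3 * ?A + 3 * ?B + 3 * ?C"
        unfolding decomposition(2)[OF \<omega> t] blinfun.add_right by (rule norm_add3_sq_le)
      then have "?e t * (norm (Y n (D (t, \<omega>))))\<^sup>2 \<le> ?e t * (3 * ?A + 3 * ?B + 3 * ?C)"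
        by (rule mult_left_mono) (rule e)
      also have "\<dots> = 3 * (?e t * ?A) + 3 * (?e t * ?B) + 3 * (?e t * ?C)" by (simp add: algebra_simps)
      also have "\<dots> \<le> 3 * (1 * ?A) + 3 * (?e t * ?B) + 3 * (1 * ?C)"
        using e by (intro add_mono mult_left_mono mult_right_mono) auto
      finally have "ennreal (?e t * (norm (Y n (D (t, \<omega>))))\<^sup>2) \<le> ennreal (3 * ?A + 3 * (?e t * ?B) + 3 * ?C)"
        by (intro ennreal_leI) simp
      also have "\<dots> = 3 * ennreal ?A + 3 * ennreal (?e t * ?B) + 3 * ennreal ?C"
        by (simp add: ennreal_plus ennreal_mult'')
      also have "3 * ennreal (?e t * ?B) \<le> 3 * (ennreal (1 / (2 * \<mu>)) * (\<integral>\<^sup>+s. low t s * ennreal (?e s * (norm (Y n (S' (t - s) (g (s, \<omega>)))))\<^sup>2) \<partial>lborel))"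
        by (intro mult_left_mono convolution_bound \<omega> t) simp
      also have "\<dots> = ennreal (3 / (2 * \<mu>)) * (\<integral>\<^sup>+s. low t s * ennreal (?e s * (norm (Y n (S' (t - s) (g (s, \<omega>)))))\<^sup>2) \<partial>lborel)"
      proof -
        have "3 * ennreal (1 / (2 * \<mu>)) = ennreal (3 / (2 * \<mu>))" using \<mu>_pos ennreal_mult'[of 3 "1 / (2 * \<mu>)"] by simp
        then show ?thesis by (simp only: mult.assoc[symmetric])
      qed
      finally show ?thesis using True by (simp add: low_def)
    qed (auto simp: low_def)
  qed
  also have "\<dots> = 3 * (\<integral>\<^sup>+t. ?a t \<partial>lborel) + ennreal (3 / (2 * \<mu>)) * (\<integral>\<^sup>+t. ?b t \<partial>lborel) + 3 * (\<integral>\<^sup>+t. ?c t \<partial>lborel)"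
  proof -
    have [measurable]: "?a \<in> borel_measurable lborel" "?b \<in> borel_measurable lborel" "?c \<in> borel_measurable lborel" by measurable
    show ?thesis by (simp add: nn_integral_add nn_integral_cmult)
  qed
  also have "\<dots> \<le> ennreal (3 * cT * (norm (x1 - x2))\<^sup>2) + ennreal (1/2) * U r \<omega> + 3 * (\<integral>\<^sup>+t. ?c t \<partial>lborel)"
  proof (intro add_right_mono add_mono)
    have "(\<integral>\<^sup>+t. ?a t \<partial>lborel) \<le> (\<integral>\<^sup>+t. low T t * normsq (Y n (S' t (x1 - x2))) \<partial>lborel)"
      using r by (intro nn_integral_mono) (auto simp: low_def)
    also have "\<dots> \<le> ennreal (cT * (norm (x1 - x2))\<^sup>2)" by (rule cT)
    finally have "3 * (\<integral>\<^sup>+t. ?a t \<partial>lborel) \<le> 3 * ennreal (cT * (norm (x1 - x2))\<^sup>2)" by (rule mult_left_mono) simp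
    also have "\<dots> = ennreal (3 * cT * (norm (x1 - x2))\<^sup>2)" by (simp add: ennreal_mult' mult.assoc)
    finally show "3 * (\<integral>\<^sup>+t. ?a t \<partial>lborel) \<le> ennreal (3 * cT * (norm (x1 - x2))\<^sup>2)" .
    have "ennreal (3 / (2 * \<mu>)) * (\<integral>\<^sup>+t. ?b t \<partial>lborel) \<le> ennreal (3 / (2 * \<mu>)) * (ennreal (cT * k\<^sup>2) * U r \<omega>)"
      by (intro mult_left_mono convolution_observation \<omega> r) simp
    also have "\<dots> = ennreal (3 / (2 * \<mu>) * (cT * k\<^sup>2)) * U r \<omega>"
      using \<mu>_pos cT_nonneg by (subst ennreal_mult) (auto simp: mult.assoc)
    also have "\<dots> \<le> ennreal (1 / 2) * U r \<omega>"
      using \<mu>_pos cT_nonneg by (intro mult_right_mono ennreal_leI) (auto simp: \<mu>_def field_simps)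
    finally show "ennreal (3 / (2 * \<mu>)) * (\<integral>\<^sup>+t. ?b t \<partial>lborel) \<le> ennreal (1/2) * U r \<omega>" .
  qed
  finally show ?thesis .
qed

lemma U_finite:
  assumes \<omega>: "good \<omega>" and r: "r \<in> {0..T}" shows "U r \<omega> < \<infinity>"
proof -
  have [measurable]: "\<omega> \<in> space M" using \<omega> by (simp add: good_def)
  have "U r \<omega> \<le> (\<integral>\<^sup>+t. 2 * normsq (obs X1 (t, \<omega>)) + 2 * normsq (obs X2 (t, \<omega>)) \<partial>lborel)"
    unfolding U_def
  proof (rule nn_integral_mono)
    fix t
    let ?a = "(norm (obs X1 (t, \<omega>)))\<^sup>2" and ?b = "(norm (obs X2 (t, \<omega>)))\<^sup>2"
    show "low r t * ennreal (exp (- 2 * \<mu> * t) * (norm (h (t, \<omega>)))\<^sup>2) \<le> 2 * ennreal ?a + 2 * ennreal ?b"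
    proof (cases "0 \<le> t \<and> t \<le> r")
      case True
      then have "exp (- 2 * \<mu> * t) * (norm (h (t, \<omega>)))\<^sup>2 \<le> 1 * (norm (h (t, \<omega>)))\<^sup>2"
        using \<mu>_pos by (intro mult_right_mono) auto
      also have "\<dots> \<le> 2 * ?a + 2 * ?b" using norm_add_sq_le[of "obs X1 (t, \<omega>)" "- obs X2 (t, \<omega>)"] by (simp add: h_def)
      finally have "ennreal (exp (- 2 * \<mu> * t) * (norm (h (t, \<omega>)))\<^sup>2) \<le> ennreal (2 * ?a + 2 * ?b)" by (rule ennreal_leI)
      then show ?thesis using True by (simp add: low_def ennreal_mult')
    qed (auto simp: low_def)
  qed
  also have "\<dots> = 2 * (\<integral>\<^sup>+t. normsq (obs X1 (t, \<omega>)) \<partial>lborel) + 2 * (\<integral>\<^sup>+t. normsq (obs X2 (t, \<omega>)) \<partial>lborel)"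
    by (simp add: nn_integral_add nn_integral_cmult)
  also have "\<dots> < \<infinity>" using \<omega> by (simp add: good_def ennreal_mult_less_top)
  finally show ?thesis .
qed

text \<open>
  On almost every path both solutions lie in the domain of the Yosida extension at almost all times, so
  \<open>Y n\<close> applied to \<open>D\<close> converges to \<open>h\<close> and Fatou's lemma bounds \<open>U\<close> by the preceding estimates.  The half
  of \<open>U\<close> on the right is absorbed on each path separately, where \<open>U\<close> is known to be finite; nothing is
  known yet about its expectation.\<close>

lemma observation_pathwise:
  assumes \<omega>: "good \<omega>" and r: "r \<in> {0..T}"
  shows "U r \<omega> \<le> ennreal (6 * cT * (norm (x1 - x2))\<^sup>2)
    + 6 * liminf (\<lambda>n. \<integral>\<^sup>+t. low r t * normsq (Y n (Z (t, \<omega>))) \<partial>lborel)"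
proof -
  have [measurable]: "\<omega> \<in> space M" using \<omega> by (simp add: good_def)
  let ?e = "\<lambda>s. exp (- 2 * \<mu> * s)"
  let ?A = "\<lambda>n. \<integral>\<^sup>+t. low r t * normsq (Y n (Z (t, \<omega>))) \<partial>lborel"
  let ?c = "3 * cT * (norm (x1 - x2))\<^sup>2"
  have dom: "AE t in lborel. t \<in> {0..T} \<longrightarrow> X1 t \<omega> \<in> yosida_dom DA A C \<and> X2 t \<omega> \<in> yosida_dom DA A C"
    using \<omega> by (simp add: good_def)
  have "U r \<omega> = (\<integral>\<^sup>+t. liminf (\<lambda>n. low r t * ennreal (?e t * (norm (Y n (D (t, \<omega>))))\<^sup>2)) \<partial>lborel)"
    unfolding U_def
  proof (rule nn_integral_cong_AE, use dom in eventually_elim)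
    fix t assume t: "t \<in> {0..T} \<longrightarrow> X1 t \<omega> \<in> yosida_dom DA A C \<and> X2 t \<omega> \<in> yosida_dom DA A C"
    have "(\<lambda>n. low r t * ennreal (?e t * (norm (Y n (D (t, \<omega>))))\<^sup>2)) \<longlonglongrightarrow> low r t * ennreal (?e t * (norm (h (t, \<omega>)))\<^sup>2)"
    proof (cases "0 \<le> t \<and> t \<le> r")
      case True
      then have tT: "0 \<le> t" "t \<le> T" using r by auto
      have "(\<lambda>n. Y n (X1 t \<omega>) - Y n (X2 t \<omega>)) \<longlonglongrightarrow> yosida_ext DA A C (X1 t \<omega>) - yosida_ext DA A C (X2 t \<omega>)"
        using t tT by (intro tendsto_diff Y_tendsto) auto
      then have "(\<lambda>n. Y n (D (t, \<omega>))) \<longlonglongrightarrow> h (t, \<omega>)"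
        using tT by (simp add: D_def h_def obs_def ext_def trunc_def blinfun.diff_right)
      then have "(\<lambda>n. ennreal (?e t * (norm (Y n (D (t, \<omega>))))\<^sup>2)) \<longlonglongrightarrow> ennreal (?e t * (norm (h (t, \<omega>)))\<^sup>2)"
        by (intro tendsto_ennrealI tendsto_mult tendsto_const tendsto_power tendsto_norm)
      then show ?thesis using True by (simp add: low_def)
    qed (auto simp: low_def)
    then show "low r t * ennreal (?e t * (norm (h (t, \<omega>)))\<^sup>2) = liminf (\<lambda>n. low r t * ennreal (?e t * (norm (Y n (D (t, \<omega>))))\<^sup>2))"
      by (rule lim_imp_Liminf[OF trivial_limit_sequentially, symmetric])
  qed
  also have "\<dots> \<le> liminf (\<lambda>n. \<integral>\<^sup>+t. low r t * ennreal (?e t * (norm (Y n (D (t, \<omega>))))\<^sup>2) \<partial>lborel)"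
    by (rule nn_integral_liminf) measurable
  also have "\<dots> \<le> liminf (\<lambda>n. ennreal ?c + ennreal (1/2) * U r \<omega> + 3 * ?A n)"
    by (intro Liminf_mono always_eventually allI pathwise_bound \<omega> r)
  also have "\<dots> = ennreal ?c + ennreal (1/2) * U r \<omega> + 3 * liminf ?A"
  proof -
    obtain u where u: "U r \<omega> = ennreal u" "u \<ge> 0" using U_finite[OF \<omega> r] by (cases "U r \<omega>") auto
    have c: "ennreal ?c + ennreal (1/2) * U r \<omega> = ennreal (?c + 1/2 * u)"
      unfolding u(1) using u(2) cT_nonneg by (simp only: ennreal_mult[symmetric] ennreal_plus[symmetric] mult_nonneg_nonneg zero_le_power2) (simp add: ennreal_plus[symmetric] ennreal_mult[symmetric] del: ennreal_plus)?
    show ?thesis unfolding c using liminf_affine_ennreal[of "?c + 1/2 * u" 3 ?A] by simp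
  qed
  finally have "U r \<omega> \<le> ennreal ?c + ennreal (1/2) * U r \<omega> + 3 * liminf ?A" .
  from absorb_half[OF U_finite[OF \<omega> r] _ this] show ?thesis using cT_nonneg by (simp add: mult.assoc)
qed

lemma observation_expectation:
  assumes r: "r \<in> {0..T}"
  shows "(\<integral>\<^sup>+\<omega>. U r \<omega> \<partial>M) \<le> ennreal (6 * cT * (norm (x1 - x2))\<^sup>2) + ennreal (24 * cT * k\<^sup>2) * (\<integral>\<^sup>+s. low r s * v s \<partial>lborel)"
proof -
  let ?A = "\<lambda>n \<omega>. \<integral>\<^sup>+t. low r t * normsq (Y n (Z (t, \<omega>))) \<partial>lborel"
  let ?c = "6 * cT * (norm (x1 - x2))\<^sup>2"
  let ?V = "\<integral>\<^sup>+s. low r s * v s \<partial>lborel"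
  have "(\<integral>\<^sup>+\<omega>. U r \<omega> \<partial>M) \<le> (\<integral>\<^sup>+\<omega>. ennreal ?c + 6 * liminf (\<lambda>n. ?A n \<omega>) \<partial>M)"
    using AE_good by (intro nn_integral_mono_AE) (auto elim!: eventually_mono intro: observation_pathwise[OF _ r])
  also have "\<dots> = ennreal ?c + 6 * (\<integral>\<^sup>+\<omega>. liminf (\<lambda>n. ?A n \<omega>) \<partial>M)"
    by (simp add: nn_integral_add nn_integral_cmult emeasure_space_1)
  also have "\<dots> \<le> ennreal ?c + 6 * liminf (\<lambda>n. \<integral>\<^sup>+\<omega>. ?A n \<omega> \<partial>M)"
  proof -
    have "?A n \<in> borel_measurable M" for n by measurable
    then show ?thesis by (intro add_left_mono mult_left_mono nn_integral_liminf) auto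
  qed
  also have "\<dots> \<le> ennreal ?c + 6 * liminf (\<lambda>n::nat. ennreal (4 * cT * k\<^sup>2) * ?V)"
    by (intro add_left_mono mult_left_mono Liminf_mono always_eventually allI noise_observation r) simp
  also have "\<dots> = ennreal ?c + 6 * (ennreal (4 * cT * k\<^sup>2) * ?V)" by (simp add: Liminf_const)
  also have "6 * (ennreal (4 * cT * k\<^sup>2) * ?V) = ennreal (24 * cT * k\<^sup>2) * ?V"
  proof -
    have "6 * ennreal (4 * cT * k\<^sup>2) = ennreal (24 * cT * k\<^sup>2)" using ennreal_mult'[of 6 "4 * cT * k\<^sup>2"] by (simp add: mult.assoc)
    then show ?thesis by (simp only: mult.assoc[symmetric])
  qed
  finally show ?thesis .
qed

lemma convolution_pathwise:
  assumes \<omega>: "good \<omega>" and r: "r \<in> {0..T}"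
  shows "3 * normsq (cv (r, \<omega>)) \<le> ennreal b0 * U r \<omega>"
proof -
  let ?h = "\<lambda>s. (norm (h (s, \<omega>)))\<^sup>2"
  let ?g = "\<lambda>s. (norm (S' (r - s) (g (s, \<omega>))))\<^sup>2"
  let ?c = "(norm (cv (r, \<omega>)))\<^sup>2"
  let ?E = "exp (2 * \<mu> * T)"
  have [measurable]: "\<omega> \<in> space M" using \<omega> by (simp add: good_def)
  let ?e = "\<lambda>s. exp (- 2 * \<mu> * s)"
  have "(\<integral>\<^sup>+s. low r s * ennreal (?e s * (?g s)) \<partial>lborel)
    \<le> (\<integral>\<^sup>+s. ennreal (KT\<^sup>2 * k\<^sup>2) * (low r s * ennreal (?e s * (?h s))) \<partial>lborel)"
  proof (rule nn_integral_mono)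
    fix s
    show "low r s * ennreal (?e s * (?g s)) \<le> ennreal (KT\<^sup>2 * k\<^sup>2) * (low r s * ennreal (?e s * (?h s)))"
    proof (cases "0 \<le> s \<and> s \<le> r")
      case True
      have "norm (S' (r - s) (g (s, \<omega>))) \<le> KT * norm (g (s, \<omega>))" using True r by (intro norm_S'_KT) auto
      also have "\<dots> \<le> KT * (k * norm (h (s, \<omega>)))" using KT_pos norm_g by (intro mult_left_mono) auto
      finally have "(?g s) \<le> (KT * (k * norm (h (s, \<omega>))))\<^sup>2" by (intro power_mono) auto
      then have "?e s * (?g s) \<le> ?e s * (KT * (k * norm (h (s, \<omega>))))\<^sup>2" by (intro mult_left_mono) auto
      also have "\<dots> = (KT\<^sup>2 * k\<^sup>2) * (?e s * (?h s))" by (simp add: power_mult_distrib)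
      finally have "ennreal (?e s * (?g s)) \<le> ennreal ((KT\<^sup>2 * k\<^sup>2) * (?e s * (?h s)))" by (rule ennreal_leI)
      also have "\<dots> = ennreal (KT\<^sup>2 * k\<^sup>2) * ennreal (?e s * (?h s))" by (rule ennreal_mult) auto
      finally show ?thesis using True by (simp add: low_def)
    qed (auto simp: low_def)
  qed
  also have "\<dots> = ennreal (KT\<^sup>2 * k\<^sup>2) * U r \<omega>" unfolding U_def by (rule nn_integral_cmult) measurable
  finally have *: "(\<integral>\<^sup>+s. low r s * ennreal (?e s * (?g s)) \<partial>lborel) \<le> ennreal (KT\<^sup>2 * k\<^sup>2) * U r \<omega>" .
  have "ennreal (?e r * ?c) \<le> ennreal (1 / (2 * \<mu>)) * (\<integral>\<^sup>+s. low r s * ennreal (?e s * (?g s)) \<partial>lborel)"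
    using convolution_bound[OF \<omega> r, of id_blinfun] by simp
  also have "\<dots> \<le> ennreal (1 / (2 * \<mu>)) * (ennreal (KT\<^sup>2 * k\<^sup>2) * U r \<omega>)"
    by (rule mult_left_mono[OF *]) simp
  finally have **: "ennreal (?e r * ?c) \<le> ennreal (1 / (2 * \<mu>)) * (ennreal (KT\<^sup>2 * k\<^sup>2) * U r \<omega>)" .
  have "?c = exp (2 * \<mu> * r) * (?e r * ?c)"
    by (simp add: mult.assoc[symmetric] exp_add[symmetric])
  also have "\<dots> \<le> ?E * (?e r * ?c)"
    using r \<mu>_pos by (intro mult_right_mono) auto
  finally have "normsq (cv (r, \<omega>)) \<le> ennreal (?E * (?e r * ?c))" by (rule ennreal_leI)
  also have "\<dots> = ennreal (?E) * ennreal (?e r * ?c)" by (rule ennreal_mult) auto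
  also have "\<dots> \<le> ennreal (?E) * (ennreal (1 / (2 * \<mu>)) * (ennreal (KT\<^sup>2 * k\<^sup>2) * U r \<omega>))"
    by (rule mult_left_mono[OF **]) simp
  finally have "3 * normsq (cv (r, \<omega>)) \<le> ennreal 3 * (ennreal (?E) * (ennreal (1 / (2 * \<mu>)) * (ennreal (KT\<^sup>2 * k\<^sup>2) * U r \<omega>)))"
    by (simp add: mult_left_mono)
  also have "\<dots> = ennreal (3 * (?E * (1 / (2 * \<mu>) * (KT\<^sup>2 * k\<^sup>2)))) * U r \<omega>"
  proof -
    have "ennreal (a * (b * (c * d))) = ennreal a * (ennreal b * (ennreal c * ennreal d))"
      if "a \<ge> 0" "b \<ge> 0" "c \<ge> 0" "d \<ge> 0" for a b c d :: real
      using that by (simp add: ennreal_mult)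
    from this[of 3 "?E" "1 / (2 * \<mu>)" "KT\<^sup>2 * k\<^sup>2"] \<mu>_pos
    have "ennreal (3 * (?E * (1 / (2 * \<mu>) * (KT\<^sup>2 * k\<^sup>2))))
        = ennreal 3 * (ennreal (?E) * (ennreal (1 / (2 * \<mu>)) * ennreal (KT\<^sup>2 * k\<^sup>2)))"
      by (auto simp del: ennreal_numeral)
    then show ?thesis by (simp only: mult.assoc)
  qed
  also have "3 * (?E * (1 / (2 * \<mu>) * (KT\<^sup>2 * k\<^sup>2))) = b0" by (simp add: b0_def)
  finally show ?thesis .
qed

text \<open>
  Taking expectations in the decomposition of \<open>D\<close>: the drift convolution is controlled by the energy
  \<open>U\<close>, and both its expectation and the noise are controlled by the time integral of \<open>v\<close>.\<close>

lemma second_moment_inequality: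
  assumes r: "r \<in> {0..T}"
  shows "v r \<le> ennreal ((3 * KT\<^sup>2 + b0 * (6 * cT)) * (norm (x1 - x2))\<^sup>2)
     + ennreal (b0 * (24 * cT * k\<^sup>2) + 12 * KT\<^sup>2 * k\<^sup>2) * (\<integral>\<^sup>+s. low r s * v s \<partial>lborel)"
proof -
  let ?d = "(norm (x1 - x2))\<^sup>2"
  let ?V = "\<integral>\<^sup>+s. low r s * v s \<partial>lborel"
  have "v r \<le> (\<integral>\<^sup>+\<omega>. ennreal (3 * KT\<^sup>2 * ?d) + ennreal b0 * U r \<omega> + 3 * normsq (Z (r, \<omega>)) \<partial>M)"
    unfolding v_def
  proof (rule nn_integral_mono_AE, use AE_good in eventually_elim)
    fix \<omega> assume \<omega>: "good \<omega>"
    have "norm (S' r (x1 - x2)) \<le> KT * norm (x1 - x2)" using r by (intro norm_S'_KT) auto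
    then have "(norm (S' r (x1 - x2)))\<^sup>2 \<le> KT\<^sup>2 * ?d" by (metis norm_ge_zero power_mono power_mult_distrib)
    then have "(norm (D (r, \<omega>)))\<^sup>2 \<le> 3 * KT\<^sup>2 * ?d + 3 * (norm (cv (r, \<omega>)))\<^sup>2 + 3 * (norm (Z (r, \<omega>)))\<^sup>2"
      using norm_add3_sq_le[of "S' r (x1 - x2)" "cv (r, \<omega>)" "Z (r, \<omega>)"] unfolding decomposition(2)[OF \<omega> r] by simp
    then have "normsq (D (r, \<omega>)) \<le> ennreal (3 * KT\<^sup>2 * ?d + 3 * (norm (cv (r, \<omega>)))\<^sup>2 + 3 * (norm (Z (r, \<omega>)))\<^sup>2)"
      by (rule ennreal_leI)
    also have "\<dots> = ennreal (3 * KT\<^sup>2 * ?d) + 3 * normsq (cv (r, \<omega>)) + 3 * normsq (Z (r, \<omega>))"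
      by (simp add: ennreal_plus ennreal_mult'')
    also have "\<dots> \<le> ennreal (3 * KT\<^sup>2 * ?d) + ennreal b0 * U r \<omega> + 3 * normsq (Z (r, \<omega>))"
      by (intro add_right_mono add_left_mono convolution_pathwise \<omega> r)
    finally show "normsq (D (r, \<omega>)) \<le> ennreal (3 * KT\<^sup>2 * ?d) + ennreal b0 * U r \<omega> + 3 * normsq (Z (r, \<omega>))" .
  qed
  also have "\<dots> = ennreal (3 * KT\<^sup>2 * ?d) + ennreal b0 * (\<integral>\<^sup>+\<omega>. U r \<omega> \<partial>M) + 3 * (\<integral>\<^sup>+\<omega>. normsq (Z (r, \<omega>)) \<partial>M)"
    by (simp add: nn_integral_add nn_integral_cmult emeasure_space_1)
  also have "\<dots> \<le> ennreal (3 * KT\<^sup>2 * ?d) + ennreal b0 * (ennreal (6 * cT * ?d) + ennreal (24 * cT * k\<^sup>2) * ?V) + 3 * (ennreal (4 * KT\<^sup>2 * k\<^sup>2) * ?V)"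
    by (intro add_mono add_left_mono mult_left_mono observation_expectation noise_second_moment r) auto
  also have "\<dots> = (ennreal (3 * KT\<^sup>2 * ?d) + ennreal b0 * ennreal (6 * cT * ?d)) + (ennreal b0 * ennreal (24 * cT * k\<^sup>2) + 3 * ennreal (4 * KT\<^sup>2 * k\<^sup>2)) * ?V"
    by (simp only: distrib_left distrib_right mult.assoc add_ac)
  also have "ennreal (3 * KT\<^sup>2 * ?d) + ennreal b0 * ennreal (6 * cT * ?d) = ennreal ((3 * KT\<^sup>2 + b0 * (6 * cT)) * ?d)"
    using b0_nonneg cT_nonneg by (simp add: ennreal_mult[symmetric] ennreal_plus[symmetric] algebra_simps del: ennreal_plus)
  also have "ennreal b0 * ennreal (24 * cT * k\<^sup>2) + 3 * ennreal (4 * KT\<^sup>2 * k\<^sup>2) = ennreal (b0 * (24 * cT * k\<^sup>2) + 12 * KT\<^sup>2 * k\<^sup>2)"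
  proof -
    have "3 * ennreal (4 * KT\<^sup>2 * k\<^sup>2) = ennreal (12 * KT\<^sup>2 * k\<^sup>2)" using ennreal_mult'[of 3 "4 * KT\<^sup>2 * k\<^sup>2"] by (simp add: mult.assoc)
    then show ?thesis using b0_nonneg cT_nonneg by (simp add: ennreal_mult[symmetric] ennreal_plus[symmetric] del: ennreal_plus)
  qed
  finally show ?thesis .
qed

lemma mean_square_dependence:
  assumes t: "t \<in> {0..T}"
  shows "(\<integral>\<^sup>+\<omega>. normsq (X1 t \<omega> - X2 t \<omega>) \<partial>M) \<le> ennreal (growth * (norm (x1 - x2))\<^sup>2)"
proof -
  have v: "v s = (\<integral>\<^sup>+\<omega>. normsq (X1 s \<omega> - X2 s \<omega>) \<partial>M)" if "s \<in> {0..T}" for s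
    using that by (simp add: v_def D_def ext_def trunc_def)
  obtain B1 where B1: "B1 \<ge> 0" "\<And>t. t \<in> {0..T} \<Longrightarrow> (\<integral>\<^sup>+\<omega>. normsq (X1 t \<omega>) \<partial>M) \<le> ennreal B1"
    using second_moment_bounded[OF X1] by blast
  obtain B2 where B2: "B2 \<ge> 0" "\<And>t. t \<in> {0..T} \<Longrightarrow> (\<integral>\<^sup>+\<omega>. normsq (X2 t \<omega>) \<partial>M) \<le> ennreal B2"
    using second_moment_bounded[OF X2] by blast
  have bd: "v s \<le> ennreal (2 * B1 + 2 * B2)" if s: "0 \<le> s" "s \<le> T" for s
  proof -
    have s': "s \<in> {0..T}" using s by simp
    have [measurable]: "X1 s \<in> borel_measurable M" "X2 s \<in> borel_measurable M"
      using X1 X2 s measurable_FF[OF s(1)] by (auto simp: mild_solution_def C_adapted_def)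
    have "v s \<le> (\<integral>\<^sup>+\<omega>. 2 * normsq (X1 s \<omega>) + 2 * normsq (X2 s \<omega>) \<partial>M)"
      unfolding v[OF s']
    proof (rule nn_integral_mono)
      fix \<omega>
      have "(norm (X1 s \<omega> - X2 s \<omega>))\<^sup>2 \<le> 2 * (norm (X1 s \<omega>))\<^sup>2 + 2 * (norm (X2 s \<omega>))\<^sup>2"
        using norm_add_sq_le[of "X1 s \<omega>" "- X2 s \<omega>"] by simp
      from ennreal_leI[OF this] show "normsq (X1 s \<omega> - X2 s \<omega>) \<le> 2 * normsq (X1 s \<omega>) + 2 * normsq (X2 s \<omega>)"
        by (simp add: ennreal_mult')
    qed
    also have "\<dots> = 2 * (\<integral>\<^sup>+\<omega>. normsq (X1 s \<omega>) \<partial>M) + 2 * (\<integral>\<^sup>+\<omega>. normsq (X2 s \<omega>) \<partial>M)"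
      by (simp add: nn_integral_add nn_integral_cmult)
    also have "\<dots> \<le> 2 * ennreal B1 + 2 * ennreal B2" by (intro add_mono mult_left_mono B1 B2 s') auto
    also have "\<dots> = ennreal (2 * B1 + 2 * B2)" using B1 B2 by (simp add: ennreal_mult' ennreal_plus)
    finally show ?thesis .
  qed
  have "v t \<le> ennreal (2 * ((3 * KT\<^sup>2 + b0 * (6 * cT)) * (norm (x1 - x2))\<^sup>2) * exp (2 * ((b0 * (24 * cT * k\<^sup>2) + 12 * KT\<^sup>2 * k\<^sup>2) + 1) * T))"
  proof (rule gronwall_nn_integral[OF v_measurable _ _ bd])
    show "(3 * KT\<^sup>2 + b0 * (6 * cT)) * (norm (x1 - x2))\<^sup>2 \<ge> 0" "b0 * (24 * cT * k\<^sup>2) + 12 * KT\<^sup>2 * k\<^sup>2 \<ge> 0"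
      using b0_nonneg cT_nonneg by auto
    show "v s \<le> ennreal ((3 * KT\<^sup>2 + b0 * (6 * cT)) * (norm (x1 - x2))\<^sup>2)
       + ennreal (b0 * (24 * cT * k\<^sup>2) + 12 * KT\<^sup>2 * k\<^sup>2) * (\<integral>\<^sup>+r. indicator {0..s} r * v r \<partial>lborel)" if "0 \<le> s" "s \<le> T" for s
      using second_moment_inequality[of s] that by (simp add: low_indicator)
  qed (use t in auto)
  also have "2 * ((3 * KT\<^sup>2 + b0 * (6 * cT)) * (norm (x1 - x2))\<^sup>2) * exp (2 * ((b0 * (24 * cT * k\<^sup>2) + 12 * KT\<^sup>2 * k\<^sup>2) + 1) * T) = growth * (norm (x1 - x2))\<^sup>2"
    unfolding growth_def by (simp only: mult_ac)
  finally show ?thesis unfolding v[OF t] .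
qed

end

section \<open>The Feller property\<close>

text \<open>
  If convergence failed, a subsequence would stay away from the limit; it has a further subsequence
  that converges almost surely, for which dominated convergence gives a contradiction.\<close>

lemma (in prob_space) expectation_continuous_of_mean_square:
  fixes Xi :: "'h::real_normed_vector \<Rightarrow> 'a \<Rightarrow> 'h2::{banach,second_countable_topology}" and \<phi> :: "'h2 \<Rightarrow> real"
  assumes meas [measurable]: "\<And>x. Xi x \<in> borel_measurable M"
    and lip: "\<And>x y. (\<integral>\<^sup>+\<omega>. normsq (Xi x \<omega> - Xi y \<omega>) \<partial>M) \<le> ennreal (B * (norm (x - y))\<^sup>2)"
    and \<phi>: "continuous_on UNIV \<phi>" and bdd: "\<And>y. \<bar>\<phi> y\<bar> \<le> b"
  shows "continuous_on UNIV (\<lambda>x. expectation (\<lambda>\<omega>. \<phi> (Xi x \<omega>)))"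
proof (rule continuous_on_sequentiallyI)
  fix u :: "nat \<Rightarrow> 'h" and x assume u: "u \<longlonglongrightarrow> x"
  have [measurable]: "\<phi> \<in> borel_measurable borel" using \<phi> by (rule borel_measurable_continuous_onI)
  let ?P = "\<lambda>x. expectation (\<lambda>\<omega>. \<phi> (Xi x \<omega>))"
  let ?q = "\<lambda>n \<omega>. (norm (Xi (u n) \<omega> - Xi x \<omega>))\<^sup>2"
  have int: "integrable M (?q n)" for n
    using lip[of "u n" x] by (intro integrableI_nonneg) (auto simp: le_less_trans[OF _ ennreal_less_top])
  have lim0: "(\<lambda>n. expectation (?q n)) \<longlonglongrightarrow> 0"
  proof (rule tendsto_sandwich[OF _ _ tendsto_const])
    show "(\<lambda>n. \<bar>B\<bar> * (norm (u n - x))\<^sup>2) \<longlonglongrightarrow> 0"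
      using u by (auto intro!: tendsto_eq_intros)
    show "\<forall>\<^sub>F n in sequentially. expectation (?q n) \<le> \<bar>B\<bar> * (norm (u n - x))\<^sup>2"
    proof (intro always_eventually allI)
      fix n
      have "ennreal (expectation (?q n)) = (\<integral>\<^sup>+\<omega>. ennreal (?q n \<omega>) \<partial>M)" using int by (subst nn_integral_eq_integral) auto
      also have "\<dots> \<le> ennreal (B * (norm (u n - x))\<^sup>2)" by (rule lip)
      also have "\<dots> \<le> ennreal (\<bar>B\<bar> * (norm (u n - x))\<^sup>2)" by (intro ennreal_leI mult_right_mono) auto
      finally show "expectation (?q n) \<le> \<bar>B\<bar> * (norm (u n - x))\<^sup>2" by (subst (asm) ennreal_le_iff) auto
    qed
    show "\<forall>\<^sub>F n in sequentially. 0 \<le> expectation (?q n)" by (intro always_eventually allI Bochner_Integration.integral_nonneg) simp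
  qed
  show "(\<lambda>n. ?P (u n)) \<longlonglongrightarrow> ?P x"
  proof (rule ccontr)
    assume "\<not> (\<lambda>n. ?P (u n)) \<longlonglongrightarrow> ?P x"
    then obtain \<epsilon> where \<epsilon>: "\<epsilon> > 0" "\<And>N. \<exists>n\<ge>N. dist (?P (u n)) (?P x) \<ge> \<epsilon>"
      unfolding lim_sequentially by (meson not_less)
    then have inf: "infinite {n. dist (?P (u n)) (?P x) \<ge> \<epsilon>}"
      unfolding infinite_nat_iff_unbounded_le by blast
    obtain s :: "nat \<Rightarrow> nat" where s: "strict_mono s" "\<And>n. s n \<in> {n. dist (?P (u n)) (?P x) \<ge> \<epsilon>}"
      using infinite_enumerate[OF inf] by blast
    have "(\<lambda>n. \<integral>\<omega>. norm (?q (s n) \<omega>) \<partial>M) \<longlonglongrightarrow> 0"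
      using LIMSEQ_subseq_LIMSEQ[OF lim0 s(1)] by (simp add: comp_def)
    from tendsto_L1_AE_subseq[OF int this]
    obtain r where r: "strict_mono r" "AE \<omega> in M. (\<lambda>n. ?q (s (r n)) \<omega>) \<longlonglongrightarrow> 0" by blast
    have "(\<lambda>n. ?P (u (s (r n)))) \<longlonglongrightarrow> ?P x"
    proof (rule integral_dominated_convergence[where w = "\<lambda>_. b"])
      show "AE \<omega> in M. (\<lambda>n. \<phi> (Xi (u (s (r n))) \<omega>)) \<longlonglongrightarrow> \<phi> (Xi x \<omega>)"
        using r(2)
      proof eventually_elim
        fix \<omega> assume "(\<lambda>n. ?q (s (r n)) \<omega>) \<longlonglongrightarrow> 0"
        then have "(\<lambda>n. sqrt (?q (s (r n)) \<omega>)) \<longlonglongrightarrow> sqrt 0" by (rule tendsto_real_sqrt)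
        then have "(\<lambda>n. Xi (u (s (r n))) \<omega> - Xi x \<omega>) \<longlonglongrightarrow> 0" by (simp add: tendsto_norm_zero_iff)
        then have "(\<lambda>n. Xi (u (s (r n))) \<omega>) \<longlonglongrightarrow> Xi x \<omega>" by (simp add: LIM_zero_iff)
        then show "(\<lambda>n. \<phi> (Xi (u (s (r n))) \<omega>)) \<longlonglongrightarrow> \<phi> (Xi x \<omega>)"
          using \<phi> by (intro isCont_tendsto_compose[of _ \<phi>]) (auto simp: continuous_on_eq_continuous_at)
      qed
    qed (use bdd in auto)
    then have "\<forall>\<^sub>F n in sequentially. dist (?P (u (s (r n)))) (?P x) < \<epsilon>" using \<epsilon>(1) by (rule tendstoD)
    then obtain n where "dist (?P (u (s (r n)))) (?P x) < \<epsilon>" by (auto simp: eventually_sequentially)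
    with s(2)[of "r n"] show False by simp
  qed
qed

theorem proposition4p2:
  fixes M :: "'w measure" and \<F> :: "real \<Rightarrow> 'w measure"
    and Q :: "'v \<Rightarrow>\<^sub>L 'v::{real_inner,banach,second_countable_topology}"
    and I :: "nat set" and lam :: "nat \<Rightarrow> real" and e :: "nat \<Rightarrow> 'v"
    and \<beta> :: "nat \<Rightarrow> real \<Rightarrow> 'w \<Rightarrow> real" and W :: "real \<Rightarrow> 'w \<Rightarrow> 'v"
    and S :: "real \<Rightarrow> 'h \<Rightarrow>\<^sub>L 'h::{real_inner,banach,second_countable_topology}"
    and DA :: "'h set" and A :: "'h \<Rightarrow> 'h"
    and \<Z> :: "'h set" and \<C> :: "'h \<Rightarrow> 'h" and C :: "'h \<Rightarrow> 'h"
    and F :: "'h \<Rightarrow> 'h" and \<M> :: "'h \<Rightarrow> 'v \<Rightarrow> 'h"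
    and k T :: real and X :: "'h \<Rightarrow> real \<Rightarrow> 'w \<Rightarrow> 'h"
  assumes "prob_space M" and "complete_measure M" and "normal_filtration M \<F>"
    and "Q_wiener M \<F> Q I lam e \<beta> W"
    and "C0_semigroup S" and "generator S DA A"
    and "linear_on_subspace \<Z> \<C>" and "DA \<subseteq> \<Z>"
    and "C = restrict \<C> DA" and "admissible S DA A C"
    and "\<forall>x. \<M> x \<in> L20 I lam e"
    and "k > 0"
    and "\<forall>x y. norm (F x - F y) + HS_norm I lam e (\<lambda>v. \<M> x v - \<M> y v) \<le> k * norm (x - y)"
    and "T > 0"
    and "\<forall>x. mild_solution M \<F> I lam e W S DA A C F \<M> T x (X x)"
  shows "\<forall>t\<in>{0..T}. transition M X t ` bcontfun \<subseteq> bcontfun"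
proof -
  interpret prob_space M by fact
  interpret stochastic_equation M \<F> Q I lam e \<beta> W S DA A C F \<M> k T
    using assms by unfold_locales auto
  have sol: "sol x (X x)" for x using assms by blast
  have dependence: "(\<integral>\<^sup>+\<omega>. normsq (X x t \<omega> - X y t \<omega>) \<partial>M) \<le> ennreal (growth * (norm (x - y))\<^sup>2)"
    if t: "t \<in> {0..T}" for x y t
  proof -
    interpret solution_pair M \<F> Q I lam e \<beta> W S DA A C F \<M> k T x y "X x" "X y"
      by unfold_locales (rule sol)+
    show ?thesis by (rule mean_square_dependence[OF t])
  qed
  show ?thesis
  proof (intro ballI image_subsetI)
    fix t and \<phi> :: "'h \<Rightarrow> real" assume t: "t \<in> {0..T}" and "\<phi> \<in> bcontfun"
    then have \<phi>: "continuous_on UNIV \<phi>" and "bounded (range \<phi>)" by (auto simp: bcontfun_def)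
    then obtain b where b: "\<And>y. \<bar>\<phi> y\<bar> \<le> b" unfolding bounded_iff by auto
    have [measurable]: "\<phi> \<in> borel_measurable borel" using \<phi> by (rule borel_measurable_continuous_onI)
    have meas [measurable]: "X x t \<in> borel_measurable M" for x
      using sol[of x] t measurable_FF[of t] by (auto simp: mild_solution_def C_adapted_def)
    have b0: "b \<ge> 0" using b[of 0] by linarith
    have cont: "continuous_on UNIV (transition M X t \<phi>)"
      unfolding transition_def[abs_def]
      by (rule expectation_continuous_of_mean_square[OF meas dependence[OF t] \<phi> b])
    have "\<bar>transition M X t \<phi> x\<bar> \<le> b" for x
    proof -
      have "\<bar>expectation (\<lambda>\<omega>. \<phi> (X x t \<omega>))\<bar> \<le> expectation (\<lambda>\<omega>. \<bar>\<phi> (X x t \<omega>)\<bar>)" by (rule integral_abs_bound)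
      also have "\<dots> \<le> expectation (\<lambda>\<omega>. b)"
        using b b0 by (intro integral_mono integrable_const_bound[where B = b]) auto
      finally show ?thesis by (simp add: transition_def prob_space)
    qed
    then have "bounded (range (transition M X t \<phi>))" by (auto simp: bounded_iff)
    with cont show "transition M X t \<phi> \<in> bcontfun" by (simp add: bcontfun_def)
  qed
qed

end
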